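(* Let $s=a+ib$ with $a>0$, $b\in\mathbb{R}$, let $k\in[0,1)$, and let $f\in\mathcal{A}$. Assume that there is a constant $c\in\mathbb{C}$ such that, for all $z\in\mathbb{D}$, the expression below is defined and finite (with $zf'(z)/f(z)$ interpreted as $1$ at $z=0$) and $$\left| c|z|^{2}+s-a(1-|z|^{2})\left\{s\left(1+ \frac{zf''(z)}{f'(z)}\right)+(1-s)\frac{zf'(z)}{f(z)}\right\}\right|\leq M,$$ where $$M=\begin{cases} ak|s|+(a-1)|s+c|, & 0<a\le 1,\\ k|s|, & a>1.\end{cases}$$ Then $f$ has an $l$-quasiconformal extension to $\mathbb{C}$, where $$l=\frac{2ka+(1-k^{2})|b|}{(1+k^{2})a+(1-k^{2})|s|}<1.$$
   Context: $\mathbb{D}=\{z\in\mathbb{C}:|z|<1\}$. $\mathcal{A}$ denotes the family of analytic functions $f$ on $\mathbb{D}$ of the form $f(z)=z+\sum_{n\ge2}a_nz^n$. A sense-preserving homeomorphism $F$ of a plane domain $G$ is $k$-quasiconformal ($0\le k<1$) if $F$ is absolutely continuous on almost all lines parallel to the coordinate axes and $|F_{\bar z}|\le k|F_z|$ almost everywhere in $G$. "$f$ has an $l$-quasiconformal extension to $\mathbb{C}$" means there is an $l$-quasiconformal homeomorphism of $\mathbb{C}$ onto itself whose restriction to $\mathbb{D}$ is $f$. *)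

theory Defs
  imports "HOL-Analysis.Analysis"
begin

abbreviation unit_disc :: "complex set" where
  "unit_disc \<equiv> ball 0 1"

definition classA :: "(complex \<Rightarrow> complex) \<Rightarrow> bool" where
  "classA f \<longleftrightarrow> f holomorphic_on unit_disc \<and> f 0 = 0 \<and> deriv f 0 = 1"

definition abs_cont_on :: "(real \<Rightarrow> complex) \<Rightarrow> real \<Rightarrow> real \<Rightarrow> bool" where
  "abs_cont_on g \<alpha> \<beta> \<longleftrightarrow>
     (\<forall>\<epsilon>>0. \<exists>\<delta>>0. \<forall>(n::nat) (u::nat \<Rightarrow> real) (v::nat \<Rightarrow> real).
        (\<forall>i<n. \<alpha> \<le> u i \<and> u i \<le> v i \<and> v i \<le> \<beta>) \<and>
        (\<forall>i<n. \<forall>j<n. i \<noteq> j \<longrightarrow> v i \<le> u j \<or> v j \<le> u i) \<and>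
        (\<Sum>i<n. v i - u i) < \<delta> \<longrightarrow>
        (\<Sum>i<n. norm (g (v i) - g (u i))) < \<epsilon>)"

definition ACL :: "(complex \<Rightarrow> complex) \<Rightarrow> bool" where
  "ACL F \<longleftrightarrow>
     (AE y in lebesgue. \<forall>\<alpha> \<beta>. abs_cont_on (\<lambda>x. F (Complex x y)) \<alpha> \<beta>) \<and>
     (AE x in lebesgue. \<forall>\<alpha> \<beta>. abs_cont_on (\<lambda>y. F (Complex x y)) \<alpha> \<beta>)"

definition has_partial_x :: "(complex \<Rightarrow> complex) \<Rightarrow> complex \<Rightarrow> complex \<Rightarrow> bool" where
  "has_partial_x F z D \<longleftrightarrow> ((\<lambda>t. F (z + complex_of_real t)) has_vector_derivative D) (at 0)"

definition has_partial_y :: "(complex \<Rightarrow> complex) \<Rightarrow> complex \<Rightarrow> complex \<Rightarrow> bool" where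
  "has_partial_y F z D \<longleftrightarrow> ((\<lambda>t. F (z + \<i> * complex_of_real t)) has_vector_derivative D) (at 0)"

text \<open>F is an l-quasiconformal homeomorphism of the complex plane onto itself:
  a homeomorphism of C onto C, ACL, and a.e. |F_zbar| <= l |F_z|, where
  F_z = (F_x - i F_y)/2 and F_zbar = (F_x + i F_y)/2.\<close>
definition qc_homeo :: "real \<Rightarrow> (complex \<Rightarrow> complex) \<Rightarrow> bool" where
  "qc_homeo l F \<longleftrightarrow>
     (\<exists>G. homeomorphism UNIV UNIV F G) \<and> ACL F \<and>
     (AE z in lebesgue. \<exists>Fx Fy. has_partial_x F z Fx \<and> has_partial_y F z Fy \<and>
         norm ((Fx + \<i> * Fy) / 2) \<le> l * norm ((Fx - \<i> * Fy) / 2))"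

definition has_qc_extension :: "real \<Rightarrow> (complex \<Rightarrow> complex) \<Rightarrow> bool" where
  "has_qc_extension l f \<longleftrightarrow> (\<exists>F. qc_homeo l F \<and> (\<forall>z\<in>unit_disc. F z = f z))"

end

(*
  Put a = Re s, phi v = log f (exp v) on the left half-plane and A x = exp (2 x / a) - 1. Outside the unit
  disc the extension is
      F z = f w * (1 - a / c * (|z| powr (2 / a) - 1) * w f' w / f w) powr s,   w = 1 / cnj z,
  which is the Loewner chain f_t of the criterion read along the spirals z = exp (cnj s * t + i theta);
  its complex dilatation is (W + s) / s up to a unimodular factor, where W + s is the expression of the
  hypothesis at w with |w|^2 replaced by |w| powr (2 / a). Convexity turns the hypothesis into
  |W + s| <= k |s|, so F is even k-quasiconformal, and k <= l.

  Everything happens for log F in the coordinate log z. The principal logarithm of the bracket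
  exists because the bracket avoids the closed negative axis: a maximum principle for E = c / (a phi'),
  since at a point violating this E could be increased along the positive reals inside the bad set.
  Replacing f by f (exp (- e) z) with e > 0 makes the map piecewise smooth up to the circle with positive
  Jacobian on both sides, hence a proper local homeomorphism of the plane with a value taken only once,
  hence a homeomorphism. For e -> 0 the bound |h'| <= C (- Re v) powr (- k) for h = exp (phi / s) gives
  Hoelder continuity up to the circle once h is known not to vanish there, fibres of the limit
  are connected, and a non-trivial fibre would be an arc of the circle on which f is constant.
  The same bound on the derivative gives absolute continuity on lines.
*)
theory Submission
  imports Defs "HOL-Complex_Analysis.Complex_Analysis" "HOL-Homology.Invariance_of_Domain"
begin

subsection \<open>Local injectivity, proper maps and limits of homeomorphisms\<close>

text \<open>The passage to e = 0 rests on one coincidence. For h = exp (phi / s) the logarithmic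
  derivative of h' is exactly H / s, where H is the braced expression of the hypothesis, and the
  hypothesis bounds H / s by k / (- Re v) up to a constant. As k < 1, the resulting singularity of
  h' is integrable; this serves continuity up to the circle as well as absolute continuity on lines.
  What the extension itself needs, however, is a bound on phi' = s h' / h, so zeros of h on the
  boundary have to be excluded by a separate, topological argument. There h is not periodic unless s
  is real, which dictates the direction of the half-strip used.

  The two cases of M come from the mismatch between 1 - |z|^2 in the hypothesis and 1 - |z| powr (2
  / a) in the construction: for a > 1 the latter is smaller and interpolation suffices; for a < 1 it
  is larger and the expression has to be extrapolated, which the summand (a - 1)|s + c| of M pays
  for.\<close>

lemma less_if_deriv_pos_except_point:
  fixes g :: "real \<Rightarrow> real"
  assumes cont: "continuous_on {0..1} g"
    and der: "\<And>t. 0 < t \<Longrightarrow> t < 1 \<Longrightarrow> t \<noteq> t0 \<Longrightarrow> \<exists>D. (g has_real_derivative D) (at t) \<and> D > 0"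
  shows "g 0 < g 1"
proof (cases "0 < t0 \<and> t0 < 1")
  case True
  have "g 0 < g t0"
    by (rule DERIV_pos_imp_increasing_open[where f = g])
       (use True in \<open>auto intro!: der intro: continuous_on_subset[OF cont]\<close>)
  also have "g t0 < g 1"
    by (rule DERIV_pos_imp_increasing_open[where f = g])
       (use True in \<open>auto intro!: der intro: continuous_on_subset[OF cont]\<close>)
  finally show ?thesis .
next
  case False
  show ?thesis
    by (rule DERIV_pos_imp_increasing_open[where f = g]) (use False der cont in auto)
qed

text \<open>The tangential derivative \<open>D\<close> is continuous across the line and only the
  normal factor \<open>P\<close> jumps, staying in a bounded part of the right half-plane. The
  velocity of the image of a short segment then keeps to one open half-plane, so the two ends cannot
  have the same image.\<close>

lemma locally_injective_across_line:
  fixes R D P :: "complex \<Rightarrow> complex" and u0 :: complex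
  assumes r: "r > 0" and cont: "continuous_on (ball u0 r) R"
    and D0: "D u0 \<noteq> 0" and contD: "isCont D u0"
    and der: "\<And>u. u \<in> ball u0 r \<Longrightarrow> Re u \<noteq> 0 \<Longrightarrow>
      (R has_derivative (\<lambda>h. (of_real (Re h) * P u + \<i> * of_real (Im h)) * D u)) (at u)"
    and vert: "\<And>u. u \<in> ball u0 r \<Longrightarrow> Re u = 0 \<Longrightarrow>
      ((\<lambda>t. R (u + \<i> * of_real t)) has_vector_derivative \<i> * D u) (at 0)"
    and m: "0 < m" "m \<le> 1" "1 \<le> C"
    and P: "\<And>u. u \<in> ball u0 r \<Longrightarrow> Re u \<noteq> 0 \<Longrightarrow> m \<le> Re (P u)"
      "\<And>u. u \<in> ball u0 r \<Longrightarrow> Re u \<noteq> 0 \<Longrightarrow> cmod (P u) \<le> C"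
  shows "\<exists>d>0. inj_on R (ball u0 d)"
proof -
  \<comment> \<open>The bound \<open>3 * e * C < m\<close> serves the segments that are not steep,
    \<open>e \<le> 1/4\<close> the steep ones.\<close>
  define e where "e = m / (4 * C)"
  have e: "0 < e" "e \<le> 1/4" "3 * e * C < m" using m by (auto simp: e_def field_simps)
  have "isCont (\<lambda>u. D u / D u0) u0" using contD D0 by simp
  from this[unfolded continuous_at_eps_delta, rule_format, OF e(1)]
  obtain d0 where d0: "d0 > 0" "\<And>u. dist u u0 < d0 \<Longrightarrow> dist (D u / D u0) 1 < e"
    using D0 by (auto simp: dist_norm)
  define d where "d = min d0 r"
  have d: "d > 0" "ball u0 d \<subseteq> ball u0 r" using d0 r by (auto simp: d_def)
  have False if pq: "p \<in> ball u0 d" "q \<in> ball u0 d" "p \<noteq> q" and eq: "R p = R q" for p q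
  proof -
    define dx dy where "dx = Re (q - p)" and "dy = Im (q - p)"
    define \<gamma> where "\<gamma> t = p + of_real t * (q - p)" for t :: real
    \<comment> \<open>The parameter at which the segment meets the line. For a vertical segment
      division by zero gives \<open>t0 = 0\<close>, which excludes no interior parameter.\<close>
    define t0 where "t0 = - Re p / dx"
    define g where "g t = R (\<gamma> t) / D u0" for t :: real
    have \<gamma>b: "\<gamma> t \<in> ball u0 d" if "0 \<le> t" "t \<le> 1" for t
    proof -
      have "\<gamma> t \<in> closed_segment p q"
        using that by (auto simp: \<gamma>_def closed_segment_def scaleR_conv_of_real algebra_simps intro!: exI[of _ t])
      then show ?thesis using closed_segment_subset[OF pq(1,2) convex_ball] by blast
    qed
    have qp: "q - p = Complex dx dy" by (simp add: dx_def dy_def complex_eq_iff)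
    have \<gamma>d: "(\<gamma> has_vector_derivative (q - p)) (at t)" for t
      unfolding \<gamma>_def by (auto intro!: derivative_eq_intros)
    have key: "\<exists>Q E. m \<le> Re Q \<and> cmod Q \<le> C \<and> cmod E \<le> e \<and>
        (g has_vector_derivative (of_real dx * Q + \<i> * of_real dy) * (1 + E)) (at t)"
      if t: "0 < t" "t < 1" "t \<noteq> t0" for t
    proof -
      define u where "u = \<gamma> t"
      have u: "u \<in> ball u0 d" "u \<in> ball u0 r" using \<gamma>b[of t] t d by (auto simp: u_def)
      have "dist (D u / D u0) 1 < e" using d0(2)[of u] u by (auto simp: d_def dist_commute)
      then have E: "cmod (D u / D u0 - 1) \<le> e" by (simp add: dist_norm)
      have "\<exists>Q. m \<le> Re Q \<and> cmod Q \<le> C \<and>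
          ((\<lambda>t. R (\<gamma> t)) has_vector_derivative (of_real dx * Q + \<i> * of_real dy) * D u) (at t)"
      proof (cases "Re u = 0")
        case False
        have "((\<lambda>t. R (\<gamma> t)) has_derivative
           (\<lambda>x. (of_real (Re (x *\<^sub>R (q-p))) * P u + \<i> * of_real (Im (x *\<^sub>R (q-p)))) * D u)) (at t)"
          by (rule has_derivative_compose[OF \<gamma>d[unfolded has_vector_derivative_def]])
             (use der[OF u(2) False] in \<open>simp add: u_def\<close>)
        then have "((\<lambda>t. R (\<gamma> t)) has_vector_derivative (of_real dx * P u + \<i> * of_real dy) * D u) (at t)"
          unfolding has_vector_derivative_def
          by (rule has_derivative_eq_rhs)
             (auto simp: dx_def dy_def scaleR_conv_of_real algebra_simps)
        then show ?thesis using P[OF u(2) False] by blast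
      next
        case True
        have dx0: "dx = 0"
        proof (rule ccontr)
          assume "dx \<noteq> 0"
          then have "t = t0" using True unfolding t0_def u_def \<gamma>_def qp
            by (simp add: field_simps)
          then show False using t by simp
        qed
        have *: "\<gamma> t' = u + \<i> * of_real (dy * (t' - t))" for t'
          unfolding u_def \<gamma>_def qp dx0 by (simp add: complex_eq_iff algebra_simps)
        have "((\<lambda>t. R (u + \<i> * of_real t)) \<circ> (\<lambda>t'. dy * (t' - t)) has_vector_derivative dy *\<^sub>R (\<i> * D u)) (at t)"
          by (rule vector_diff_chain_at) (use vert[OF u(2) True] in \<open>auto intro!: derivative_eq_intros\<close>)
        then have "((\<lambda>t. R (\<gamma> t)) has_vector_derivative (of_real dx * 1 + \<i> * of_real dy) * D u) (at t)"
          by (simp add: * o_def dx0 scaleR_conv_of_real mult_ac)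
        then show ?thesis using m by (intro exI[of _ 1]) auto
      qed
      then obtain Q where Q: "m \<le> Re Q" "cmod Q \<le> C"
        "((\<lambda>t. R (\<gamma> t)) has_vector_derivative (of_real dx * Q + \<i> * of_real dy) * D u) (at t)" by blast
      have "(g has_vector_derivative (of_real dx * Q + \<i> * of_real dy) * (1 + (D u / D u0 - 1))) (at t)"
        unfolding g_def using D0
        by (auto intro!: derivative_eq_intros Q(3))
      then show ?thesis using Q E by blast
    qed
    have contg: "continuous_on {0..1} g"
      unfolding g_def
      by (intro continuous_intros continuous_on_compose2[OF cont])
         (use \<gamma>b d D0 in \<open>auto simp: \<gamma>_def intro!: continuous_intros\<close>)
    have g01: "g 0 = g 1" using eq by (simp add: g_def \<gamma>_def)
    let ?V = "\<lambda>Q. of_real dx * Q + \<i> * of_real dy"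
    \<comment> \<open>A functional of norm at most 1 that outweighs the error on every admissible
      velocity would increase strictly along \<open>g\<close>, although \<open>g\<close> returns to
      its initial value.\<close>
    have no_increase: False
      if T: "bounded_linear T" "\<And>z. \<bar>T z\<bar> \<le> cmod z"
        and pos: "\<And>Q. m \<le> Re Q \<Longrightarrow> cmod Q \<le> C \<Longrightarrow> cmod (?V Q) * e < T (?V Q)" for T :: "complex \<Rightarrow> real"
    proof -
      have "(\<lambda>t. T (g t)) 0 < (\<lambda>t. T (g t)) 1"
      proof (rule less_if_deriv_pos_except_point)
        show "continuous_on {0..1} (\<lambda>t. T (g t))" by (rule bounded_linear.continuous_on[OF T(1) contg])
        fix t assume t: "0 < t" "t < 1" "t \<noteq> t0"
        obtain Q E where Q: "m \<le> Re Q" "cmod Q \<le> C" "cmod E \<le> e"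
          "(g has_vector_derivative ?V Q * (1 + E)) (at t)"
          using key[OF t] by blast
        have "((\<lambda>t. T (g t)) has_real_derivative T (?V Q * (1 + E))) (at t)"
          using bounded_linear.has_vector_derivative[OF T(1) Q(4)]
          by (simp add: has_real_derivative_iff_has_vector_derivative)
        moreover have "T (?V Q * (1 + E)) > 0"
        proof -
          have "T (?V Q * (1 + E)) = T (?V Q) + T (?V Q * E)"
            using linear_add[OF bounded_linear.linear[OF T(1)], of "?V Q" "?V Q * E"] by (simp add: distrib_left)
          moreover have "\<bar>T (?V Q * E)\<bar> \<le> cmod (?V Q) * e"
            using T(2)[of "?V Q * E"] mult_left_mono[OF Q(3) norm_ge_zero, of "?V Q"] by (simp add: norm_mult)
          ultimately show ?thesis using pos[OF Q(1,2)] by linarith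
        qed
        ultimately show "\<exists>D. ((\<lambda>t. T (g t)) has_real_derivative D) (at t) \<and> D > 0" by blast
      qed
      then show False using g01 by simp
    qed
    have V: "cmod (?V Q) \<le> C * \<bar>dx\<bar> + \<bar>dy\<bar>" "\<bar>Im (of_real dx * Q)\<bar> \<le> C * \<bar>dx\<bar>" if "cmod Q \<le> C" for Q
    proof -
      have "cmod (of_real dx * Q) \<le> C * \<bar>dx\<bar>" using mult_left_mono[OF that, of "\<bar>dx\<bar>"] by (simp add: norm_mult mult.commute)
      then show "cmod (?V Q) \<le> C * \<bar>dx\<bar> + \<bar>dy\<bar>" "\<bar>Im (of_real dx * Q)\<bar> \<le> C * \<bar>dx\<bar>"
        using norm_triangle_ineq[of "of_real dx * Q" "\<i> * of_real dy"] abs_Im_le_cmod[of "of_real dx * Q"]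
        by (auto simp: norm_mult)
    qed
    show False
    \<comment> \<open>If the segment is not steep, the real part of the velocity, at least
      \<open>m * \<bar>dx\<bar>\<close> in modulus, decides; if it is steep,
      \<open>dx * Im Q\<close> can cancel at most half of \<open>dy\<close> and the imaginary part
      decides.\<close>
    proof (cases "\<bar>dy\<bar> \<le> 2 * C * \<bar>dx\<bar>")
      case True
      then have dx0: "dx \<noteq> 0" using pq(3) qp by (auto simp: complex_eq_iff)
      show False
      proof (rule no_increase[of "\<lambda>z. sgn dx * Re z"])
        show "bounded_linear (\<lambda>z. sgn dx * Re z)" by (intro bounded_linear_const_mult bounded_linear_Re)
        show "\<bar>sgn dx * Re z\<bar> \<le> cmod z" for z using abs_Re_le_cmod[of z] dx0 by (simp add: abs_mult abs_sgn_eq)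
        fix Q assume Q: "m \<le> Re Q" "cmod Q \<le> C"
        have "cmod (?V Q) * e \<le> 3 * C * \<bar>dx\<bar> * e" using V(1)[OF Q(2)] True e(1) by (intro mult_right_mono) auto
        also have "\<dots> < m * \<bar>dx\<bar>" using e dx0 by (simp add: mult_ac)
        also have "\<dots> \<le> \<bar>dx\<bar> * Re Q" using mult_left_mono[OF Q(1), of "\<bar>dx\<bar>"] by (simp only: mult.commute)
        also have "\<dots> = sgn dx * Re (?V Q)" by (simp add: abs_sgn[of dx] mult_ac)
        finally show "cmod (?V Q) * e < sgn dx * Re (?V Q)" .
      qed
    next
      case False
      then have dy0: "dy \<noteq> 0" using m by auto
      show False
      proof (rule no_increase[of "\<lambda>z. sgn dy * Im z"])
        show "bounded_linear (\<lambda>z. sgn dy * Im z)" by (intro bounded_linear_const_mult bounded_linear_Im)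
        show "\<bar>sgn dy * Im z\<bar> \<le> cmod z" for z using abs_Im_le_cmod[of z] dy0 by (simp add: abs_mult abs_sgn_eq)
        fix Q assume Q: "m \<le> Re Q" "cmod Q \<le> C"
        have "cmod (?V Q) \<le> 3/2 * \<bar>dy\<bar>" using V(1)[OF Q(2)] False by simp
        then have "cmod (?V Q) * e \<le> (3/2 * \<bar>dy\<bar>) * (1/4)" using e by (intro mult_mono) auto
        also have "\<dots> < \<bar>dy\<bar> - \<bar>dy\<bar> / 2" using dy0 by simp
        also have "\<dots> \<le> \<bar>dy\<bar> + sgn dy * Im (of_real dx * Q)"
        proof -
          have "\<bar>sgn dy * Im (of_real dx * Q)\<bar> \<le> \<bar>dy\<bar> / 2"
            using V(2)[OF Q(2)] False dy0 by (simp add: abs_mult[of "sgn dy"] abs_sgn_eq)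
          then show ?thesis by linarith
        qed
        also have "\<dots> = sgn dy * Im (?V Q)" by (simp add: abs_sgn[of dy] algebra_simps)
        finally show "cmod (?V Q) * e < sgn dy * Im (?V Q)" .
      qed
    qed
  qed
  then have "inj_on R (ball u0 d)" unfolding inj_on_def by blast
  then show ?thesis using d by blast
qed

text \<open>The values taken more than once form an open set, by invariance of domain, and a closed
  one: preimages of a convergent sequence of values subconverge by properness, and local injectivity
  keeps two of them from merging. As \<open>w0\<close> is not among these values, connectedness
  leaves none. Openness and properness likewise make the range clopen.\<close>

lemma bij_if_proper_local_homeo:
  fixes R :: "'a::euclidean_space \<Rightarrow> 'a"
  assumes cont: "continuous_on UNIV R"
    and locinj: "\<And>u. \<exists>d>0. inj_on R (ball u d)"
    and proper: "\<And>B. bounded {u. norm (R u) \<le> B}"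
    and single: "\<And>p q. R p = w0 \<Longrightarrow> R q = w0 \<Longrightarrow> p = q"
  shows "bij R"
proof -
  have opn: "open (R ` S)" if S: "open S" for S
  proof (rule Topological_Spaces.openI)
    fix w assume "w \<in> R ` S"
    then obtain u where u: "u \<in> S" "w = R u" by blast
    obtain d where d: "d > 0" "inj_on R (ball u d)" using locinj by blast
    have "open (R ` (ball u d \<inter> S))"
      by (rule invariance_of_domain) (use S d cont in \<open>auto intro: continuous_on_subset inj_on_subset\<close>)
    moreover have "w \<in> R ` (ball u d \<inter> S)" using u d by auto
    ultimately show "\<exists>T. open T \<and> w \<in> T \<and> T \<subseteq> R ` S"
      by (intro exI[of _ "R ` (ball u d \<inter> S)"]) auto
  qed
  have conv: "\<exists>u r. strict_mono r \<and> (p \<circ> r) \<longlonglongrightarrow> u" if "convergent (\<lambda>n. R (p n))" for p :: "nat \<Rightarrow> 'a"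
  proof -
    have "bounded (range (\<lambda>n. R (p n)))"
      using convergent_imp_bounded that by (auto simp: convergent_def)
    then obtain B where "\<And>n. norm (R (p n)) \<le> B" by (auto simp: bounded_iff)
    then have "range p \<subseteq> {u. norm (R u) \<le> B}" by auto
    then have "bounded (range p)" using proper bounded_subset by blast
    then show ?thesis using bounded_imp_convergent_subsequence by metis
  qed
  have surj: "range R = UNIV"
  proof -
    have "closed (range R)"
      unfolding closed_sequential_limits
    proof safe
      fix x l assume x: "\<forall>n::nat. x n \<in> range R" "x \<longlonglongrightarrow> l"
      have "\<forall>n. \<exists>p. x n = R p" using x(1) by blast
      then obtain p where p: "\<And>n. x n = R (p n)" by metis
      have "convergent (\<lambda>n. R (p n))" using x(2) by (auto simp: convergent_def p[symmetric])
      from conv[OF this]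
      obtain u r where ur: "strict_mono (r :: nat \<Rightarrow> nat)" "(p \<circ> r) \<longlonglongrightarrow> u" by blast
      have "(\<lambda>n. R ((p \<circ> r) n)) \<longlonglongrightarrow> R u"
        by (intro continuous_on_tendsto_compose[OF cont] ur) auto
      moreover have "(x \<circ> r) \<longlonglongrightarrow> l" using x ur LIMSEQ_subseq_LIMSEQ by blast
      ultimately have "l = R u" using LIMSEQ_unique by (auto simp: o_def p)
      then show "l \<in> range R" by blast
    qed
    then show ?thesis using opn[of UNIV] clopen[of "range R"] by auto
  qed
  define M where "M = {w. \<exists>p q. p \<noteq> q \<and> R p = w \<and> R q = w}"
  have "open M"
  proof (rule Topological_Spaces.openI)
    fix w assume "w \<in> M"
    then obtain p q where pq: "p \<noteq> q" "R p = w" "R q = w" by (auto simp: M_def)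
    obtain U V where UV: "open U" "open V" "p \<in> U" "q \<in> V" "U \<inter> V = {}"
      using hausdorff[OF pq(1)] by blast
    have "R ` U \<inter> R ` V \<subseteq> M" using UV by (force simp: M_def)
    moreover have "open (R ` U \<inter> R ` V)" using UV opn by auto
    ultimately show "\<exists>T. open T \<and> w \<in> T \<and> T \<subseteq> M"
      using UV pq by (metis IntI imageI)
  qed
  moreover have "closed M"
    unfolding closed_sequential_limits
  proof safe
    fix x l assume x: "\<forall>n::nat. x n \<in> M" "x \<longlonglongrightarrow> l"
    then have "\<forall>n. \<exists>p q. p \<noteq> q \<and> R p = x n \<and> R q = x n" by (simp add: M_def)
    then obtain p q where p: "\<And>n. p n \<noteq> q n" "\<And>n. R (p n) = x n" "\<And>n. R (q n) = x n" by metis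
    have "convergent (\<lambda>n. R (p n))" using x(2) by (auto simp: convergent_def p)
    from conv[OF this]
    obtain u r where ur: "strict_mono (r :: nat \<Rightarrow> nat)" "(p \<circ> r) \<longlonglongrightarrow> u" by blast
    have xr: "(x \<circ> r) \<longlonglongrightarrow> l" using x ur LIMSEQ_subseq_LIMSEQ by blast
    have "convergent (\<lambda>n. R ((q \<circ> r) n))" using xr by (auto simp: convergent_def p o_def)
    from conv[OF this]
    obtain v r' where vr: "strict_mono (r' :: nat \<Rightarrow> nat)" "((q \<circ> r) \<circ> r') \<longlonglongrightarrow> v" by blast
    have ur': "((p \<circ> r) \<circ> r') \<longlonglongrightarrow> u" using ur vr LIMSEQ_subseq_LIMSEQ by blast
    have xr': "((x \<circ> r) \<circ> r') \<longlonglongrightarrow> l" using xr vr LIMSEQ_subseq_LIMSEQ by blast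
    have "(\<lambda>n. R (((p \<circ> r) \<circ> r') n)) \<longlonglongrightarrow> R u" "(\<lambda>n. R (((q \<circ> r) \<circ> r') n)) \<longlonglongrightarrow> R v"
      by (intro continuous_on_tendsto_compose[OF cont] ur' vr(2); simp)+
    then have l: "l = R u" "l = R v" using xr' by (auto simp: o_def p intro: LIMSEQ_unique)
    have "u \<noteq> v"
    proof
      assume "u = v"
      obtain d where d: "d > 0" "inj_on R (ball u d)" using locinj by blast
      have "\<forall>\<^sub>F n in sequentially. dist (((p \<circ> r) \<circ> r') n) u < d"
        using ur' d by (auto dest: tendstoD)
      moreover have "\<forall>\<^sub>F n in sequentially. dist (((q \<circ> r) \<circ> r') n) u < d"
        using vr d \<open>u = v\<close> by (auto dest: tendstoD)
      ultimately have "\<forall>\<^sub>F n in sequentially. False"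
      proof eventually_elim
        case (elim n)
        then show False using d(2) p unfolding inj_on_def
          by (metis comp_apply dist_commute mem_ball)
      qed
      then show False by simp
    qed
    then show "l \<in> M" using l by (auto simp: M_def)
  qed
  moreover have "w0 \<notin> M" using single by (auto simp: M_def)
  ultimately have "M = {}" using clopen[of M] by blast
  then have "inj R" unfolding M_def inj_on_def by blast
  then show ?thesis using surj by (simp add: bij_def)
qed

section \<open>Homeomorphisms and the fibres of their limits\<close>

lemma homeomorphism_if_bij:
  fixes f :: "'a::euclidean_space \<Rightarrow> 'a"
  assumes "continuous_on UNIV f" "bij f"
  shows "homeomorphism UNIV UNIV f (inv_into UNIV f)"
proof -
  have "continuous_on (f ` UNIV) (inv_into UNIV f)"
    by (rule continuous_on_inverse_open[OF open_UNIV]) (use assms in \<open>auto simp: bij_def\<close>)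
  then show ?thesis using assms
    by (auto simp: homeomorphism_def bij_def inj_imp_surj_inv surj_f_inv_f)
qed

text \<open>A small ball around the value has connected preimages under the approximating maps, and these
  cannot jump across the frontier of a neighbourhood of one part of a disconnected fibre.\<close>

lemma connected_fibre_limit_homeo:
  fixes R :: "real \<Rightarrow> 'a::euclidean_space \<Rightarrow> 'a"
  assumes cont: "continuous_on ({0..1} \<times> UNIV) (\<lambda>(e, u). R e u)"
    and bij: "\<And>e. 0 < e \<Longrightarrow> e \<le> 1 \<Longrightarrow> bij (R e)"
    and proper: "bounded {u. R 0 u = w}"
  shows "connected {u. R 0 u = w}"
proof (rule ccontr)
  let ?F = "{u. R 0 u = w}"
  assume nc: "\<not> connected ?F"
  have cont_e: "continuous_on UNIV (R e)" if "0 \<le> e" "e \<le> 1" for e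
  proof -
    have "continuous_on UNIV ((\<lambda>(e, u). R e u) \<circ> (\<lambda>u. (e, u)))"
      by (intro continuous_on_compose continuous_intros continuous_on_subset[OF cont]) (use that in auto)
    then show ?thesis by (simp add: o_def)
  qed
  have clF: "closed ?F"
    using continuous_closed_vimage[of "{w}" "R 0"] cont_e[of 0]
    by (auto simp: vimage_def continuous_on_eq_continuous_within)
  then have cpF: "compact ?F" using proper compact_eq_bounded_closed by blast
  obtain A B where AB: "closed A" "closed B" "?F \<subseteq> A \<union> B" "A \<inter> B \<inter> ?F = {}" "A \<inter> ?F \<noteq> {}" "B \<inter> ?F \<noteq> {}"
    using nc unfolding connected_closed by blast
  define A' B' where "A' = A \<inter> ?F" and "B' = B \<inter> ?F"
  have cA: "compact A'" "compact B'" "A' \<inter> B' = {}" "A' \<noteq> {}" "B' \<noteq> {}" "?F = A' \<union> B'"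
    using AB cpF by (auto simp: A'_def B'_def closed_Int_compact)
  obtain d where d: "d > 0" "\<And>x y. x \<in> A' \<Longrightarrow> y \<in> B' \<Longrightarrow> d \<le> dist x y"
    using separate_compact_closed[OF cA(1) compact_imp_closed[OF cA(2)] cA(3)] by blast
  \<comment> \<open>With half the distance of the two parts, the frontier of \<open>U\<close> misses
    \<open>B'\<close> as well as \<open>A'\<close>.\<close>
  define U where "U = {x. infdist x A' < d / 2}"
  have U: "open U" unfolding U_def
    by (intro open_Collect_less continuous_intros)
  have Uc: "U \<union> frontier U \<subseteq> {x. infdist x A' \<le> d / 2}"
  proof -
    have "closed {x. infdist x A' \<le> d / 2}" by (intro closed_Collect_le continuous_intros)
    then have "closure U \<subseteq> {x. infdist x A' \<le> d / 2}"
      by (intro closure_minimal) (auto simp: U_def)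
    then show ?thesis using closure_subset[of U] by (auto simp: frontier_def)
  qed
  have frU: "infdist x A' = d / 2" if "x \<in> frontier U" for x
  proof -
    have "x \<notin> U" using that U by (simp add: frontier_def interior_open)
    then show ?thesis using Uc that by (auto simp: U_def)
  qed
  have bU: "bounded (frontier U)"
  proof -
    obtain r where r: "\<And>x. x \<in> A' \<Longrightarrow> norm x \<le> r" using compact_imp_bounded[OF cA(1)] by (auto simp: bounded_iff)
    have "norm x \<le> r + d" if "x \<in> frontier U" for x
    proof -
      obtain y where y: "y \<in> A'" "infdist x A' = dist x y"
        by (rule infdist_attains_inf[OF compact_imp_closed[OF cA(1)] cA(4)])
      have "norm x \<le> norm y + dist x y" by (metis add.commute dist_norm norm_triangle_sub)
      then show ?thesis using frU[OF that] y r[of y] d by auto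
    qed
    then show ?thesis by (auto simp: bounded_iff)
  qed
  then have cfr: "compact (frontier U)" using compact_eq_bounded_closed by auto
  have frF: "frontier U \<inter> ?F = {}"
  proof -
    have "x \<notin> A' \<union> B'" if "x \<in> frontier U" for x
    proof
      assume "x \<in> A' \<union> B'"
      moreover have "x \<notin> A'" using frU[OF that] d cA by (metis infdist_zero half_gt_zero less_irrefl)
      moreover have "x \<notin> B'"
      proof
        assume "x \<in> B'"
        obtain y where y: "y \<in> A'" "infdist x A' = dist x y"
          by (rule infdist_attains_inf[OF compact_imp_closed[OF cA(1)] cA(4)])
        then show False using d(2)[of y x] \<open>x \<in> B'\<close> frU[OF that] d by (simp add: dist_commute)
      qed
      ultimately show False by blast
    qed
    then show ?thesis using cA(6) by blast
  qed
  obtain p q where p: "p \<in> A'" and q: "q \<in> B'" using cA by blast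
  have pU: "p \<in> U" using p d by (simp add: U_def)
  have qU: "q \<notin> U"
  proof
    assume "q \<in> U"
    obtain y where y: "y \<in> A'" "infdist q A' = dist q y"
      by (rule infdist_attains_inf[OF compact_imp_closed[OF cA(1)] cA(4)])
    then show False using d(2)[of y q] q \<open>q \<in> U\<close> d by (simp add: U_def dist_commute)
  qed
  \<comment> \<open>The approximation has to be uniform only on the frontier and at one point of
    each part.\<close>
  define K where "K = frontier U \<union> {p, q}"
  have cK: "compact K" using cfr by (simp add: K_def)
  have frne: "frontier U \<noteq> {}" using frontier_eq_empty[of U] pU qU by auto
  have contd: "continuous_on (frontier U) (\<lambda>x. dist (R 0 x) w)"
    by (intro continuous_on_dist continuous_on_const continuous_on_subset[OF cont_e]) auto
  obtain x0 where x0: "x0 \<in> frontier U" "\<And>x. x \<in> frontier U \<Longrightarrow> dist (R 0 x0) w \<le> dist (R 0 x) w"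
    using continuous_attains_inf[OF cfr frne contd] by blast
  \<comment> \<open>Half the distance of \<open>w\<close> from the image of the frontier: an error
    below \<epsilon> then keeps the frontier out of the preimage of
    \<open>ball w \<epsilon>\<close>.\<close>
  define \<epsilon> where "\<epsilon> = dist (R 0 x0) w / 2"
  have \<epsilon>: "\<epsilon> > 0" using x0(1) frF by (auto simp: \<epsilon>_def)
  have "uniformly_continuous_on ({0..1} \<times> K) (\<lambda>(e, u). R e u)"
    by (intro compact_uniformly_continuous continuous_on_subset[OF cont] compact_Times cK) auto
  then obtain \<delta> where \<delta>: "\<delta> > 0" "\<And>z z'. z \<in> {0..1} \<times> K \<Longrightarrow> z' \<in> {0..1} \<times> K \<Longrightarrow> dist z' z < \<delta> \<Longrightarrow>
      dist ((\<lambda>(e, u). R e u) z') ((\<lambda>(e, u). R e u) z) < \<epsilon>"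
    using \<epsilon> unfolding uniformly_continuous_on_def by metis
  define e where "e = min (\<delta> / 2) 1"
  have e: "0 < e" "e \<le> 1" "e < \<delta>" using \<delta> by (auto simp: e_def)
  have close: "dist (R e u) (R 0 u) < \<epsilon>" if "u \<in> K" for u
    using \<delta>(2)[of "(0, u)" "(e, u)"] e that by (auto simp: dist_Pair_Pair)
  have homeo: "homeomorphism UNIV UNIV (R e) (inv_into UNIV (R e))"
    by (rule homeomorphism_if_bij) (use bij cont_e e in auto)
  define P where "P = inv_into UNIV (R e) ` ball w \<epsilon>"
  have "connected P" unfolding P_def
    by (rule connected_continuous_image)
       (use homeo in \<open>auto simp: homeomorphism_def intro: continuous_on_subset\<close>)
  have inP: "u \<in> P \<longleftrightarrow> dist (R e u) w < \<epsilon>" for u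
    using bij[OF e(1,2)] unfolding P_def
    by (metis (no_types, lifting) bij_inv_eq_iff dist_commute imageE image_eqI mem_ball)
  have "p \<in> P" "q \<in> P" using close[of p] close[of q] p q
    by (auto simp: inP K_def A'_def B'_def)
  then have "P \<inter> frontier U \<noteq> {}"
    using connected_Int_frontier[OF \<open>connected P\<close>, of U] pU qU by blast
  then obtain x where x: "x \<in> P" "x \<in> frontier U" by blast
  have "dist (R 0 x) w \<le> dist (R e x) (R 0 x) + dist (R e x) w" by (metis dist_commute dist_triangle)
  also have "\<dots> < 2 * \<epsilon>" using close[of x] x by (auto simp: K_def inP)
  finally show False using x0(2)[OF x(2)] by (simp add: \<epsilon>_def)
qed

subsection \<open>Absolute continuity and boundary values\<close>

text \<open>Induction that removes the interval with the largest left end: the others lie to its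
  left, unless it is degenerate and contributes nothing.\<close>

lemma sum_increments_le:
  fixes \<phi> :: "real \<Rightarrow> real" and u v :: "nat \<Rightarrow> real"
  assumes "finite I" and mono: "mono_on {\<alpha>..\<beta>} \<phi>" and le: "\<alpha> \<le> \<beta>"
    and iv: "\<And>i. i \<in> I \<Longrightarrow> \<alpha> \<le> u i \<and> u i \<le> v i \<and> v i \<le> \<beta>"
    and disj: "\<And>i j. i \<in> I \<Longrightarrow> j \<in> I \<Longrightarrow> i \<noteq> j \<Longrightarrow> v i \<le> u j \<or> v j \<le> u i"
  shows "(\<Sum>i\<in>I. \<phi> (v i) - \<phi> (u i)) \<le> \<phi> \<beta> - \<phi> \<alpha>"
  using assms
proof (induction "card I" arbitrary: I \<beta>)
  case 0
  then show ?case by (auto dest: mono_onD[of _ _ \<alpha> \<beta>])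
next
  case (Suc n)
  then have "I \<noteq> {}" by auto
  have "Max (u ` I) \<in> u ` I" using Suc.prems(1) \<open>I \<noteq> {}\<close> by (intro Max_in) auto
  then obtain i where i: "i \<in> I" "u i = Max (u ` I)" by force
  have imax: "u j \<le> u i" if "j \<in> I" for j using that i Suc.prems(1) by simp
  define J where "J = I - {i}"
  have J: "finite J" "n = card J" "J \<subseteq> I" using Suc.prems(1) Suc.hyps(2) i by (auto simp: J_def)
  have sumI: "(\<Sum>i\<in>I. \<phi> (v i) - \<phi> (u i)) = (\<phi> (v i) - \<phi> (u i)) + (\<Sum>i\<in>J. \<phi> (v i) - \<phi> (u i))"
    unfolding J_def using i Suc.prems(1) by (simp add: sum.remove)
  have ui: "\<alpha> \<le> u i" "u i \<le> v i" "v i \<le> \<beta>" using Suc.prems(4)[OF i(1)] by auto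
  show ?case
  proof (cases "\<forall>j\<in>J. v j \<le> u i")
    case True
    have "(\<Sum>i\<in>J. \<phi> (v i) - \<phi> (u i)) \<le> \<phi> (u i) - \<phi> \<alpha>"
      by (rule Suc.hyps(1)[OF J(2,1)])
         (use Suc.prems ui J True in \<open>auto intro: mono_on_subset\<close>)
    moreover have "\<phi> (v i) \<le> \<phi> \<beta>" by (rule mono_onD[OF Suc.prems(2)]) (use ui in auto)
    ultimately show ?thesis using sumI by simp
  next
    case False
    then obtain j where j: "j \<in> J" "\<not> v j \<le> u i" by blast
    then have "v i \<le> u j" using Suc.prems(5)[of i j] i J by (auto simp: J_def)
    then have "v i = u i" using ui imax[of j] j J by auto
    moreover have "(\<Sum>i\<in>J. \<phi> (v i) - \<phi> (u i)) \<le> \<phi> \<beta> - \<phi> \<alpha>"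
      by (rule Suc.hyps(1)[OF J(2,1)]) (use Suc.prems J in auto)
    ultimately show ?thesis using sumI by simp
  qed
qed

text \<open>Truncation at \<eta> makes the power Lipschitz, because \<open>x powr (p - 1)\<close>
  does not increase with \<open>x\<close>.\<close>

lemma powr_increment_le:
  fixes p \<eta> u v :: real
  assumes "0 < p" "p \<le> 1" "0 < \<eta>" "u \<le> v"
  shows "max v \<eta> powr p - max u \<eta> powr p \<le> \<eta> powr (p - 1) * (v - u)"
proof -
  define x y where "x = max u \<eta>" and "y = max v \<eta>"
  have xy: "\<eta> \<le> x" "x \<le> y" "0 < x" "y - x \<le> v - u" using assms by (auto simp: x_def y_def)
  have "y powr p = y * y powr (p - 1)" using xy by (simp add: powr_mult_base)
  also have "\<dots> \<le> y * x powr (p - 1)" using xy assms by (intro mult_left_mono powr_mono2') auto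
  finally have "y powr p - x powr p \<le> y * x powr (p - 1) - x * x powr (p - 1)"
    using xy by (simp add: powr_mult_base)
  also have "\<dots> = (y - x) * x powr (p - 1)" by (simp add: algebra_simps)
  also have "\<dots> \<le> (v - u) * \<eta> powr (p - 1)"
    using xy assms by (intro mult_mono powr_mono2') auto
  finally show ?thesis by (simp add: x_def y_def mult.commute)
qed

lemma powr_add_le:
  fixes x y p :: real
  assumes "0 \<le> x" "0 \<le> y" "0 < p" "p \<le> 1"
  shows "(x + y) powr p \<le> x powr p + y powr p"
proof (cases "x = 0 \<or> y = 0")
  case False
  then have "(x + y) powr p = x * (x + y) powr (p - 1) + y * (x + y) powr (p - 1)"
    using assms by (simp add: powr_mult_base flip: distrib_right)
  also have "\<dots> \<le> x * x powr (p - 1) + y * y powr (p - 1)"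
    using assms False by (intro add_mono mult_left_mono powr_mono2') auto
  finally show ?thesis using assms False by (simp add: powr_mult_base)
qed (use assms in auto)

text \<open>The odd function \<open>sgn x * \<bar>x\<bar> powr p\<close>, for positive
  \<open>p\<close> an increasing primitive of the singular density
  \<open>p * \<bar>x\<bar> powr (p - 1)\<close>.\<close>

definition signed_powr :: "real \<Rightarrow> real \<Rightarrow> real" where
  "signed_powr p x = max x 0 powr p - max (- x) 0 powr p"

lemma signed_powr_mono: "0 < p \<Longrightarrow> x \<le> y \<Longrightarrow> signed_powr p x \<le> signed_powr p y"
  unfolding signed_powr_def by (intro diff_mono powr_mono2) auto

lemma continuous_on_signed_powr [continuous_intros]:
  "0 < p \<Longrightarrow> continuous_on S f \<Longrightarrow> continuous_on S (\<lambda>x. signed_powr p (f x))"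
  unfolding signed_powr_def by (intro continuous_on_diff continuous_on_powr' continuous_intros) auto

lemma has_derivative_signed_powr:
  assumes "x \<noteq> 0"
  shows "(signed_powr p has_real_derivative p * \<bar>x\<bar> powr (p - 1)) (at x)"
proof (cases "x > 0")
  case True
  have "((\<lambda>x. x powr p - 0 powr p) has_real_derivative p * x powr (p - 1)) (at x)"
    using True by (auto intro!: derivative_eq_intros)
  then show ?thesis
    using True has_field_derivative_transform_within_open[where S = "{0<..}"
      and f = "\<lambda>x. x powr p - 0 powr p" and g = "signed_powr p"]
    by (auto simp: signed_powr_def max_def)
next
  case False
  then have x: "x < 0" using assms by simp
  have "((\<lambda>x. 0 powr p - (- x) powr p) has_real_derivative p * (- x) powr (p - 1)) (at x)"
    using x by (auto intro!: derivative_eq_intros)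
  then show ?thesis
    using x has_field_derivative_transform_within_open[where S = "{..<0}"
      and f = "\<lambda>x. 0 powr p - (- x) powr p" and g = "signed_powr p"]
    by (auto simp: signed_powr_def max_def)
qed

text \<open>Clamping the argument to \<open>[- \<eta>, \<eta>]\<close> splits the function into a
  monotone part whose range has length at most \<epsilon> / 4, which also bounds the sum of its
  increments over disjoint intervals, and a Lipschitz part, for which \<delta> is chosen.\<close>

lemma signed_powr_sum_small:
  fixes p \<epsilon> c :: real
  assumes p: "0 < p" "p \<le> 1" and \<epsilon>: "\<epsilon> > 0" and ab: "\<alpha> \<le> \<beta>"
  shows "\<exists>\<delta>>0. \<forall>(n::nat) u v. (\<forall>i<n. \<alpha> \<le> u i \<and> u i \<le> v i \<and> v i \<le> \<beta>) \<and>
    (\<forall>i<n. \<forall>j<n. i \<noteq> j \<longrightarrow> v i \<le> u j \<or> v j \<le> u i) \<and> (\<Sum>i<n. v i - u i) < \<delta> \<longrightarrow>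
    (\<Sum>i<n. signed_powr p (v i - c) - signed_powr p (u i - c)) < \<epsilon>"
proof -
  define \<eta> where "\<eta> = (\<epsilon> / 8) powr (1 / p)"
  have \<eta>: "\<eta> > 0" "\<eta> powr p = \<epsilon> / 8" using \<epsilon> p by (auto simp: \<eta>_def powr_powr)
  define L where "L = \<eta> powr (p - 1)"
  have L: "L > 0" using \<eta> by (simp add: L_def)
  define \<theta> where "\<theta> x = signed_powr p (max (- \<eta>) (min \<eta> x))" for x
  have mono: "\<theta> x \<le> \<theta> y" if "x \<le> y" for x y
    unfolding \<theta>_def using that p by (intro signed_powr_mono) auto
  have bnd: "\<bar>\<theta> x\<bar> \<le> \<epsilon> / 8" for x
  proof -
    have "\<theta> x \<le> signed_powr p \<eta>" "signed_powr p (- \<eta>) \<le> \<theta> x"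
      unfolding \<theta>_def using p \<eta> by (auto intro!: signed_powr_mono)
    then show ?thesis using \<eta> p by (simp add: signed_powr_def max_def)
  qed
  have split: "signed_powr p x = \<theta> x + (max x \<eta> powr p - max (- x) \<eta> powr p)" for x
    using \<eta> p by (auto simp: \<theta>_def signed_powr_def max_def min_def)
  have inc: "signed_powr p y - signed_powr p x \<le> \<theta> y - \<theta> x + 2 * L * (y - x)" if "x \<le> y" for x y
  proof -
    have "max y \<eta> powr p - max x \<eta> powr p \<le> L * (y - x)"
      unfolding L_def by (rule powr_increment_le) (use that p \<eta> in auto)
    moreover have "max (-x) \<eta> powr p - max (-y) \<eta> powr p \<le> L * (-x - (-y))"
      unfolding L_def by (rule powr_increment_le) (use that p \<eta> in auto)
    ultimately show ?thesis unfolding split by simp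
  qed
  show ?thesis
  proof (intro exI conjI allI impI)
    show "\<epsilon> / (4 * L) > 0" using \<epsilon> L by simp
    fix n :: nat and u v :: "nat \<Rightarrow> real"
    assume H: "(\<forall>i<n. \<alpha> \<le> u i \<and> u i \<le> v i \<and> v i \<le> \<beta>) \<and>
      (\<forall>i<n. \<forall>j<n. i \<noteq> j \<longrightarrow> v i \<le> u j \<or> v j \<le> u i) \<and> (\<Sum>i<n. v i - u i) < \<epsilon> / (4 * L)"
    have "(\<Sum>i<n. signed_powr p (v i - c) - signed_powr p (u i - c))
        \<le> (\<Sum>i<n. (\<theta> (v i - c) - \<theta> (u i - c)) + 2 * L * (v i - u i))"
    proof (rule sum_mono)
      fix i assume "i \<in> {..<n}"
      then show "signed_powr p (v i - c) - signed_powr p (u i - c) \<le> (\<theta> (v i - c) - \<theta> (u i - c)) + 2 * L * (v i - u i)"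
        using inc[of "u i - c" "v i - c"] H by auto
    qed
    also have "\<dots> = (\<Sum>i<n. \<theta> (v i - c) - \<theta> (u i - c)) + 2 * L * (\<Sum>i<n. v i - u i)"
      by (simp add: sum.distrib sum_distrib_left)
    also have "(\<Sum>i<n. \<theta> (v i - c) - \<theta> (u i - c)) \<le> \<theta> (\<beta> - c) - \<theta> (\<alpha> - c)"
      by (rule sum_increments_le[where \<phi> = "\<lambda>x. \<theta> (x - c)"])
         (use H ab in \<open>auto intro!: mono_onI mono\<close>)
    also have "\<theta> (\<beta> - c) - \<theta> (\<alpha> - c) \<le> \<epsilon> / 4" using bnd[of "\<beta> - c"] bnd[of "\<alpha> - c"] by linarith
    also have "2 * L * (\<Sum>i<n. v i - u i) \<le> 2 * L * (\<epsilon> / (4 * L))"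
      using H L by (intro mult_left_mono) auto
    also have "\<epsilon> / 4 + 2 * L * (\<epsilon> / (4 * L)) < \<epsilon>" using L \<epsilon> by simp
    finally show "(\<Sum>i<n. signed_powr p (v i - c) - signed_powr p (u i - c)) < \<epsilon>" by simp
  qed
qed

text \<open>The increments of \<open>g\<close> are dominated by those of \<open>\<Theta>\<close>, a
  primitive of the bound on the derivative, and \<open>\<Theta>\<close> is absolutely continuous
  because \<open>k < 1\<close>. There are two singular points because a line meets the circle at
  most twice; they may coincide or lie outside the interval.\<close>

lemma abs_cont_on_if_deriv_le_powr:
  fixes g :: "real \<Rightarrow> complex" and k B p q :: real
  assumes k: "0 \<le> k" "k < 1" and B: "0 \<le> B"
    and cont: "continuous_on {\<alpha>..\<beta>} g"
    and der: "\<And>x. \<alpha> < x \<Longrightarrow> x < \<beta> \<Longrightarrow> x \<noteq> p \<Longrightarrow> x \<noteq> q \<Longrightarrow>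
      \<exists>g'. (g has_vector_derivative g') (at x) \<and>
        norm g' \<le> B * (1 + \<bar>x - p\<bar> powr - k + \<bar>x - q\<bar> powr - k)"
  shows "abs_cont_on g \<alpha> \<beta>"
proof (cases "\<alpha> \<le> \<beta>")
  case False
  then have "\<not> (\<alpha> \<le> x \<and> x \<le> y \<and> y \<le> \<beta>)" for x y by linarith
  then have n0: "n = 0" if "\<forall>i<n. \<alpha> \<le> u i \<and> u i \<le> v i \<and> v i \<le> \<beta>" for n :: nat and u v :: "nat \<Rightarrow> real"
    using that by (metis gr_zeroI)
  show ?thesis
    unfolding abs_cont_on_def
  proof (intro allI impI, rule exI[of _ 1], intro conjI allI impI)
    fix \<epsilon> :: real and n :: nat and u v :: "nat \<Rightarrow> real"
    assume "\<epsilon> > 0" and H: "(\<forall>i<n. \<alpha> \<le> u i \<and> u i \<le> v i \<and> v i \<le> \<beta>) \<and>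
        (\<forall>i<n. \<forall>j<n. i \<noteq> j \<longrightarrow> v i \<le> u j \<or> v j \<le> u i) \<and> (\<Sum>i<n. v i - u i) < 1"
    then show "(\<Sum>i<n. norm (g (v i) - g (u i))) < \<epsilon>" using n0[OF conjunct1[OF H]] by simp
  qed simp
next
  case ab: True
  define r where "r = 1 - k"
  have r: "0 < r" "r \<le> 1" using k by (auto simp: r_def)
  define \<Theta> where "\<Theta> x = B * (x + signed_powr r (x - p) / r + signed_powr r (x - q) / r)" for x
  have cont\<Theta>: "continuous_on S \<Theta>" for S
    unfolding \<Theta>_def using r by (intro continuous_intros) auto
  have c0: "norm (g v - g u) \<le> \<Theta> v - \<Theta> u"
    if "\<alpha> \<le> u" "u \<le> v" "v \<le> \<beta>" "p \<notin> {u<..<v}" "q \<notin> {u<..<v}" for u v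
  proof (cases "u < v")
    case True
    obtain g' where g': "\<And>x. \<alpha> < x \<Longrightarrow> x < \<beta> \<Longrightarrow> x \<noteq> p \<Longrightarrow> x \<noteq> q \<Longrightarrow> (g has_vector_derivative g' x) (at x) \<and>
        norm (g' x) \<le> B * (1 + \<bar>x - p\<bar> powr - k + \<bar>x - q\<bar> powr - k)" using der by metis
    show ?thesis
    proof (rule differentiable_bound_general[OF True])
      show "continuous_on {u..v} g" by (rule continuous_on_subset[OF cont]) (use that in auto)
      show "continuous_on {u..v} \<Theta>" by (rule cont\<Theta>)
      fix x assume x: "u < x" "x < v"
      then have xx: "\<alpha> < x" "x < \<beta>" "x \<noteq> p" "x \<noteq> q" using that by auto
      show "(g has_vector_derivative g' x) (at x)" using g' xx by blast
      show "norm (g' x) \<le> B * (1 + \<bar>x - p\<bar> powr - k + \<bar>x - q\<bar> powr - k)" using g' xx by blast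
      have *: "((\<lambda>x. signed_powr r (x - c) / r) has_real_derivative \<bar>x - c\<bar> powr - k) (at x)" if "x \<noteq> c" for c
      proof -
        have "((\<lambda>x. signed_powr r (x - c)) has_real_derivative (r * \<bar>x - c\<bar> powr (r - 1)) * 1) (at x)"
          by (rule DERIV_chain2[where f = "signed_powr r" and g = "\<lambda>x. x - c", OF has_derivative_signed_powr])
             (use that in \<open>auto intro!: derivative_eq_intros\<close>)
        from DERIV_cdivide[OF this, of r] show ?thesis using r by (simp add: r_def)
      qed
      show "(\<Theta> has_vector_derivative B * (1 + \<bar>x - p\<bar> powr - k + \<bar>x - q\<bar> powr - k)) (at x)"
        unfolding \<Theta>_def has_real_derivative_iff_has_vector_derivative[symmetric]
        by (intro DERIV_cmult DERIV_add DERIV_ident *) (use xx in auto)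
    qed
  qed (use that in auto)
  \<comment> \<open>The singular points are inserted as division points, one at a time;
    \<open>g\<close> need not be differentiable there.\<close>
  have c1: "norm (g v - g u) \<le> \<Theta> v - \<Theta> u"
    if "\<alpha> \<le> u" "u \<le> v" "v \<le> \<beta>" "q \<notin> {u<..<v}" for u v
  proof (cases "p \<in> {u<..<v}")
    case True
    have "norm (g v - g u) \<le> norm (g v - g p) + norm (g p - g u)"
      using norm_triangle_ineq[of "g v - g p" "g p - g u"] by simp
    also have "\<dots> \<le> (\<Theta> v - \<Theta> p) + (\<Theta> p - \<Theta> u)"
      using True that by (intro add_mono c0) auto
    finally show ?thesis by simp
  qed (use that c0 in auto)
  have c2: "norm (g v - g u) \<le> \<Theta> v - \<Theta> u" if "\<alpha> \<le> u" "u \<le> v" "v \<le> \<beta>" for u v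
  proof (cases "q \<in> {u<..<v}")
    case True
    have "norm (g v - g u) \<le> norm (g v - g q) + norm (g q - g u)"
      using norm_triangle_ineq[of "g v - g q" "g q - g u"] by simp
    also have "\<dots> \<le> (\<Theta> v - \<Theta> q) + (\<Theta> q - \<Theta> u)"
      using True that by (intro add_mono c1) auto
    finally show ?thesis by simp
  qed (use that c1 in auto)
  show ?thesis
    unfolding abs_cont_on_def
  proof (intro allI impI)
    fix \<epsilon> :: real assume \<epsilon>: "\<epsilon> > 0"
    \<comment> \<open>The identity and the two odd powers in \<open>\<Theta>\<close> contribute at
      most a quarter of \<epsilon> each; \<open>B + 1\<close> keeps the quotient meaningful for
      \<open>B = 0\<close>.\<close>
    define \<epsilon>' where "\<epsilon>' = \<epsilon> * r / (4 * (B + 1))"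
    have \<epsilon>': "\<epsilon>' > 0" using \<epsilon> r B by (simp add: \<epsilon>'_def)
    obtain d1 where d1: "d1 > 0" "\<And>(n::nat) u v. (\<forall>i<n. \<alpha> \<le> u i \<and> u i \<le> v i \<and> v i \<le> \<beta>) \<and>
      (\<forall>i<n. \<forall>j<n. i \<noteq> j \<longrightarrow> v i \<le> u j \<or> v j \<le> u i) \<and> (\<Sum>i<n. v i - u i) < d1 \<Longrightarrow>
      (\<Sum>i<n. signed_powr r (v i - p) - signed_powr r (u i - p)) < \<epsilon>'"
      using signed_powr_sum_small[OF r \<epsilon>' ab, of p] by blast
    obtain d2 where d2: "d2 > 0" "\<And>(n::nat) u v. (\<forall>i<n. \<alpha> \<le> u i \<and> u i \<le> v i \<and> v i \<le> \<beta>) \<and>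
      (\<forall>i<n. \<forall>j<n. i \<noteq> j \<longrightarrow> v i \<le> u j \<or> v j \<le> u i) \<and> (\<Sum>i<n. v i - u i) < d2 \<Longrightarrow>
      (\<Sum>i<n. signed_powr r (v i - q) - signed_powr r (u i - q)) < \<epsilon>'"
      using signed_powr_sum_small[OF r \<epsilon>' ab, of q] by blast
    define d where "d = min (\<epsilon> / (4 * (B + 1))) (min d1 d2)"
    have d: "d > 0" using \<epsilon> B d1 d2 by (simp add: d_def)
    show "\<exists>\<delta>>0. \<forall>(n::nat) u v. (\<forall>i<n. \<alpha> \<le> u i \<and> u i \<le> v i \<and> v i \<le> \<beta>) \<and>
        (\<forall>i<n. \<forall>j<n. i \<noteq> j \<longrightarrow> v i \<le> u j \<or> v j \<le> u i) \<and> (\<Sum>i<n. v i - u i) < \<delta> \<longrightarrow>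
        (\<Sum>i<n. norm (g (v i) - g (u i))) < \<epsilon>"
    proof (intro exI[of _ d] conjI allI impI d)
      fix n :: nat and u v :: "nat \<Rightarrow> real"
      assume H: "(\<forall>i<n. \<alpha> \<le> u i \<and> u i \<le> v i \<and> v i \<le> \<beta>) \<and>
        (\<forall>i<n. \<forall>j<n. i \<noteq> j \<longrightarrow> v i \<le> u j \<or> v j \<le> u i) \<and> (\<Sum>i<n. v i - u i) < d"
      let ?S1 = "\<Sum>i<n. signed_powr r (v i - p) - signed_powr r (u i - p)"
      let ?S2 = "\<Sum>i<n. signed_powr r (v i - q) - signed_powr r (u i - q)"
      have S1: "?S1 < \<epsilon>'" by (rule d1(2)) (use H in \<open>auto simp: d_def\<close>)
      have S2: "?S2 < \<epsilon>'" by (rule d2(2)) (use H in \<open>auto simp: d_def\<close>)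
      have "(\<Sum>i<n. norm (g (v i) - g (u i))) \<le> (\<Sum>i<n. \<Theta> (v i) - \<Theta> (u i))"
        by (rule sum_mono) (use H in \<open>auto intro!: c2\<close>)
      also have "\<dots> = B * ((\<Sum>i<n. v i - u i) + ?S1 / r + ?S2 / r)"
        unfolding \<Theta>_def
        by (simp add: sum.distrib sum_distrib_left sum_divide_distrib sum_subtractf algebra_simps diff_divide_distrib)
      also have "\<dots> \<le> B * (\<epsilon> / (4 * (B + 1)) + \<epsilon>' / r + \<epsilon>' / r)"
        using B r S1 S2 H
        by (intro mult_left_mono add_mono divide_right_mono) (auto simp: d_def)
      also have "\<dots> = 3/4 * \<epsilon> * (B / (B + 1))"
      proof -
        have "\<epsilon>' / r = \<epsilon> / (4 * (B + 1))" using r by (simp add: \<epsilon>'_def)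
        then show ?thesis by simp
      qed
      also have "\<dots> \<le> 3/4 * \<epsilon> * 1" using B \<epsilon> by (intro mult_left_mono) auto
      also have "\<dots> < \<epsilon>" using \<epsilon> by simp
      finally show "(\<Sum>i<n. norm (g (v i) - g (u i))) < \<epsilon>" .
    qed
  qed
qed

section \<open>Boundary values of holomorphic functions on the left half-plane\<close>

definition left_halfplane :: "complex set" where "left_halfplane = {v. Re v < 0}"

lemma open_left_halfplane: "open left_halfplane"
  unfolding left_halfplane_def by (rule open_halfspace_Re_lt)

lemma convex_left_halfplane: "convex left_halfplane"
  unfolding left_halfplane_def by (rule convex_halfspace_Re_lt)

text \<open>The value on the imaginary axis is taken along one fixed horizontal sequence; a bound on
  the derivative of \<open>q\<close> later makes this a continuous extension.\<close>

definition left_ext :: "(complex \<Rightarrow> complex) \<Rightarrow> complex \<Rightarrow> complex" where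
  "left_ext q v = (if Re v < 0 then q v else lim (\<lambda>n. q (v - of_real (inverse (real (Suc n))))))"

lemma left_ext_simp [simp]: "Re v < 0 \<Longrightarrow> left_ext q v = q v"
  by (simp add: left_ext_def)

text \<open>The Hardy-Littlewood argument: a derivative of size \<open>(- Re v) powr - k\<close>
  integrates along horizontal lines to a Hoelder modulus with exponent \<open>1 - k\<close>,
  uniformly in \<open>Im v\<close>. The boundary values are thus uniform limits of translates of
  \<open>q\<close>. The strip for the derivative is one unit wider than that for continuity, to
  leave room for the translates.\<close>

lemma left_limit_estimate:
  fixes q :: "complex \<Rightarrow> complex"
  assumes k: "0 \<le> k" "k < 1"
    and hol: "q holomorphic_on left_halfplane"
    and bd: "\<And>v. - 2 \<le> Re v \<Longrightarrow> Re v < 0 \<Longrightarrow> \<bar>Im v\<bar> \<le> Y \<Longrightarrow> cmod (deriv q v) \<le> C * (- Re v) powr - k"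
  shows "\<And>v d. - 2 \<le> Re v - d \<Longrightarrow> 0 \<le> d \<Longrightarrow> Re v \<le> 0 \<Longrightarrow> \<bar>Im v\<bar> \<le> Y \<Longrightarrow>
            cmod (left_ext q v - left_ext q (v - of_real d)) \<le> C / (1 - k) * d powr (1 - k)"
    and "continuous_on {v. - 1 \<le> Re v \<and> Re v \<le> 0 \<and> \<bar>Im v\<bar> \<le> Y} (left_ext q)"
proof -
  define r where "r = 1 - k"
  have r: "0 < r" "r \<le> 1" using k by (auto simp: r_def)
  define \<iota> where "\<iota> n = inverse (real (Suc n))" for n
  have \<iota>: "0 < \<iota> n" "\<iota> n \<le> 1" for n by (auto simp: \<iota>_def field_simps)
  have \<iota>_mono: "\<iota> n \<le> \<iota> m" if "m \<le> n" for m n using that by (simp add: \<iota>_def field_simps)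
  have \<iota>_lim: "\<iota> \<longlonglongrightarrow> 0" unfolding \<iota>_def by (rule LIMSEQ_inverse_real_of_nat)
  \<comment> \<open>The sign of \<open>C\<close> is read off at a point of the strip; for negative
    \<open>Y\<close> there is no such point, and the estimates are vacuous.\<close>
  have C: "C \<ge> 0" if "\<bar>y\<bar> \<le> Y" for y
  proof -
    have "cmod (deriv q (Complex (-1) y)) \<le> C * 1 powr - k"
      using bd[of "Complex (-1) y"] that by simp
    from order.trans[OF norm_ge_zero this] show ?thesis by simp
  qed
  have A: "cmod (q v - q (v - of_real d)) \<le> C / (1 - k) * ((d - Re v) powr (1 - k) - (- Re v) powr (1 - k))"
    if "- 2 \<le> Re v - d" "0 \<le> d" "Re v < 0" "\<bar>Im v\<bar> \<le> Y" for v d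
  proof (cases "d = 0")
    case False
    have "norm ((\<lambda>t. q (v - of_real (d - t))) d - (\<lambda>t. q (v - of_real (d - t))) 0)
       \<le> (\<lambda>t. - C / r * (d - t - Re v) powr r) d - (\<lambda>t. - C / r * (d - t - Re v) powr r) 0"
    proof (rule differentiable_bound_general[where f = "\<lambda>t. q (v - of_real (d - t))" and \<phi> = "\<lambda>t. - C / r * (d - t - Re v) powr r"])
      show "0 < d" using that False by simp
      show "continuous_on {0..d} (\<lambda>t. q (v - of_real (d - t)))"
        by (intro continuous_on_compose2[OF holomorphic_on_imp_continuous_on[OF hol]] continuous_intros)
           (use that in \<open>auto simp: left_halfplane_def\<close>)
      show "continuous_on {0..d} (\<lambda>t. - C / r * (d - t - Re v) powr r)"
        by (intro continuous_intros) (use that r in auto)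
      fix t assume t: "0 < t" "t < d"
      have dq: "(q has_field_derivative deriv q (v - of_real (d - t))) (at (v - of_real (d - t)))"
        by (rule holomorphic_derivI[OF hol open_left_halfplane]) (use t that in \<open>auto simp: left_halfplane_def\<close>)
      have "((q \<circ> (\<lambda>t. v - of_real (d - t))) has_vector_derivative 1 * deriv q (v - of_real (d - t))) (at t)"
        by (rule field_vector_diff_chain_at[where f = "\<lambda>t. v - of_real (d - t)", OF _ dq]) (auto intro!: derivative_eq_intros)
      then show "((\<lambda>t. q (v - of_real (d - t))) has_vector_derivative deriv q (v - of_real (d - t))) (at t)"
        by (simp add: o_def)
      show "((\<lambda>t. - C / r * (d - t - Re v) powr r) has_vector_derivative C * (d - t - Re v) powr - k) (at t)"
        unfolding has_real_derivative_iff_has_vector_derivative[symmetric]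
        using t that r by (auto intro!: derivative_eq_intros simp: r_def)
      show "norm (deriv q (v - of_real (d - t))) \<le> C * (d - t - Re v) powr - k"
        using bd[of "v - of_real (d - t)"] t that by simp
    qed
    then show ?thesis by (simp add: r_def algebra_simps)
  qed simp
  have A': "cmod (q v - q (v - of_real d)) \<le> C / r * d powr r"
    if "- 2 \<le> Re v - d" "0 \<le> d" "Re v < 0" "\<bar>Im v\<bar> \<le> Y" for v d
  proof -
    have "(d - Re v) powr r - (- Re v) powr r \<le> d powr r"
      using powr_add_le[of d "- Re v" r] that r by simp
    then have "C / r * ((d - Re v) powr r - (- Re v) powr r) \<le> C / r * d powr r"
      using C[OF that(4)] r by (intro mult_left_mono) auto
    then show ?thesis using A[OF that] by (simp add: r_def)
  qed
  have conv: "(\<lambda>n. q (v - of_real (\<iota> n))) \<longlonglongrightarrow> left_ext q v"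
    if v: "Re v = 0" "\<bar>Im v\<bar> \<le> Y" for v
  proof -
    let ?x = "\<lambda>n. q (v - of_real (\<iota> n))"
    have "Cauchy ?x"
    proof (rule metric_CauchyI)
      fix e :: real assume e: "e > 0"
      have "(\<lambda>n. C / r * \<iota> n powr r) \<longlonglongrightarrow> C / r * 0 powr r"
        by (rule tendsto_mult[OF tendsto_const], rule tendsto_powr'[OF \<iota>_lim tendsto_const])
           (use r \<iota> in \<open>auto simp: less_imp_le\<close>)
      then have "\<forall>\<^sub>F n in sequentially. C / r * \<iota> n powr r < e"
        using e by (intro order_tendstoD) auto
      then obtain N where N: "\<And>n. n \<ge> N \<Longrightarrow> C / r * \<iota> n powr r < e"
        by (auto simp: eventually_sequentially)
      have main: "dist (?x m) (?x n) < e" if "N \<le> m" "m \<le> n" for m n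
      proof -
        define w d where "w = v - of_real (\<iota> n)" and "d = \<iota> m - \<iota> n"
        have d: "0 \<le> d" "d \<le> \<iota> m" using \<iota>_mono[OF that(2)] \<iota>(1)[of n] by (auto simp: d_def)
        have "dist (?x m) (?x n) = cmod (q w - q (w - of_real d))"
          by (simp add: w_def d_def dist_norm norm_minus_commute)
        also have "\<dots> \<le> C / r * d powr r"
          by (rule A') (use v d \<iota>[of m] \<iota>[of n] in \<open>auto simp: w_def d_def\<close>)
        also have "\<dots> \<le> C / r * \<iota> m powr r"
          using C[OF v(2)] r d by (intro mult_left_mono powr_mono2) auto
        also have "\<dots> < e" using N that by auto
        finally show ?thesis .
      qed
      show "\<exists>M. \<forall>m\<ge>M. \<forall>n\<ge>M. dist (?x m) (?x n) < e"
        using main by (metis dist_commute linear)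
    qed
    then have "?x \<longlonglongrightarrow> lim ?x" by (simp add: Cauchy_convergent_iff convergent_LIMSEQ_iff)
    then show ?thesis using v by (simp add: left_ext_def \<iota>_def)
  qed
  show B: "cmod (left_ext q v - left_ext q (v - of_real d)) \<le> C / (1 - k) * d powr (1 - k)"
    if vd: "- 2 \<le> Re v - d" "0 \<le> d" "Re v \<le> 0" "\<bar>Im v\<bar> \<le> Y" for v d
  proof (cases "Re v < 0 \<or> d = 0")
    case True
    then show ?thesis using A'[of v d] that by (auto simp: r_def)
  next
    case False
    then have v0: "Re v = 0" and d0: "d > 0" using that by auto
    have "(\<lambda>n. cmod (q (v - of_real (\<iota> n)) - left_ext q (v - of_real d)))
        \<longlonglongrightarrow> cmod (left_ext q v - left_ext q (v - of_real d))"
      by (intro tendsto_intros conv v0 vd)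
    moreover have "\<forall>\<^sub>F n in sequentially. \<iota> n < d"
      using order_tendstoD(2)[OF \<iota>_lim d0] .
    then have "\<forall>\<^sub>F n in sequentially. cmod (q (v - of_real (\<iota> n)) - left_ext q (v - of_real d)) \<le> C / r * d powr r"
    proof eventually_elim
      case (elim n)
      have "cmod (q (v - of_real (\<iota> n)) - left_ext q (v - of_real d)) =
        cmod (q (v - of_real (\<iota> n)) - q (v - of_real (\<iota> n) - of_real (d - \<iota> n)))"
        using v0 d0 by simp
      also have "\<dots> \<le> C / r * (d - \<iota> n) powr r"
        by (rule A') (use elim v0 vd \<iota>[of n] in auto)
      also have "\<dots> \<le> C / r * d powr r"
        using C[OF vd(4)] r elim \<iota>(1)[of n] by (intro mult_left_mono powr_mono2) auto
      finally show ?case .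
    qed
    ultimately show ?thesis unfolding r_def
      by (intro tendsto_upperbound) (auto simp: trivial_limit_sequentially)
  qed
  show "continuous_on {v. - 1 \<le> Re v \<and> Re v \<le> 0 \<and> \<bar>Im v\<bar> \<le> Y} (left_ext q)" (is "continuous_on ?S _")
  proof (rule uniform_limit_theorem[where F = sequentially])
    let ?f = "\<lambda>n v. q (v - of_real (\<iota> n))"
    show "\<forall>\<^sub>F n in sequentially. continuous_on ?S (?f n)"
      by (intro always_eventually allI continuous_on_compose2[OF holomorphic_on_imp_continuous_on[OF hol]] continuous_intros)
         (auto simp: left_halfplane_def intro: order.strict_trans1[OF _ \<iota>(1)])
    show "uniform_limit ?S ?f (left_ext q) sequentially"
    proof (rule uniform_limitI)
      fix e :: real assume e: "e > 0"
      have "(\<lambda>n. C / r * \<iota> n powr r) \<longlonglongrightarrow> C / r * 0 powr r"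
        by (rule tendsto_mult[OF tendsto_const], rule tendsto_powr'[OF \<iota>_lim tendsto_const])
           (use r \<iota> in \<open>auto simp: less_imp_le\<close>)
      then have "\<forall>\<^sub>F n in sequentially. C / r * \<iota> n powr r < e"
        using e by (intro order_tendstoD) auto
      then show "\<forall>\<^sub>F n in sequentially. \<forall>v\<in>?S. dist (?f n v) (left_ext q v) < e"
      proof eventually_elim
        case (elim n)
        note i = \<iota>[of n]
        show ?case
        proof safe
          fix v assume v: "- 1 \<le> Re v" "Re v \<le> 0" "\<bar>Im v\<bar> \<le> Y"
          have "left_ext q (v - of_real (\<iota> n)) = ?f n v"
            using v i by (intro left_ext_simp) (simp add: order.strict_trans1[OF v(2)])
          then have "dist (?f n v) (left_ext q v) \<le> C / r * \<iota> n powr r"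
            using B[of v "\<iota> n"] v i by (simp add: dist_norm norm_minus_commute r_def)
          then show "dist (?f n v) (left_ext q v) < e" using elim by simp
        qed
      qed
    qed
  qed auto
qed

text \<open>Glued to the constant \<open>w\<close> on the right, \<open>left_ext q\<close> is
  continuous across the segment and therefore holomorphic there. It equals \<open>w\<close> on an
  open set, so the identity theorem applies, in a box around the segment and from there in the
  half-plane.\<close>

lemma const_if_left_ext_const:
  fixes q :: "complex \<Rightarrow> complex"
  assumes hol: "q holomorphic_on left_halfplane"
    and cont: "\<And>Y. continuous_on {v. - 1 \<le> Re v \<and> Re v \<le> 0 \<and> \<bar>Im v\<bar> \<le> Y} (left_ext q)"
    and y: "y1 < y2" and const: "\<And>y. y1 < y \<Longrightarrow> y < y2 \<Longrightarrow> left_ext q (Complex 0 y) = w"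
    and v: "Re v < 0"
  shows "q v = w"
proof -
  define S where "S = {v. - 1 < Re v \<and> Re v < 1 \<and> y1 < Im v \<and> Im v < y2}"
  have S: "open S" unfolding S_def
    by (intro open_Collect_conj open_Collect_less continuous_intros)
  define Q where "Q v = (if Re v \<le> 0 then left_ext q v else w)" for v
  have "Q holomorphic_on S"
  proof (rule holomorphic_on_paste_across_line[OF S, of 1 Q 0])
    show "Q holomorphic_on S \<inter> {z. 1 \<bullet> z < 0}"
    proof (rule holomorphic_transform)
      show "q holomorphic_on S \<inter> {z. 1 \<bullet> z < 0}"
        by (rule holomorphic_on_subset[OF hol]) (auto simp: left_halfplane_def)
    qed (auto simp: Q_def)
    show "Q holomorphic_on S \<inter> {z. 0 < 1 \<bullet> z}"
      by (rule holomorphic_transform[of "\<lambda>_. w"]) (auto simp: Q_def)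
    show "continuous_on S Q"
      unfolding Q_def
    proof (rule continuous_on_cases_le)
      show "continuous_on {v \<in> S. Re v \<le> 0} (left_ext q)"
        by (rule continuous_on_subset[OF cont[of "max \<bar>y1\<bar> \<bar>y2\<bar>"]]) (auto simp: S_def)
      fix v assume v: "v \<in> S" "Re v = 0"
      then have "v = Complex 0 (Im v)" by (auto simp: complex_eq_iff)
      then show "left_ext q v = w" using const[of "Im v"] v by (auto simp: S_def)
    qed (intro continuous_intros)+
  qed auto
  have "Q z = w" if "z \<in> S" for z
  proof (rule analytic_continuation_open[of "S \<inter> {z. 0 < Re z}" S Q "\<lambda>_. w"])
    have "Complex (1/2) ((y1 + y2) / 2) \<in> S \<inter> {z. 0 < Re z}" using y by (simp add: S_def)
    then show "S \<inter> {z. 0 < Re z} \<noteq> {}" by blast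
    show "open (S \<inter> {z. 0 < Re z})" using S open_halfspace_Re_gt by blast
    have "S = {v. - 1 < Re v} \<inter> {v. Re v < 1} \<inter> {v. y1 < Im v} \<inter> {v. Im v < y2}"
      by (auto simp: S_def)
    then have "convex S"
      by (simp add: convex_Int convex_halfspace_Re_lt convex_halfspace_Re_gt convex_halfspace_Im_lt convex_halfspace_Im_gt)
    then show "connected S" by (rule convex_connected)
  qed (use S \<open>Q holomorphic_on S\<close> that in \<open>auto simp: Q_def\<close>)
  then have qw: "q z = w" if "z \<in> S \<inter> left_halfplane" for z
    using that by (force simp: Q_def left_halfplane_def)
  show ?thesis
  proof (rule analytic_continuation_open[of "S \<inter> left_halfplane" left_halfplane q "\<lambda>_. w"])
    have "Complex (-1/2) ((y1 + y2) / 2) \<in> S \<inter> left_halfplane" using y by (simp add: S_def left_halfplane_def)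
    then show "S \<inter> left_halfplane \<noteq> {}" by blast
    show "v \<in> left_halfplane" using v by (simp add: left_halfplane_def)
  qed (use S open_left_halfplane hol qw convex_connected[OF convex_left_halfplane] in auto)
qed

subsection \<open>The extension in logarithmic coordinates\<close>

abbreviation turn :: "int \<Rightarrow> complex" where "turn n \<equiv> 2 * of_real pi * of_int n * \<i>"

text \<open>With \<open>\<phi> v = log (f (exp v))\<close> the periodicity says that
  \<open>f\<close> winds around 0 once with \<open>exp v\<close>, and \<open>asym\<close> is the
  normalisation at 0. In \<open>key\<close> the weight \<open>N\<close> runs through an interval
  because different values matter: the right endpoint gives the growth of \<open>h\<close>, values
  below it the dilatation, and \<open>t / (1 + t)\<close> excludes a bracket on the negative
  axis.\<close>

locale loewner_data =
  fixes s c :: complex and k :: real and \<phi> :: "complex \<Rightarrow> complex"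
  assumes a_pos: "Re s > 0" and k: "0 \<le> k" "k < 1"
    and hol: "\<phi> holomorphic_on left_halfplane"
    and per: "Re v < 0 \<Longrightarrow> \<phi> (v + 2 * of_real pi * \<i>) = \<phi> v + 2 * of_real pi * \<i>"
    and asym: "e > 0 \<Longrightarrow> \<exists>L<0. \<forall>v. Re v < L \<longrightarrow> cmod (\<phi> v - v) < e \<and> cmod (deriv \<phi> v - 1) < e"
    and deriv_nz: "Re v < 0 \<Longrightarrow> deriv \<phi> v \<noteq> 0"
    and key: "Re v < 0 \<Longrightarrow> 0 \<le> N \<Longrightarrow> N \<le> 1 - exp (2 * Re v / Re s) \<Longrightarrow>
      cmod (s + c - (c + of_real (Re s) * (deriv \<phi> v + s * deriv (deriv \<phi>) v / deriv \<phi> v)) * of_real N) \<le> k * cmod s"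
begin

abbreviation "a \<equiv> Re s"

text \<open>At z = exp v, \<open>\<gamma>\<close> is z f'/f and \<open>H\<close> is the braced
  expression of the hypothesis, since the logarithmic derivative of \<open>\<gamma>\<close> is 1 + z
  f''/f' - z f'/f. The argument \<open>x\<close> of \<open>G\<close> and \<open>W\<close> is kept
  apart from \<open>v\<close> because shrinking the disc separates it from
  \<open>- Re v\<close>.\<close>

definition "\<gamma> = deriv \<phi>"
definition "H v = \<gamma> v + s * deriv \<gamma> v / \<gamma> v"
definition A :: "real \<Rightarrow> real" where "A x = exp (2 * x / a) - 1"
definition "G v x = 1 - of_real a / c * of_real (A x) * \<gamma> v"
definition "W v x = c * of_real (exp (- 2 * x / a)) - of_real (a * (1 - exp (- 2 * x / a))) * H v"

section \<open>Elementary consequences and periodicity\<close>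

lemma s_nz: "s \<noteq> 0" using a_pos by auto

lemma cmod_s_pos: "cmod s > 0" using s_nz by simp

lemma hol_\<gamma>: "\<gamma> holomorphic_on left_halfplane"
  unfolding \<gamma>_def by (rule holomorphic_deriv[OF hol open_left_halfplane])

lemma has_deriv_\<phi>: "Re v < 0 \<Longrightarrow> (\<phi> has_field_derivative \<gamma> v) (at v)"
  unfolding \<gamma>_def by (rule holomorphic_derivI[OF hol open_left_halfplane]) (simp add: left_halfplane_def)

lemma has_deriv_\<gamma>: "Re v < 0 \<Longrightarrow> (\<gamma> has_field_derivative deriv \<gamma> v) (at v)"
  by (rule holomorphic_derivI[OF hol_\<gamma> open_left_halfplane]) (simp add: left_halfplane_def)

lemma \<gamma>_nz: "Re v < 0 \<Longrightarrow> \<gamma> v \<noteq> 0"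
  using deriv_nz by (simp add: \<gamma>_def)

lemma hol_H: "H holomorphic_on left_halfplane"
proof -
  have "deriv \<gamma> holomorphic_on left_halfplane" by (rule holomorphic_deriv[OF hol_\<gamma> open_left_halfplane])
  then show ?thesis unfolding H_def
    by (intro holomorphic_intros hol_\<gamma> open_left_halfplane) (simp_all add: left_halfplane_def \<gamma>_nz)
qed

lemma H_bound: "Re v < 0 \<Longrightarrow> 0 \<le> N \<Longrightarrow> N \<le> 1 - exp (2 * Re v / a) \<Longrightarrow>
    cmod (s + c - (c + of_real a * H v) * of_real N) \<le> k * cmod s"
  using key[of v N] by (simp add: H_def \<gamma>_def)

lemma sc_bound: "cmod (s + c) \<le> k * cmod s"
  using H_bound[of "-1" 0] a_pos by simp

lemma c_nz: "c \<noteq> 0"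
  using sc_bound k cmod_s_pos by auto

text \<open>The last condition puts \<open>z\<close> into the half-plane
  \<open>Re (cnj s * z) > 0\<close>, where adding a nonnegative multiple of \<open>z\<close> to
  \<open>s\<close> cannot decrease the modulus. This excludes positive real values of
  \<open>E\<close> on the far left, where \<open>\<gamma>\<close> is close to 1.\<close>

lemma phase_excluded:
  assumes "cmod (s + of_real t * z) \<le> k * cmod s" "t \<ge> 0" "cmod (z - 1) < a / cmod s"
  shows False
proof -
  have "\<bar>Re (cnj s * (z - 1))\<bar> \<le> cmod s * cmod (z - 1)"
    using abs_Re_le_cmod[of "cnj s * (z - 1)"] by (simp add: norm_mult)
  also have "\<dots> < a" using assms(3) cmod_s_pos by (simp add: field_simps)
  finally have "Re (cnj s * z) \<ge> 0" by (simp add: algebra_simps)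
  then have "0 \<le> 2 * t * Re (cnj s * z)" using assms(2) by simp
  have "cmod s ^ 2 \<le> cmod s ^ 2 + 2 * t * Re (cnj s * z) + (t * cmod z)\<^sup>2"
    using \<open>0 \<le> 2 * t * Re (cnj s * z)\<close> by simp
  also have "\<dots> = cmod (s + of_real t * z) ^ 2"
    by (simp add: cmod_power2 power_mult_distrib) (simp add: power2_eq_square algebra_simps)
  also have "\<dots> \<le> (k * cmod s) ^ 2" using assms(1) by (intro power_mono) auto
  also have "\<dots> < cmod s ^ 2" using k cmod_s_pos by (intro power_strict_mono) auto
  finally show False by simp
qed

lemma per_int: "Re v < 0 \<Longrightarrow> \<phi> (v + turn n) = \<phi> v + turn n"
proof (induction n arbitrary: v rule: int_induct[where k = 0])
  case (step1 i)
  have "\<phi> (v + 2 * of_real pi * of_int (i + 1) * \<i>) = \<phi> ((v + 2 * of_real pi * of_int i * \<i>) + 2 * of_real pi * \<i>)"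
    by (simp add: algebra_simps)
  also have "\<dots> = \<phi> (v + 2 * of_real pi * of_int i * \<i>) + 2 * of_real pi * \<i>"
    by (rule per) (use step1 in auto)
  also have "\<dots> = \<phi> v + 2 * of_real pi * of_int (i + 1) * \<i>" using step1 by (simp add: algebra_simps)
  finally show ?case .
next
  case (step2 i)
  have "\<phi> (v + 2 * of_real pi * of_int (i - 1) * \<i>) + 2 * of_real pi * \<i> =
     \<phi> ((v + 2 * of_real pi * of_int (i - 1) * \<i>) + 2 * of_real pi * \<i>)"
    by (rule per[symmetric]) (use step2 in auto)
  also have "\<dots> = \<phi> (v + 2 * of_real pi * of_int i * \<i>)" by (simp add: algebra_simps)
  also have "\<dots> = \<phi> v + 2 * of_real pi * of_int i * \<i>" using step2 by blast
  finally show ?case by (simp add: algebra_simps)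
qed auto

lemma \<gamma>_per_int: assumes "Re v < 0" shows "\<gamma> (v + turn n) = \<gamma> v"
proof -
  define p where "p = turn n"
  have "(\<phi> has_field_derivative \<gamma> (v + p)) (at (v + p))"
    by (rule has_deriv_\<phi>) (use assms in \<open>simp add: p_def\<close>)
  then have 1: "((\<lambda>w. \<phi> (w + p)) has_field_derivative \<gamma> (v + p)) (at v)"
    by (simp add: DERIV_shift)
  have "((\<lambda>w. \<phi> w + p) has_field_derivative \<gamma> v) (at v)"
    using has_deriv_\<phi>[OF assms] by (auto intro!: derivative_eq_intros)
  then have "((\<lambda>w. \<phi> (w + p)) has_field_derivative \<gamma> v) (at v)"
    by (rule has_field_derivative_transform_within_open[OF _ open_left_halfplane])
       (use assms per_int in \<open>auto simp: left_halfplane_def p_def\<close>)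
  then show ?thesis using 1 DERIV_unique unfolding p_def by blast
qed

lemma shift_to_strip:
  obtains n :: int where "0 \<le> Im (v + turn n)" "Im (v + turn n) \<le> 2 * pi"
proof -
  define n where "n = - \<lfloor>Im v / (2 * pi)\<rfloor>"
  have p: "2 * pi > 0" by simp
  have "of_int (- n) \<le> Im v / (2 * pi)" "Im v / (2 * pi) \<le> of_int (- n) + 1"
    unfolding n_def by linarith+
  then have "0 \<le> Im v + 2 * pi * of_int n" "Im v + 2 * pi * of_int n \<le> 2 * pi"
    unfolding pos_le_divide_eq[OF p] pos_divide_le_eq[OF p] by (auto simp: algebra_simps)
  then show ?thesis using that[of n] by simp
qed

text \<open>\<open>G v x\<close> is a nonpositive real iff \<open>E v\<close> is a real in \<open>(0, A x]\<close>; for \<open>x \<le> - Re v\<close> this puts \<open>v\<close>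
  into \<open>bad 0\<close>.\<close>

definition "E v = c / (of_real a * \<gamma> v)"

definition "bad \<epsilon> = {v. Re v < 0 \<and> Im (E v) = 0 \<and> Re (E v) > 0 \<and> 2 / a * (Re v + \<epsilon>) + ln (1 + Re (E v)) \<le> 0}"

section \<open>The bracket avoids the negative axis\<close>

lemma E_nz: "Re v < 0 \<Longrightarrow> E v \<noteq> 0"
  using c_nz a_pos \<gamma>_nz by (simp add: E_def)

lemma hol_E: "E holomorphic_on left_halfplane"
  unfolding E_def by (intro holomorphic_intros hol_\<gamma>) (use a_pos \<gamma>_nz in \<open>auto simp: left_halfplane_def\<close>)

lemma deriv_E:
  assumes "Re v < 0"
  shows "deriv E v = - c * deriv \<gamma> v / (of_real a * (\<gamma> v)\<^sup>2)"
proof -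
  have "(E has_field_derivative - c * deriv \<gamma> v / (of_real a * (\<gamma> v)\<^sup>2)) (at v)"
    unfolding E_def using assms a_pos \<gamma>_nz[OF assms]
    by (auto intro!: derivative_eq_intros has_deriv_\<gamma>[THEN DERIV_chain2] simp: power2_eq_square field_simps)
  then show ?thesis by (rule DERIV_imp_deriv)
qed

text \<open>Where \<open>E v = t\<close> is real, \<open>a * \<gamma> v = c / t\<close> and
  \<open>deriv \<gamma> v / \<gamma> v = - deriv E v / t\<close>. The weight
  \<open>N = t / (1 + t)\<close> is the one for which the terms with \<open>c\<close> cancel in
  \<open>key\<close>, and membership in \<open>bad \<epsilon>\<close> makes it admissible.\<close>

lemma bad_deriv:
  assumes "v \<in> bad \<epsilon>" "\<epsilon> \<ge> 0"
  shows "cmod (1 + of_real (a / (1 + Re (E v))) * deriv E v) \<le> k"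
proof -
  define t where "t = Re (E v)"
  have v: "Re v < 0" "E v = of_real t" "t > 0" "2 / a * (Re v + \<epsilon>) + ln (1 + t) \<le> 0"
    using assms by (auto simp: bad_def t_def complex_eq_iff)
  define N where "N = t / (1 + t)"
  have "2 / a * Re v + ln (1 + t) \<le> 0"
    using v(4) assms(2) a_pos by (smt (verit) divide_pos_pos mult_left_mono)
  then have "ln (1 + t) \<le> - (2 * Re v / a)" by simp
  then have "exp (ln (1 + t)) \<le> exp (- (2 * Re v / a))" by (simp only: exp_le_cancel_iff)
  then have "1 + t \<le> exp (- (2 * Re v / a))" using v(3) by simp
  then have "inverse (exp (- (2 * Re v / a))) \<le> inverse (1 + t)" using v(3) by (intro le_imp_inverse_le) auto
  then have "exp (2 * Re v / a) \<le> 1 / (1 + t)" by (simp add: exp_minus inverse_eq_divide)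
  also have "\<dots> = 1 - N" using v(3) by (simp add: N_def field_simps)
  finally have "N \<le> 1 - exp (2 * Re v / a)" by simp
  moreover have "N \<ge> 0" using v(3) by (simp add: N_def)
  ultimately have b: "cmod (s + c - (c + of_real a * H v) * of_real N) \<le> k * cmod s"
    by (intro H_bound v(1))
  have tz: "complex_of_real t \<noteq> 0" "complex_of_real (1 + t) \<noteq> 0" "complex_of_real a \<noteq> 0"
    using v(3) a_pos by (simp_all del: of_real_add)
  have g: "of_real a * \<gamma> v = c / of_real t"
    using v(2) \<gamma>_nz[OF v(1)] tz by (simp add: E_def field_simps)
  have "deriv \<gamma> v / \<gamma> v = - deriv E v * (of_real a * \<gamma> v) / c"
    using deriv_E[OF v(1)] \<gamma>_nz[OF v(1)] tz c_nz by (simp add: field_simps power2_eq_square)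
  also have "\<dots> = - deriv E v / of_real t" unfolding g using c_nz by simp
  finally have dg: "deriv \<gamma> v / \<gamma> v = - deriv E v / of_real t" .
  have "of_real a * H v = of_real a * \<gamma> v + of_real a * (s * (deriv \<gamma> v / \<gamma> v))"
    unfolding H_def by (simp add: ring_distribs)
  then have "of_real a * H v = c / of_real t - of_real a * (s * deriv E v / of_real t)"
    unfolding g dg by simp
  then have "s + c - (c + of_real a * H v) * of_real N = s * (1 + of_real (a / (1 + t)) * deriv E v)"
    unfolding N_def using tz by (simp add: field_simps)
  then have "cmod s * cmod (1 + of_real (a / (1 + t)) * deriv E v) \<le> k * cmod s"
    using b by (simp only: norm_mult)
  then show ?thesis using cmod_s_pos by (simp add: t_def mult.commute)
qed

text \<open>By \<open>bad_deriv\<close>, \<open>z = a / (1 + t) * deriv E v\<close> lies in the unit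
  disc around -1, which inversion maps to the half-plane \<open>Re (1 / z) < - 1 / 2\<close>. When
  the value of \<open>E\<close> is raised from \<open>t\<close> along the reals, \<open>Re v\<close>
  therefore falls faster than \<open>a / 2 * ln (1 + t)\<close> grows, and the inequality in
  \<open>bad \<epsilon>\<close> becomes strict.\<close>

lemma bad_move:
  assumes "v \<in> bad \<epsilon>" "\<epsilon> \<ge> 0"
  obtains v' where "v' \<in> bad \<epsilon>" "Re (E v') > Re (E v)" "2 / a * (Re v' + \<epsilon>) + ln (1 + Re (E v')) < 0"
proof -
  define t where "t = Re (E v)"
  have v: "Re v < 0" "E v = of_real t" "t > 0" "2 / a * (Re v + \<epsilon>) + ln (1 + t) \<le> 0"
    using assms by (auto simp: bad_def t_def complex_eq_iff)
  define z where "z = of_real (a / (1 + t)) * deriv E v"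
  have z1: "cmod (1 + z) < 1" using bad_deriv[OF assms] k by (simp add: z_def t_def)
  then have z0: "z \<noteq> 0" by auto
  then have E'0: "deriv E v \<noteq> 0" by (auto simp: z_def)
  have rez: "Re (1 / z) < - 1 / 2"
  proof -
    have "cmod (1 + z) ^ 2 < 1" using z1 by (simp add: power_less_one_iff)
    moreover have "cmod (1 + z) ^ 2 = 1 + 2 * Re z + cmod z ^ 2"
      unfolding cmod_power2 by (simp add: power2_eq_square algebra_simps)
    ultimately have "2 * Re z + cmod z ^ 2 < 0" by simp
    moreover have "cmod z ^ 2 > 0" using z0 by simp
    ultimately have "Re z / cmod z ^ 2 < - 1 / 2" by (simp add: field_simps)
    then show ?thesis by (simp add: Re_divide cmod_power2)
  qed
  obtain r where r: "r > 0" "ball v r \<subseteq> left_halfplane" "open (E ` ball v r)" "inj_on E (ball v r)"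
    using has_complex_derivative_locally_invertible[OF hol_E _ open_left_halfplane E'0] v
    by (auto simp: left_halfplane_def)
  obtain g where g: "g holomorphic_on (E ` ball v r)" "\<And>w. w \<in> ball v r \<Longrightarrow> deriv E w * deriv g (E w) = 1"
      "\<And>w. w \<in> ball v r \<Longrightarrow> g (E w) = w"
    using holomorphic_has_inverse[OF holomorphic_on_subset[OF hol_E r(2)] open_ball r(4)] by metis
  have vb: "v \<in> ball v r" using r by simp
  have dg: "(g has_field_derivative deriv g (of_real t)) (at (of_real t))"
    by (rule holomorphic_derivI[OF g(1) r(3)]) (use vb v(2) in \<open>metis imageI\<close>)
  have dgv: "deriv g (of_real t) = of_real (a / (1 + t)) * (1 / z)"
  proof -
    have "deriv g (of_real t) = 1 / deriv E v" using g(2)[OF vb] E'0 v(2) by (simp add: field_simps)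
    moreover have "of_real (a / (1 + t)) \<noteq> (0 :: complex)" using v(3) a_pos by (simp del: of_real_divide)
    ultimately show ?thesis by (simp add: z_def del: of_real_divide)
  qed
  define \<psi> where "\<psi> h = 2 / a * (Re (g (of_real h)) + \<epsilon>) + ln (1 + h)" for h
  have "(g \<circ> of_real has_vector_derivative 1 * deriv g (of_real t)) (at t)"
    by (rule field_vector_diff_chain_at[where f = of_real, OF _ dg]) (auto intro!: derivative_eq_intros)
  then have dre: "((\<lambda>h. Re (g (of_real h))) has_real_derivative Re (deriv g (of_real t))) (at t)"
    by (intro has_field_derivative_Re) (simp add: o_def)
  have dln: "((\<lambda>h. ln (1 + h)) has_real_derivative 1 / (1 + t)) (at t)"
    using v(3) by (auto intro!: derivative_eq_intros)
  have "(\<psi> has_real_derivative 2 / a * Re (deriv g (of_real t)) + 1 / (1 + t)) (at t)"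
    unfolding \<psi>_def by (rule DERIV_cong, rule DERIV_add[OF DERIV_cmult[OF DERIV_add[OF dre DERIV_const]] dln]) simp
  moreover have "2 / a * Re (deriv g (of_real t)) + 1 / (1 + t) < 0"
  proof -
    have "Re (deriv g (of_real t)) = a / (1 + t) * Re (1 / z)"
    proof -
      have "Re (of_real r * w) = r * Re w" for r w by simp
      then show ?thesis unfolding dgv by blast
    qed
    then have "2 / a * Re (deriv g (of_real t)) + 1 / (1 + t) = (2 * Re (1 / z) + 1) / (1 + t)"
      using a_pos v(3) by (simp add: add_divide_distrib)
    then show ?thesis using rez v(3) by (simp add: divide_neg_pos)
  qed
  ultimately obtain d where d: "d > 0" "\<And>h. 0 < h \<Longrightarrow> h < d \<Longrightarrow> \<psi> (t + h) < \<psi> t"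
    using DERIV_neg_dec_right by blast
  have \<psi>t: "\<psi> t \<le> 0" using v g(3)[OF vb] by (simp add: \<psi>_def)
  have "of_real t \<in> E ` ball v r" using vb v(2) by (metis imageI)
  then obtain d' where d': "d' > 0" "ball (of_real t) d' \<subseteq> E ` ball v r"
    using r(3) open_contains_ball by blast
  define h where "h = min d d' / 2"
  have h: "0 < h" "h < d" "h < d'" using d d' by (auto simp: h_def)
  have "of_real (t + h) \<in> E ` ball v r"
    using d'(2) h by (intro subsetD[OF d'(2)]) (simp add: dist_norm)
  then obtain v' where v': "v' \<in> ball v r" "E v' = of_real (t + h)" by (metis imageE)
  have "g (of_real (t + h)) = v'" using g(3)[OF v'(1)] v'(2) by simp
  then have neg: "2 / a * (Re v' + \<epsilon>) + ln (1 + Re (E v')) < 0"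
    using d(2)[of h] h \<psi>t v'(2) by (simp add: \<psi>_def)
  show ?thesis
  proof (rule that[of v'])
    show "v' \<in> bad \<epsilon>" using neg v' r(2) v(3) h by (auto simp: bad_def left_halfplane_def)
  qed (use neg v' h in \<open>auto simp: t_def\<close>)
qed

lemma bad_shift: "v \<in> bad \<epsilon> \<Longrightarrow> v + turn n \<in> bad \<epsilon>"
    and E_shift: "Re v < 0 \<Longrightarrow> E (v + turn n) = E v"
  by (simp_all add: bad_def E_def \<gamma>_per_int)

text \<open>Otherwise \<open>Re (E v)\<close> would attain a maximum on the bad set, against
  \<open>bad_move\<close>. The set is compact modulo the period because \<epsilon> keeps it away
  from the axis and \<open>phase_excluded\<close> away from the far left.\<close>

lemma bad_empty_pos:
  assumes "\<epsilon> > 0"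
  shows "bad \<epsilon> = {}"
proof (rule ccontr)
  assume ne: "bad \<epsilon> \<noteq> {}"
  obtain L where L: "L < 0" "\<And>v. Re v < L \<Longrightarrow> cmod (\<gamma> v - 1) < a / cmod s"
    using asym[of "a / cmod s"] a_pos cmod_s_pos by (auto simp: \<gamma>_def)
  have bL: "L \<le> Re v" if "v \<in> bad \<epsilon>" for v
  proof (rule ccontr)
    assume "\<not> L \<le> Re v"
    then have g: "cmod (\<gamma> v - 1) < a / cmod s" using L by auto
    have v: "Re v < 0" "E v = of_real (Re (E v))" "Re (E v) > 0" using that by (auto simp: bad_def complex_eq_iff)
    have "of_real (Re (E v)) * (of_real a * \<gamma> v) = c"
      using v(2) \<gamma>_nz[OF v(1)] a_pos by (simp add: E_def)
    then have "c = of_real (a * Re (E v)) * \<gamma> v" by (simp add: mult_ac)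
    then show False using phase_excluded[of "a * Re (E v)" "\<gamma> v"] sc_bound g v a_pos by simp
  qed
  have b\<epsilon>: "Re v \<le> - \<epsilon>" if "v \<in> bad \<epsilon>" for v
  proof -
    have "ln (1 + Re (E v)) > 0" "2 / a * (Re v + \<epsilon>) + ln (1 + Re (E v)) \<le> 0" using that by (auto simp: bad_def)
    then have "2 / a * (Re v + \<epsilon>) < 0" by linarith
    then show ?thesis using a_pos by (simp add: divide_less_0_iff)
  qed
  define S where "S = {v. L \<le> Re v \<and> Re v \<le> - \<epsilon> \<and> 0 \<le> Im v \<and> Im v \<le> 2 * pi}"
  have S: "S = cbox (Complex L 0) (Complex (- \<epsilon>) (2 * pi))"
    by (auto simp: S_def in_cbox_complex_iff)
  have Sc: "compact S" unfolding S by (rule compact_cbox)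
  have Sl: "S \<subseteq> left_halfplane" using assms by (auto simp: S_def left_halfplane_def)
  have cE: "continuous_on S E" by (rule holomorphic_on_imp_continuous_on[OF holomorphic_on_subset[OF hol_E Sl]])
  \<comment> \<open>The truncation \<open>max 0\<close> makes the logarithm continuous on all of
    \<open>S\<close>. Allowing \<open>Re (E v) = 0\<close> adds no point, as \<open>E\<close> has no
    zeros.\<close>
  define K where "K = S \<inter> {v \<in> S. Im (E v) = 0} \<inter> {v \<in> S. 0 \<le> Re (E v)} \<inter> {v \<in> S. 2 / a * (Re v + \<epsilon>) + ln (1 + max 0 (Re (E v))) \<le> 0}"
  have KI: "K = bad \<epsilon> \<inter> S"
  proof safe
    fix v assume "v \<in> K"
    then have v: "v \<in> S" "Im (E v) = 0" "0 \<le> Re (E v)" "2 / a * (Re v + \<epsilon>) + ln (1 + Re (E v)) \<le> 0" by (auto simp: K_def max_def)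
    have "Re v < 0" using v(1) Sl by (auto simp: left_halfplane_def)
    moreover have "Re (E v) \<noteq> 0" using E_nz[OF \<open>Re v < 0\<close>] v(2) by (simp add: complex_eq_iff)
    ultimately show "v \<in> bad \<epsilon>" using v by (auto simp: bad_def)
  qed (auto simp: K_def bad_def S_def)
  have "closed {v \<in> S. Im (E v) = 0}" "closed {v \<in> S. 0 \<le> Re (E v)}"
     "closed {v \<in> S. 2 / a * (Re v + \<epsilon>) + ln (1 + max 0 (Re (E v))) \<le> 0}"
    using compact_imp_closed[OF Sc]
    by (auto intro!: continuous_closed_preimage_constant continuous_on_closed_Collect_le continuous_intros cE)
       (use a_pos in auto)
  then have "compact K" unfolding K_def using Sc by (intro compact_Int_closed)
  obtain v0 where v0: "v0 \<in> bad \<epsilon>" using ne by blast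
  have toK: "\<exists>w\<in>K. E w = E v" if "v \<in> bad \<epsilon>" for v
  proof -
    obtain n :: int where n: "0 \<le> Im (v + turn n)" "Im (v + turn n) \<le> 2 * pi"
      using shift_to_strip by blast
    let ?w = "v + turn n"
    have "?w \<in> bad \<epsilon>" by (rule bad_shift[OF that])
    moreover have "?w \<in> S" using n bL[OF \<open>?w \<in> bad \<epsilon>\<close>] b\<epsilon>[OF \<open>?w \<in> bad \<epsilon>\<close>] by (auto simp: S_def)
    moreover have "E ?w = E v" using that by (intro E_shift) (simp add: bad_def)
    ultimately show ?thesis unfolding KI by blast
  qed
  then have "K \<noteq> {}" using v0 by blast
  have "continuous_on K (\<lambda>v. Re (E v))"
    by (intro continuous_intros continuous_on_subset[OF cE]) (auto simp: K_def)
  then obtain w where w: "w \<in> K" "\<And>v. v \<in> K \<Longrightarrow> Re (E v) \<le> Re (E w)"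
    using continuous_attains_sup[OF \<open>compact K\<close> \<open>K \<noteq> {}\<close>] by blast
  obtain w' where w': "w' \<in> bad \<epsilon>" "Re (E w') > Re (E w)"
    using bad_move[of w \<epsilon>] w(1) assms unfolding KI by auto
  then show False using toK[OF w'(1)] w(2) by force
qed

text \<open>A violation gives a point of \<open>bad 0\<close>, a set that might accumulate at the
  imaginary axis, where a maximum need not exist. One application of \<open>bad_move\<close> makes
  the inequality strict, and the slack is a positive \<epsilon> to which
  \<open>bad_empty_pos\<close> applies.\<close>

lemma G_slit:
  assumes "Re v < 0" "0 \<le> x" "x \<le> - Re v"
  shows "G v x \<notin> \<real>\<^sub>\<le>\<^sub>0"
proof
  assume "G v x \<in> \<real>\<^sub>\<le>\<^sub>0"
  then obtain g where g: "G v x = of_real g" "g \<le> 0" by (auto elim!: nonpos_Reals_cases)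
  have gE: "of_real a / c * \<gamma> v = 1 / E v" using \<gamma>_nz[OF assms(1)] c_nz a_pos by (simp add: E_def field_simps)
  have "G v x = 1 - of_real (A x) * (of_real a / c * \<gamma> v)" by (simp add: G_def mult_ac)
  then have "G v x = 1 - of_real (A x) / E v" unfolding gE by simp
  then have "of_real (A x) = (1 - of_real g) * E v" using E_nz[OF assms(1)] g by (simp add: field_simps)
  then have "E v = of_real (A x) / of_real (1 - g)" using g by (simp add: field_simps complex_eq_iff)
  then have Ev: "E v = of_real (A x / (1 - g))" by simp
  have A0: "A x \<ge> 0" using assms a_pos by (simp add: A_def)
  moreover have "A x \<noteq> 0" using Ev E_nz[OF assms(1)] by auto
  ultimately have Ap: "A x > 0" by simp
  have t: "0 < A x / (1 - g)" "A x / (1 - g) \<le> A x" using Ap g by (auto simp: field_simps mult_le_0_iff)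
  have "ln (1 + A x / (1 - g)) \<le> ln (1 + A x)" using t by simp
  also have "\<dots> = 2 * x / a" by (simp add: A_def)
  also have "\<dots> \<le> 2 / a * (- Re v)" using mult_left_mono[of x "- Re v" "2 / a"] assms a_pos by simp
  finally have "v \<in> bad 0" using assms(1) Ev t by (simp add: bad_def)
  then obtain v' where v': "v' \<in> bad 0" "2 / a * Re v' + ln (1 + Re (E v')) < 0"
    using bad_move[of v 0] by auto
  define \<epsilon> where "\<epsilon> = - (2 / a * Re v' + ln (1 + Re (E v'))) * a / 2"
  have "\<epsilon> > 0" unfolding \<epsilon>_def using v'(2) a_pos by (intro divide_pos_pos mult_pos_pos) auto
  moreover have "2 / a * (Re v' + \<epsilon>) + ln (1 + Re (E v')) = 0" using a_pos by (simp add: \<epsilon>_def field_simps)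
  then have "v' \<in> bad \<epsilon>" using v' by (simp add: bad_def)
  ultimately show False using bad_empty_pos by blast
qed

lemma W_bound:
  assumes "Re v < 0" "0 \<le> x" "x \<le> - Re v"
  shows "cmod (W v x + s) \<le> k * cmod s"
proof -
  have "exp (2 * Re v / a) \<le> exp (- 2 * x / a)" using divide_right_mono[of "2 * Re v" "- 2 * x" a] assms a_pos by simp
  then have "cmod (s + c - (c + of_real a * H v) * of_real (1 - exp (- 2 * x / a))) \<le> k * cmod s"
    using assms a_pos by (intro H_bound) (auto simp: divide_nonneg_pos)
  also have "s + c - (c + of_real a * H v) * of_real (1 - exp (- 2 * x / a)) = W v x + s"
    by (simp add: W_def algebra_simps)
  finally show ?thesis .
qed

lemma W_nz:
  assumes "Re v < 0" "0 \<le> x" "x \<le> - Re v"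
  shows "W v x \<noteq> 0"
  using W_bound[OF assms] k cmod_s_pos by auto

definition "P_lower = (1 - k) / (1 + k)"
definition "P_upper = 2 / (1 - k) + 1"

lemma P_lower_upper: "0 < P_lower" "P_lower \<le> 1" "1 \<le> P_upper"
  using k by (auto simp: P_lower_def P_upper_def field_simps)

text \<open>The quotient \<open>(P - 1) / (P + 1)\<close> equals \<open>(w + s) / s\<close>. For
  \<open>q = - s / w\<close> the condition \<open>cmod (q - 1) \<le> k * cmod q\<close> describes a
  disc centred on the real axis with leftmost point \<open>1 / (1 + k)\<close>; as
  \<open>P = 2 * q - 1\<close>, this is the origin of \<open>P_lower\<close>.\<close>

lemma dilatation_bounds:
  assumes w: "cmod (w + s) \<le> k * cmod s"
  defines "P \<equiv> - 1 - 2 * s / w"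
  shows "cmod (P - 1) \<le> k * cmod (P + 1)" "P_lower \<le> Re P" "cmod P \<le> P_upper"
proof -
  have w0: "w \<noteq> 0" using w k cmod_s_pos by auto
  define q where "q = - s / w"
  have q0: "q \<noteq> 0" using w0 s_nz by (simp add: q_def)
  have Pq: "P = 2 * q - 1" by (simp add: P_def q_def)
  have ws: "cmod w \<le> (1 + k) * cmod s" "(1 - k) * cmod s \<le> cmod w"
    using norm_triangle_ineq4[of "w + s" s] norm_triangle_ineq2[of s "w + s"] w by (auto simp: algebra_simps)
  have q1: "1 / (1 + k) \<le> cmod q" "cmod q \<le> 1 / (1 - k)"
    using ws w0 k by (auto simp: q_def norm_divide field_simps)
  have "q - 1 = - ((w + s) / w)" using w0 by (simp add: q_def field_simps)
  then have "cmod (q - 1) = cmod (w + s) / cmod w" by (simp only: norm_divide norm_minus_cancel)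
  also have "\<dots> \<le> k * cmod s / cmod w" by (rule divide_right_mono[OF w]) simp
  also have "\<dots> = k * cmod q" by (simp add: q_def norm_divide)
  finally have q2: "cmod (q - 1) \<le> k * cmod q" .
  have "P - 1 = 2 * (q - 1)" "P + 1 = 2 * q" by (auto simp: Pq)
  then have "cmod (P - 1) = 2 * cmod (q - 1)" "cmod (P + 1) = 2 * cmod q"
    by (simp_all only: norm_mult norm_numeral)
  then show "cmod (P - 1) \<le> k * cmod (P + 1)" using q2 by simp
  have "cmod (q - 1) ^ 2 \<le> (k * cmod q) ^ 2" using q2 by (intro power_mono) auto
  then have "1 + (1 - k\<^sup>2) * (cmod q)\<^sup>2 \<le> 2 * Re q"
  proof -
    have "cmod (q - 1) ^ 2 = cmod q ^ 2 - 2 * Re q + 1"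
      unfolding cmod_power2 by (simp add: power2_eq_square algebra_simps)
    then show ?thesis using \<open>cmod (q - 1) ^ 2 \<le> (k * cmod q) ^ 2\<close>
      by (simp add: power_mult_distrib algebra_simps)
  qed
  moreover have "(1 - k\<^sup>2) * (1 / (1 + k))\<^sup>2 \<le> (1 - k\<^sup>2) * (cmod q)\<^sup>2"
    using q1 k by (intro mult_left_mono power_mono) (auto simp: power_le_one)
  moreover have "(1 - k\<^sup>2) * (1 / (1 + k))\<^sup>2 = P_lower"
  proof -
    have "1 - k\<^sup>2 = (1 - k) * (1 + k)" by (simp add: power2_eq_square algebra_simps)
    then show ?thesis using k by (simp add: P_lower_def power2_eq_square)
  qed
  ultimately show "P_lower \<le> Re P" by (simp add: Pq)
  have "cmod P \<le> 2 * cmod q + 1" using norm_triangle_ineq4[of "2 * q" 1] by (simp add: Pq norm_mult)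
  then show "cmod P \<le> P_upper" using q1 by (simp add: P_upper_def)
qed

text \<open>In the coordinate \<open>u = log z\<close> the point \<open>1 / cnj z\<close> becomes \<open>- cnj u\<close>; the parameter \<open>e\<close> shrinks
  the disc by \<open>exp (- e)\<close>. On the right half-plane \<open>log_ext e\<close> is the logarithm of the extension, and
  its partial derivatives are \<open>\<i> * log_ext_D e u\<close> in the direction \<open>\<i>\<close> and
  \<open>log_ext_P e u * log_ext_D e u\<close> in the direction \<open>1\<close>.\<close>

definition reflect :: "real \<Rightarrow> complex \<Rightarrow> complex" where
  "reflect e u = of_real (- \<bar>Re u\<bar> - e) + \<i> * of_real (Im u)"

definition pos_part :: "complex \<Rightarrow> real" where "pos_part u = max (Re u) 0"

definition log_ext :: "real \<Rightarrow> complex \<Rightarrow> complex" where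
  "log_ext e u = left_ext \<phi> (reflect e u) + s * Ln (G (reflect e u) (pos_part u))"

definition log_ext_D :: "real \<Rightarrow> complex \<Rightarrow> complex" where
  "log_ext_D e u = \<gamma> (reflect e u) * (1 - of_real a / c * of_real (A (pos_part u)) * H (reflect e u)) / G (reflect e u) (pos_part u)"

definition log_ext_P :: "real \<Rightarrow> complex \<Rightarrow> complex" where
  "log_ext_P e u = (if Re u < 0 then 1 else - 1 - 2 * s / W (reflect e u) (pos_part u))"

section \<open>The logarithm of the extension and its derivative\<close>

lemma reflect_simps [simp]: "Re (reflect e u) = - \<bar>Re u\<bar> - e" "Im (reflect e u) = Im u"
  by (simp_all add: reflect_def)

lemma reflect_left: "Re u \<le> 0 \<Longrightarrow> reflect e u = u - of_real e"
  and reflect_right: "0 \<le> Re u \<Longrightarrow> reflect e u = - cnj u - of_real e"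
  by (simp_all add: complex_eq_iff)

lemma pos_part_left: "Re u \<le> 0 \<Longrightarrow> pos_part u = 0" and pos_part_right: "0 \<le> Re u \<Longrightarrow> pos_part u = Re u"
  by (simp_all add: pos_part_def)

lemma A_0 [simp]: "A 0 = 0" by (simp add: A_def)

lemma A_nonneg: "0 \<le> x \<Longrightarrow> 0 \<le> A x" using a_pos by (simp add: A_def)

lemma G_0 [simp]: "G v 0 = 1" by (simp add: G_def)

lemma reflect_region:
  assumes "0 \<le> e" "e > 0 \<or> Re u \<noteq> 0"
  shows "Re (reflect e u) < 0" "0 \<le> pos_part u" "pos_part u \<le> - Re (reflect e u)"
  using assms by (auto simp: pos_part_def)

lemma G_slit_reflect:
  assumes "0 \<le> e" "e > 0 \<or> Re u \<noteq> 0" shows "G (reflect e u) (pos_part u) \<notin> \<real>\<^sub>\<le>\<^sub>0"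
  by (rule G_slit[OF reflect_region[OF assms]])

lemma G_nz_reflect:
  assumes "0 \<le> e" "e > 0 \<or> Re u \<noteq> 0" shows "G (reflect e u) (pos_part u) \<noteq> 0"
  using G_slit_reflect[OF assms] by auto

text \<open>The last factor also occurs in \<open>log_ext_D\<close>; through it the nonvanishing of
  \<open>W\<close> and its upper bound pass to the tangential derivative.\<close>

lemma W_eq: "W v x = c * of_real (exp (- 2 * x / a)) * (1 - of_real a / c * of_real (A x) * H v)"
proof -
  have "exp (- (2 * x / a)) * A x = 1 - exp (- 2 * x / a)"
    by (simp add: A_def algebra_simps flip: exp_add)
  then have "complex_of_real (1 - exp (- 2 * x / a)) = of_real (exp (- (2 * x / a))) * of_real (A x)"
    by (metis of_real_mult)
  then have "W v x = c * of_real (exp (- (2 * x / a))) - of_real a * (of_real (exp (- (2 * x / a))) * of_real (A x)) * H v"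
    unfolding W_def of_real_mult by simp
  also have "\<dots> = c * of_real (exp (- 2 * x / a)) * (1 - of_real a / c * of_real (A x) * H v)"
    using c_nz by (simp add: field_simps)
  finally show ?thesis .
qed

lemma log_ext_D_nz:
  assumes "0 \<le> e" "e > 0 \<or> Re u \<noteq> 0" shows "log_ext_D e u \<noteq> 0"
proof -
  have "1 - of_real a / c * of_real (A (pos_part u)) * H (reflect e u) \<noteq> 0"
    using W_nz[OF reflect_region[OF assms]] unfolding W_eq by auto
  then show ?thesis using \<gamma>_nz[OF reflect_region(1)[OF assms]] G_nz_reflect[OF assms] by (simp add: log_ext_D_def)
qed

lemma log_ext_D_left: "Re u \<le> 0 \<Longrightarrow> log_ext_D e u = \<gamma> (u - of_real e)"
  by (simp add: log_ext_D_def pos_part_left reflect_left)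

lemma log_ext_left: "Re u \<le> 0 \<Longrightarrow> log_ext e u = left_ext \<phi> (u - of_real e)"
  by (simp add: log_ext_def pos_part_left reflect_left)

lemma log_ext_eq: "0 \<le> e \<Longrightarrow> e > 0 \<or> Re u \<noteq> 0 \<Longrightarrow> log_ext e u = \<phi> (reflect e u) + s * Ln (G (reflect e u) (pos_part u))"
  unfolding log_ext_def by (subst left_ext_simp) auto

lemma log_ext_has_derivative:
  assumes e: "0 \<le> e" and u: "Re u \<noteq> 0"
  shows "(log_ext e has_derivative (\<lambda>h. (of_real (Re h) * log_ext_P e u + \<i> * of_real (Im h)) * log_ext_D e u)) (at u)"
proof (cases "Re u < 0")
  case True
  have "((\<lambda>u. \<phi> (u - of_real e)) has_field_derivative \<gamma> (u - of_real e)) (at u)"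
  proof -
    have "((\<lambda>u. u - of_real e) has_field_derivative 1) (at u)" by (auto intro!: derivative_eq_intros)
    from DERIV_chain2[where f = \<phi> and g = "\<lambda>u. u - of_real e", OF has_deriv_\<phi> this] show ?thesis
      using True e by simp
  qed
  then have "((\<lambda>u. \<phi> (u - of_real e)) has_derivative (\<lambda>h. \<gamma> (u - of_real e) * h)) (at u)"
    by (simp add: has_field_derivative_def)
  then have "(log_ext e has_derivative (\<lambda>h. \<gamma> (u - of_real e) * h)) (at u)"
    by (rule has_derivative_transform_within_open[OF _ open_left_halfplane])
       (use True e in \<open>auto simp: left_halfplane_def log_ext_left\<close>)
  then show ?thesis
    by (rule has_derivative_eq_rhs)
       (use True in \<open>auto simp: log_ext_P_def log_ext_D_left fun_eq_iff complex_eq_iff algebra_simps\<close>)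
next
  case False
  then have u: "Re u > 0" using assms by simp
  define v where "v = - cnj u - of_real e"
  have v: "Re v < 0" "reflect e u = v" using u e by (auto simp: v_def reflect_right)
  define K where "K = of_real a / c"
  define g where "g = G v (Re u)"
  have gs: "g \<notin> \<real>\<^sub>\<le>\<^sub>0" using G_slit_reflect[OF e, of u] u v by (simp add: g_def pos_part_right)
  then have g0: "g \<noteq> 0" by auto
  \<comment> \<open>The reflected point moves by \<open>- cnj h\<close>, which is \<open>h\<close>
    along the axis and \<open>- h\<close> across it.\<close>
  have dv: "((\<lambda>u. - cnj u - of_real e) has_derivative (\<lambda>h. - cnj h)) (at u)"
    by (auto intro!: derivative_eq_intros)
  have d\<phi>: "((\<lambda>u. \<phi> (- cnj u - of_real e)) has_derivative (\<lambda>h. \<gamma> v * (- cnj h))) (at u)"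
    by (rule has_derivative_compose[OF dv]) (use has_deriv_\<phi>[OF v(1)] in \<open>simp add: has_field_derivative_def v_def\<close>)
  have d\<gamma>: "((\<lambda>u. \<gamma> (- cnj u - of_real e)) has_derivative (\<lambda>h. deriv \<gamma> v * (- cnj h))) (at u)"
    by (rule has_derivative_compose[OF dv]) (use has_deriv_\<gamma>[OF v(1)] in \<open>simp add: has_field_derivative_def v_def\<close>)
  have dA0: "((\<lambda>x. A x) has_real_derivative 2 / a * (A (Re u) + 1)) (at (Re u))"
    unfolding A_def using a_pos by (auto intro!: derivative_eq_intros)
  have dA: "((\<lambda>u. complex_of_real (A (Re u))) has_derivative (\<lambda>h. of_real (2 / a * (A (Re u) + 1) * Re h))) (at u)"
    by (intro has_derivative_of_real has_derivative_compose[where f = Re and g = A, OF _ dA0[unfolded has_field_derivative_def]])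
       (auto intro!: derivative_eq_intros)
  let ?dG = "\<lambda>h. - (K * of_real (A (Re u)) * (deriv \<gamma> v * (- cnj h)) + K * of_real (2 / a * (A (Re u) + 1) * Re h) * \<gamma> v)"
  let ?dR = "\<lambda>h. \<gamma> v * (- cnj h) + s * (inverse g * ?dG h)"
  have dG: "((\<lambda>u. 1 - K * of_real (A (Re u)) * \<gamma> (- cnj u - of_real e)) has_derivative
      ?dG) (at u)"
    by (rule has_derivative_eq_rhs, (rule derivative_intros dA d\<gamma>)+) (simp add: v_def)
  have g_alt: "1 - K * of_real (A (Re u)) * \<gamma> (- cnj u - of_real e) = g" by (simp add: g_def G_def K_def v_def)
  have dL: "((\<lambda>u. Ln (1 - K * of_real (A (Re u)) * \<gamma> (- cnj u - of_real e))) has_derivative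
      (\<lambda>h. inverse g * ?dG h)) (at u)"
    by (rule has_derivative_compose[OF dG])
       (use has_field_derivative_Ln[OF gs] in \<open>simp add: has_field_derivative_def g_alt\<close>)
  have dR: "((\<lambda>u. \<phi> (- cnj u - of_real e) + s * Ln (1 - K * of_real (A (Re u)) * \<gamma> (- cnj u - of_real e))) has_derivative
      ?dR) (at u)"
    by (intro has_derivative_add d\<phi> has_derivative_mult_right dL)
  have "(log_ext e has_derivative
      ?dR) (at u)"
  proof (rule has_derivative_transform_within_open[OF dR, of "{u. 0 < Re u}"])
    fix w assume "w \<in> {u. 0 < Re u}"
    then show "\<phi> (- cnj w - of_real e) + s * Ln (1 - K * of_real (A (Re w)) * \<gamma> (- cnj w - of_real e)) = log_ext e w"
      using e by (simp add: log_ext_eq reflect_right pos_part_right G_def K_def)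
  qed (use u open_halfspace_Re_gt in auto)
  then show ?thesis
  proof (rule has_derivative_eq_rhs)
    define D where "D = log_ext_D e u"
    have Aex: "A (Re u) + 1 = exp (2 * Re u / a)" by (simp add: A_def)
    \<comment> \<open>The tangential derivative: \<open>A\<close> is constant along vertical lines,
      so only \<open>\<phi>\<close> and the \<open>\<gamma>\<close> inside the logarithm are
      differentiated.\<close>
    have D1: "D = \<gamma> v - s * K * of_real (A (Re u)) * deriv \<gamma> v / g"
    proof -
      have "D * g = \<gamma> v * (1 - K * of_real (A (Re u)) * H v)"
        using g0 u by (simp add: D_def log_ext_D_def v pos_part_right g_def K_def)
      also have "\<dots> = \<gamma> v * (1 - K * of_real (A (Re u)) * \<gamma> v) - s * K * of_real (A (Re u)) * deriv \<gamma> v"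
        unfolding H_def using \<gamma>_nz[OF v(1)] by (simp add: field_simps)
      finally have "D * g = \<gamma> v * g - s * K * of_real (A (Re u)) * deriv \<gamma> v"
        by (simp add: g_def G_def K_def)
      then show ?thesis using g0 by (simp add: field_simps)
    qed
    define Q where "Q = 1 - K * of_real (A (Re u)) * H v"
    define w where "w = W v (Re u)"
    have wQ: "w = c * Q / of_real (A (Re u) + 1)"
      unfolding w_def W_eq Q_def K_def Aex by (simp add: exp_minus field_simps flip: exp_of_real)
    have w0: "w \<noteq> 0" using W_nz[OF v(1), of "Re u"] u e by (simp add: w_def v_def)
    have Q0: "Q \<noteq> 0" using w0 wQ by auto
    have DQ: "D = \<gamma> v * Q / g" using u by (simp add: D_def log_ext_D_def v pos_part_right g_def K_def Q_def)
    have A1: "complex_of_real (A (Re u) + 1) \<noteq> 0" unfolding Aex by simp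
    define B where "B = complex_of_real (A (Re u) + 1)"
    define A' where "A' = complex_of_real (2 / a * (A (Re u) + 1))"
    have B: "A' = 2 / of_real a * B" "B \<noteq> 0" using A1 by (simp_all add: A'_def B_def)
    \<comment> \<open>The derivative of \<open>A\<close> enters only across the axis and produces
      the term \<open>- 2 * s / w\<close> of \<open>log_ext_P\<close>.\<close>
    have D2: "2 * s / w * D = s * K * A' * \<gamma> v / g"
      unfolding DQ wQ K_def B_def[symmetric] B(1) using Q0 g0 c_nz a_pos B(2) by (simp add: field_simps)
    show "(\<lambda>h. ?dR h)
      = (\<lambda>h. (of_real (Re h) * log_ext_P e u + \<i> * of_real (Im h)) * log_ext_D e u)"
    proof
      fix h
      have ch: "cnj h = of_real (Re h) - \<i> * of_real (Im h)" by (simp add: complex_eq_iff)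
      have P: "log_ext_P e u = - 1 - 2 * s / w" using u by (simp add: log_ext_P_def v pos_part_right w_def)
      have "(of_real (Re h) * log_ext_P e u + \<i> * of_real (Im h)) * D = - cnj h * D - of_real (Re h) * (2 * s / w * D)"
        unfolding P ch by (simp add: algebra_simps)
      also have "\<dots> = - cnj h * D - of_real (Re h) * (s * K * A' * \<gamma> v / g)"
        by (simp only: D2)
      also have "\<dots> = - cnj h * (\<gamma> v - s * K * of_real (A (Re u)) * deriv \<gamma> v / g)
          - of_real (Re h) * (s * K * A' * \<gamma> v / g)"
        by (simp only: D1)
      also have "\<dots> = \<gamma> v * (- cnj h) + s * (inverse g * - (K * of_real (A (Re u)) * (deriv \<gamma> v * (- cnj h)) + K * (A' * of_real (Re h)) * \<gamma> v))"
        by (simp add: field_simps g0)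
      also have "A' * of_real (Re h) = of_real (2 / a * (A (Re u) + 1) * Re h)" by (simp add: A'_def)
      finally show "?dR h
        = (of_real (Re h) * log_ext_P e u + \<i> * of_real (Im h)) * log_ext_D e u" by (simp add: D_def)
    qed
  qed
qed

lemma log_ext_P_bounds:
  assumes "0 \<le> e" "Re u \<noteq> 0"
  shows "cmod (log_ext_P e u - 1) \<le> k * cmod (log_ext_P e u + 1)" "P_lower \<le> Re (log_ext_P e u)" "cmod (log_ext_P e u) \<le> P_upper"
  using dilatation_bounds[OF W_bound[OF reflect_region[OF assms(1) disjI2[OF assms(2)]]]] k P_lower_upper
  by (auto simp: log_ext_P_def)

text \<open>The parameters whose reflected point lies in the open half-plane; only the axis at
  \<open>e = 0\<close> is left out, where boundary values are required.\<close>

definition \<Omega> :: "(real \<times> complex) set" where "\<Omega> = {(e, u). 0 \<le> e \<and> (e > 0 \<or> Re u \<noteq> 0)}"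

lemma continuous_on_reflect: "continuous_on S (\<lambda>p. reflect (fst p) (snd p))"
  unfolding reflect_def by (intro continuous_intros)

lemma continuous_on_pos_part: "continuous_on S (\<lambda>p. pos_part (snd p))"
  unfolding pos_part_def by (intro continuous_intros)

lemma continuous_on_A: "continuous_on S f \<Longrightarrow> continuous_on S (\<lambda>p. A (f p))"
  unfolding A_def using a_pos by (intro continuous_intros) auto

lemma continuous_on_reflect_comp:
  assumes "q holomorphic_on left_halfplane"
  shows "continuous_on \<Omega> (\<lambda>p. q (reflect (fst p) (snd p)))"
  by (rule continuous_on_compose2[OF holomorphic_on_imp_continuous_on[OF assms] continuous_on_reflect])
     (auto simp: \<Omega>_def left_halfplane_def)

lemma continuous_on_G: "continuous_on \<Omega> (\<lambda>p. G (reflect (fst p) (snd p)) (pos_part (snd p)))"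
  unfolding G_def
  by (intro continuous_intros continuous_on_reflect_comp[OF hol_\<gamma>] continuous_on_A continuous_on_pos_part)

lemma continuous_on_log_ext: "continuous_on \<Omega> (\<lambda>(e, u). log_ext e u)"
proof -
  have "continuous_on \<Omega> (\<lambda>p. \<phi> (reflect (fst p) (snd p)) + s * Ln (G (reflect (fst p) (snd p)) (pos_part (snd p))))"
    by (intro continuous_intros continuous_on_reflect_comp[OF hol] continuous_on_G continuous_on_Ln)
       (auto simp: \<Omega>_def G_slit_reflect)
  then show ?thesis
    by (rule continuous_on_eq) (auto simp: \<Omega>_def log_ext_eq)
qed

lemma continuous_on_log_ext_D: "continuous_on \<Omega> (\<lambda>(e, u). log_ext_D e u)"
proof -
  have "continuous_on \<Omega> (\<lambda>p. log_ext_D (fst p) (snd p))"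
    unfolding log_ext_D_def
    by (intro continuous_intros continuous_on_reflect_comp hol_\<gamma> hol_H continuous_on_G continuous_on_A continuous_on_pos_part)
       (auto simp: \<Omega>_def G_nz_reflect)
  then show ?thesis by (simp add: case_prod_unfold)
qed

lemma continuous_on_slice:
  assumes "continuous_on T (\<lambda>(e, u). f e u)" "Pair e ` S \<subseteq> T"
  shows "continuous_on S (f e)"
proof -
  have "continuous_on S (Pair e)" using continuous_on_Pair[OF continuous_on_const continuous_on_id] by simp
  from continuous_on_compose2[OF assms(1) this assms(2)] show ?thesis by simp
qed

lemma log_ext_slice: "e > 0 \<Longrightarrow> continuous_on UNIV (log_ext e)"
  by (rule continuous_on_slice[OF continuous_on_log_ext]) (auto simp: \<Omega>_def)

lemma log_ext_locally_injective:
  assumes e: "0 \<le> e" "e > 0 \<or> Re u \<noteq> 0"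
  shows "\<exists>d>0. inj_on (log_ext e) (ball u d)"
proof -
  \<comment> \<open>For \<open>e > 0\<close> the ball may cross the axis; at \<open>e = 0\<close> it
    has to stay on one side.\<close>
  define r where "r = (if e > 0 then 1 else \<bar>Re u\<bar>)"
  have r: "r > 0" using e by (auto simp: r_def)
  have reg: "e > 0 \<or> Re w \<noteq> 0" if "w \<in> ball u r" for w
  proof (cases "e > 0")
    case False
    then have "cmod (u - w) < \<bar>Re u\<bar>" using that by (simp add: r_def dist_norm)
    then show ?thesis using abs_Re_le_cmod[of "u - w"] by auto
  qed auto
  have sub: "Pair e ` ball u r \<subseteq> \<Omega>" using reg e by (auto simp: \<Omega>_def)
  have cR: "continuous_on (ball u r) (log_ext e)" "continuous_on (ball u r) (log_ext_D e)"
    using continuous_on_slice[OF continuous_on_log_ext sub] continuous_on_slice[OF continuous_on_log_ext_D sub] by auto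
  show ?thesis
  proof (rule locally_injective_across_line[OF r cR(1), where D = "log_ext_D e" and P = "log_ext_P e" and m = P_lower and C = P_upper])
    show "log_ext_D e u \<noteq> 0" by (rule log_ext_D_nz[OF e])
    show "isCont (log_ext_D e) u" using cR(2) r by (simp add: continuous_on_eq_continuous_at)
    fix w assume w: "w \<in> ball u r" "Re w = 0"
    then have e0: "e > 0" using reg by auto
    have "((\<lambda>t. \<phi> ((w - of_real e) + \<i> * of_real t)) has_vector_derivative \<i> * \<gamma> (w - of_real e)) (at 0)"
    proof -
      have "(\<phi> \<circ> (\<lambda>t. (w - of_real e) + \<i> * of_real t) has_vector_derivative \<i> * \<gamma> (w - of_real e)) (at 0)"
        by (rule field_vector_diff_chain_at[where f = "\<lambda>t. (w - of_real e) + \<i> * of_real t"])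
           (use w e0 in \<open>auto intro!: derivative_eq_intros has_deriv_\<phi>\<close>)
      then show ?thesis by (simp add: o_def)
    qed
    then show "((\<lambda>t. log_ext e (w + \<i> * of_real t)) has_vector_derivative \<i> * log_ext_D e w) (at 0)"
      using w e0 by (simp add: log_ext_D_left log_ext_left algebra_simps)
  qed (use e in \<open>auto intro: log_ext_has_derivative log_ext_P_bounds P_lower_upper\<close>)
qed

section \<open>Equivariance under the period, growth at infinity, bijectivity for positive e\<close>

lemma reflect_shift: "reflect e (u + turn n) = reflect e u + turn n"
  and pos_part_shift: "pos_part (u + turn n) = pos_part u"
  by (simp_all add: complex_eq_iff pos_part_def)

lemma log_ext_shift':
  assumes "0 \<le> e" "e > 0 \<or> Re u \<noteq> 0"
  shows "log_ext e (u + turn n) = log_ext e u + turn n"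
  using assms reflect_region(1)[OF assms]
  by (subst (1 2) log_ext_eq) (auto simp: G_def reflect_shift pos_part_shift \<gamma>_per_int per_int)

lemma log_ext_shift:
  assumes e: "0 \<le> e" and cont: "continuous_on UNIV (log_ext e)"
  shows "log_ext e (u + turn n) = log_ext e u + turn n"
proof (cases "e > 0 \<or> Re u \<noteq> 0")
  case False
  \<comment> \<open>On the axis at \<open>e = 0\<close> the relation is a limit of the one at points
    to the left.\<close>
  define w where "w m = u - of_real (inverse (real (Suc m)))" for m
  have w: "w \<longlonglongrightarrow> u"
    unfolding w_def using tendsto_diff[OF tendsto_const tendsto_of_real[OF LIMSEQ_inverse_real_of_nat], of u] by simp
  have eq: "log_ext e (w m + turn n) = log_ext e (w m) + turn n" for m
    by (rule log_ext_shift'[OF e]) (use False in \<open>auto simp: w_def\<close>)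
  have "(\<lambda>m. log_ext e (w m + turn n)) \<longlonglongrightarrow> log_ext e (u + turn n)"
    by (intro continuous_on_tendsto_compose[OF cont] tendsto_intros w) auto
  moreover have "(\<lambda>m. log_ext e (w m) + turn n) \<longlonglongrightarrow> log_ext e u + turn n"
    by (intro tendsto_intros continuous_on_tendsto_compose[OF cont w]) auto
  ultimately show ?thesis unfolding eq by (rule LIMSEQ_unique)
qed (use log_ext_shift' e in blast)

text \<open>On the far right \<open>Ln (G v x)\<close> is \<open>2 * x / a\<close> up to a bounded
  error, the imaginary part of the principal branch being at most pi in modulus. Since
  \<open>- x + s * (2 * x / a) = x + 2 * (Im s / a) * x * \<i>\<close>, the comparison map is the
  vertical shear that describes the spirals in logarithmic coordinates. What lies between the far
  left and the far right is compact modulo the period.\<close>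

lemma log_ext_deviation:
  assumes e: "0 \<le> e" and cont: "continuous_on UNIV (log_ext e)"
  obtains C where "\<And>u. cmod (log_ext e u - (u + 2 * of_real (Im s / a * pos_part u) * \<i>)) \<le> C"
proof -
  define dev where "dev u = log_ext e u - (u + 2 * of_real (Im s / a * pos_part u) * \<i>)" for u
  obtain L where L: "L < 0" "\<And>v. Re v < L \<Longrightarrow> cmod (\<phi> v - v) < 1/2" "\<And>v. Re v < L \<Longrightarrow> cmod (\<gamma> v - 1) < 1/2"
    using asym[of "1/2"] by (auto simp: \<gamma>_def)
  have left: "cmod (dev u) \<le> 1/2 + e" if "Re u < L" for u
  proof -
    have "dev u = (\<phi> (u - of_real e) - (u - of_real e)) - of_real e"
      using that L e by (simp add: dev_def log_ext_left pos_part_left)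
    moreover have "cmod (\<phi> (u - of_real e) - (u - of_real e)) < 1/2" using that e by (intro L) auto
    ultimately show ?thesis
      using norm_triangle_ineq4[of "\<phi> (u - of_real e) - (u - of_real e)" "of_real e"] e by simp
  qed
  define K where "K = cmod (of_real a / c)"
  have K: "K > 0" using a_pos c_nz by (simp add: K_def)
  \<comment> \<open>Beyond \<open>X\<close> one has \<open>K * t > 2 * K + 4\<close> for
    \<open>t = exp (2 * x / a)\<close>, so the summand 1 of \<open>G\<close> is dominated and
    \<open>cmod (G v x)\<close> is at least \<open>K / 4 * t\<close>.\<close>
  define X where "X = max (- L) (a / 2 * ln (2 + 4 / K))"
  define C1 where "C1 = \<bar>ln (1 + 2 * K)\<bar> + \<bar>ln (K / 4)\<bar> + pi"
  have right: "cmod (dev u) \<le> 1/2 + e + cmod s * C1" if "Re u > X" for u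
  proof -
    define x v where "x = Re u" and "v = reflect e u"
    have x: "x > - L" "x > a / 2 * ln (2 + 4 / K)" "x > 0" using that L(1) by (auto simp: X_def x_def)
    have v: "Re v < L" "v = of_real (- x - e) + \<i> * of_real (Im u)" using x e by (auto simp: v_def x_def reflect_def)
    define t where "t = exp (2 * x / a)"
    have "ln (2 + 4 / K) < 2 * x / a" using x(2) a_pos by (simp add: field_simps)
    then have t: "2 + 4 / K < t" unfolding t_def using K
      by (metis add_pos_pos divide_pos_pos exp_less_mono exp_ln zero_less_numeral)
    then have t1: "t > 0" "K * t > 2 * K + 4" using K by (auto simp: field_simps intro: order.strict_trans[OF _ t])
    have At: "A x = t - 1" by (simp add: A_def t_def)
    have \<gamma>1: "cmod (\<gamma> v - 1) < 1/2" by (rule L) (rule v)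
    have \<gamma>2: "cmod (\<gamma> v) \<le> 3/2" "1/2 \<le> cmod (\<gamma> v)"
      using \<gamma>1 norm_triangle_ineq2[of "\<gamma> v" 1] norm_triangle_ineq2[of 1 "\<gamma> v"]
      by (auto simp: norm_minus_commute)
    define q where "q = of_real a / c * of_real (A x) * \<gamma> v"
    have g: "G v x = 1 - q" by (simp add: G_def q_def)
    have t2: "t \<ge> 1" using x a_pos by (simp add: t_def)
    have nq: "cmod q = K * (t - 1) * cmod (\<gamma> v)"
    proof -
      have "cmod (complex_of_real (A x)) = t - 1" unfolding norm_of_real At using t2 by simp
      then show ?thesis by (simp only: q_def K_def norm_mult)
    qed
    have "cmod q \<le> K * (t - 1) * (3/2)" unfolding nq using K t2 \<gamma>2 by (intro mult_left_mono) auto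
    then have up: "cmod (G v x) \<le> (1 + 2 * K) * t"
    proof -
      assume "cmod q \<le> K * (t - 1) * (3/2)"
      moreover have "K * (t - 1) * (3/2) = 3/2 * (K * t) - 3/2 * K" "(1 + 2 * K) * t = t + 2 * (K * t)"
        by (auto simp: field_simps)
      moreover have "cmod (1 - q) \<le> 1 + cmod q" using norm_triangle_ineq4[of 1 q] by simp
      ultimately show ?thesis using K t2 mult_pos_pos[OF K t1(1)] unfolding g by linarith
    qed
    have "K * (t - 1) * (1/2) \<le> cmod q" unfolding nq using K t2 \<gamma>2 by (intro mult_left_mono) auto
    then have lo: "K / 4 * t \<le> cmod (G v x)"
      using norm_triangle_ineq2[of q 1] t1 unfolding g norm_minus_commute[of 1 q] by (simp add: algebra_simps)
    have g0: "cmod (G v x) > 0" using lo K t1 by (smt (verit) divide_pos_pos mult_pos_pos)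
    have "ln (cmod (G v x)) \<le> ln (1 + 2 * K) + ln t"
      using up g0 K t1 by (subst ln_mult_pos[symmetric]) auto
    moreover have "ln (K / 4) + ln t \<le> ln (cmod (G v x))"
      using lo g0 K t1 by (subst ln_mult_pos[symmetric]) auto
    moreover have "ln t = 2 * x / a" by (simp add: t_def)
    ultimately have "\<bar>Re (Ln (G v x)) - 2 * x / a\<bar> \<le> \<bar>ln (1 + 2 * K)\<bar> + \<bar>ln (K / 4)\<bar>"
      using g0 by simp
    moreover have "\<bar>Im (Ln (G v x))\<bar> \<le> pi"
      using mpi_less_Im_Ln[of "G v x"] Im_Ln_le_pi[of "G v x"] g0 by auto
    ultimately have Lb: "cmod (Ln (G v x) - of_real (2 * x / a)) \<le> C1"
      using cmod_le[of "Ln (G v x) - of_real (2 * x / a)"] by (simp add: C1_def)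
    have sx: "s = of_real a + \<i> * of_real (Im s)" by (simp add: complex_eq_iff)
    have "dev u = (\<phi> v - v) - of_real e + s * (Ln (G v x) - of_real (2 * x / a))"
    proof -
      have "dev u = \<phi> v + s * Ln (G v x) - (u + 2 * of_real (Im s / a * x) * \<i>)"
        unfolding dev_def using e x by (subst log_ext_eq) (auto simp: v_def x_def pos_part_right)
      moreover have "v + s * of_real (2 * x / a) - (u + 2 * of_real (Im s / a * x) * \<i>) = - of_real e"
        unfolding v(2) using a_pos by (simp add: complex_eq_iff x_def)
      ultimately show ?thesis by (simp add: algebra_simps)
    qed
    then have "cmod (dev u) \<le> cmod (\<phi> v - v) + cmod (of_real e) + cmod (s * (Ln (G v x) - of_real (2 * x / a)))"
      using norm_triangle_ineq4[of "\<phi> v - v" "of_real e"]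
        norm_triangle_ineq[of "\<phi> v - v - of_real e" "s * (Ln (G v x) - of_real (2 * x / a))"] by simp
    also have "\<dots> \<le> 1/2 + e + cmod s * C1"
      unfolding norm_mult using L(2)[OF v(1)] e Lb by (intro add_mono mult_left_mono) auto
    finally show ?thesis .
  qed
  define S where "S = cbox (Complex L 0) (Complex X (2 * pi))"
  have "compact (dev ` S)"
    unfolding dev_def S_def pos_part_def
    by (intro compact_continuous_image continuous_intros continuous_on_subset[OF cont] compact_cbox) auto
  then obtain C2 where C2: "\<And>u. u \<in> S \<Longrightarrow> cmod (dev u) \<le> C2"
    using compact_imp_bounded by (force simp: bounded_iff)
  have mid: "cmod (dev u) \<le> C2" if "L \<le> Re u" "Re u \<le> X" for u
  proof -
    obtain n :: int where n: "0 \<le> Im (u + turn n)" "Im (u + turn n) \<le> 2 * pi"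
      using shift_to_strip by blast
    have "dev (u + turn n) = dev u"
      unfolding dev_def log_ext_shift[OF e cont] pos_part_shift by simp
    moreover have "u + turn n \<in> S"
      using n that by (auto simp: S_def in_cbox_complex_iff)
    ultimately show ?thesis using C2 by metis
  qed
  show ?thesis
  proof (rule that)
    fix u
    show "cmod (log_ext e u - (u + 2 * of_real (Im s / a * pos_part u) * \<i>)) \<le> max (1/2 + e) (max (1/2 + e + cmod s * C1) C2)"
      using left[of u] right[of u] mid[of u] unfolding dev_def by linarith
  qed
qed

lemma log_ext_proper:
  assumes e: "0 \<le> e" and cont: "continuous_on UNIV (log_ext e)"
  shows "bounded {u. cmod (log_ext e u) \<le> B}"
proof -
  obtain C where C: "\<And>u. cmod (log_ext e u - (u + 2 * of_real (Im s / a * pos_part u) * \<i>)) \<le> C"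
    using log_ext_deviation[OF assms] by blast
  have "cmod u \<le> (B + C) + ((B + C) + 2 * \<bar>Im s / a\<bar> * (B + C))" if "cmod (log_ext e u) \<le> B" for u
  proof -
    define w where "w = u + 2 * of_real (Im s / a * pos_part u) * \<i>"
    have "cmod w \<le> cmod (log_ext e u) + cmod (log_ext e u - w)"
      by (metis norm_minus_commute norm_triangle_sub)
    then have w: "cmod w \<le> B + C" using C[of u] that by (simp add: w_def)
    have re: "\<bar>Re u\<bar> \<le> B + C" using abs_Re_le_cmod[of w] w by (simp add: w_def)
    have p: "\<bar>pos_part u\<bar> \<le> B + C" using re unfolding pos_part_def max_def by (smt (verit))
    have "\<bar>Im w\<bar> \<le> B + C" using abs_Im_le_cmod[of w] w by simp
    moreover have "Im u = Im w - 2 * (Im s / a) * pos_part u" by (simp add: w_def)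
    ultimately have "\<bar>Im u\<bar> \<le> (B + C) + \<bar>2 * (Im s / a) * pos_part u\<bar>" by linarith
    also have "\<bar>2 * (Im s / a) * pos_part u\<bar> \<le> 2 * \<bar>Im s / a\<bar> * (B + C)"
      unfolding abs_mult using p by (intro mult_mono) auto
    finally show ?thesis using cmod_le[of u] re by linarith
  qed
  then show ?thesis unfolding bounded_iff by blast
qed

lemma \<phi>_injective_far_left:
  obtains L where "L < 0" "inj_on \<phi> {v. Re v < L}"
proof -
  obtain L where L: "L < 0" "\<And>v. Re v < L \<Longrightarrow> cmod (\<gamma> v - 1) < 1/2"
    using asym[of "1/2"] by (auto simp: \<gamma>_def)
  have "inj_on \<phi> {v. Re v < L}"
  proof (rule inj_onI)
    fix v w assume vw: "v \<in> {v. Re v < L}" "w \<in> {v. Re v < L}" "\<phi> v = \<phi> w"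
    have "cmod ((\<lambda>v. \<phi> v - v) v - (\<lambda>v. \<phi> v - v) w) \<le> 1/2 * cmod (v - w)"
    proof (rule field_differentiable_bound[where S = "{v. Re v < L}"])
      show "convex {v. Re v < L}" by (rule convex_halfspace_Re_lt)
      fix z assume z: "z \<in> {v. Re v < L}"
      then show "((\<lambda>v. \<phi> v - v) has_field_derivative \<gamma> z - 1) (at z within {v. Re v < L})"
        using L(1) by (intro derivative_intros has_field_derivative_at_within[OF has_deriv_\<phi>]) auto
      show "cmod (\<gamma> z - 1) \<le> 1/2" using L(2) z by (simp add: less_imp_le)
    qed (use vw in auto)
    then have "cmod (v - w) \<le> 1/2 * cmod (v - w)" using vw by (simp add: norm_minus_commute)
    then show "v = w" by simp
  qed
  then show ?thesis using that L by blast
qed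

text \<open>The value with a single preimage is taken so far to the left that, by the bounded
  deviation, all its preimages lie where \<open>\<phi>\<close> differs from the identity by a
  contraction. The shear is purely vertical and does not affect the real parts.\<close>

lemma log_ext_bij:
  assumes e: "0 < e"
  shows "bij (log_ext e)"
proof -
  have cont: "continuous_on UNIV (log_ext e)" by (rule log_ext_slice[OF e])
  obtain C where C: "\<And>u. cmod (log_ext e u - (u + 2 * of_real (Im s / a * pos_part u) * \<i>)) \<le> C"
    using log_ext_deviation[OF less_imp_le[OF e] cont] by blast
  obtain L where L: "L < 0" "inj_on \<phi> {v. Re v < L}" using \<phi>_injective_far_left by blast
  define w0 where "w0 = complex_of_real (L - C - 1)"
  have pre: "Re p < L" if "log_ext e p = w0" for p
  proof -
    have "\<bar>Re (log_ext e p - (p + 2 * of_real (Im s / a * pos_part p) * \<i>))\<bar> \<le> C"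
      using abs_Re_le_cmod C order.trans by blast
    then show ?thesis using that by (simp add: w0_def)
  qed
  show ?thesis
  proof (rule bij_if_proper_local_homeo[OF cont, of w0])
    fix u show "\<exists>d>0. inj_on (log_ext e) (ball u d)" by (rule log_ext_locally_injective) (use e in auto)
  next
    fix B show "bounded {u. cmod (log_ext e u) \<le> B}" by (rule log_ext_proper[OF less_imp_le[OF e] cont])
  next
    fix p q assume pq: "log_ext e p = w0" "log_ext e q = w0"
    have "\<phi> (p - of_real e) = \<phi> (q - of_real e)"
      using pre[OF pq(1)] pre[OF pq(2)] pq L(1) e by (simp add: log_ext_left)
    then show "p = q"
      using inj_onD[OF L(2), of "p - of_real e" "q - of_real e"] pre[OF pq(1)] pre[OF pq(2)] e by simp
  qed
qed

end

subsection \<open>Boundary behaviour\<close>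

lemma continuous_on_left_ext:
  fixes q :: "complex \<Rightarrow> complex"
  assumes hol: "q holomorphic_on left_halfplane"
    and cont: "\<And>Y. continuous_on {v. - 1 \<le> Re v \<and> Re v \<le> 0 \<and> \<bar>Im v\<bar> \<le> Y} (left_ext q)"
  shows "continuous_on {v. Re v \<le> 0} (left_ext q)"
  unfolding continuous_on_eq_continuous_within
proof
  fix v assume v: "v \<in> {v. Re v \<le> 0}"
  show "continuous (at v within {v. Re v \<le> 0}) (left_ext q)"
  proof (cases "Re v < 0")
    case True
    have "continuous_on left_halfplane (left_ext q)"
      by (rule continuous_on_eq[OF holomorphic_on_imp_continuous_on[OF hol]]) (auto simp: left_halfplane_def)
    then have "isCont (left_ext q) v"
      using True open_left_halfplane by (simp add: continuous_on_eq_continuous_at left_halfplane_def)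
    then show ?thesis by (rule continuous_at_imp_continuous_at_within)
  next
    case False
    define N where "N = {w. - 1 < Re w} \<inter> {w. Im w < \<bar>Im v\<bar> + 1} \<inter> {w. - (\<bar>Im v\<bar> + 1) < Im w}"
    let ?S = "{w. - 1 \<le> Re w \<and> Re w \<le> 0 \<and> \<bar>Im w\<bar> \<le> \<bar>Im v\<bar> + 1}"
    have "open N" unfolding N_def
      by (intro open_Int open_halfspace_Re_gt open_halfspace_Im_lt open_halfspace_Im_gt)
    have "at v within {w. Re w \<le> 0} = at v within ?S"
      by (rule at_within_nhd[OF _ \<open>open N\<close>]) (use False v in \<open>auto simp: N_def\<close>)
    moreover have "continuous (at v within ?S) (left_ext q)"
      using cont[of "\<bar>Im v\<bar> + 1"] False v by (auto simp: continuous_on_eq_continuous_within)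
    ultimately show ?thesis by simp
  qed
qed

section \<open>Growth of the derivative of h\<close>

context loewner_data
begin

definition h :: "complex \<Rightarrow> complex" where "h v = exp (\<phi> v / s)"

lemma hol_h: "h holomorphic_on left_halfplane"
  unfolding h_def using s_nz by (intro holomorphic_intros hol) auto

lemma deriv_h: assumes "Re v < 0" shows "deriv h v = h v * \<gamma> v / s"
proof (rule DERIV_imp_deriv)
  have "((\<lambda>v. \<phi> v / s) has_field_derivative \<gamma> v / s) (at v)"
    by (rule DERIV_cdivide[OF has_deriv_\<phi>[OF assms]])
  from DERIV_chain2[OF DERIV_exp this] show "(h has_field_derivative h v * \<gamma> v / s) (at v)"
    unfolding h_def by simp
qed

text \<open>Both \<open>s + c\<close> and the expression of \<open>key\<close> at the largest
  \<open>N\<close> have modulus at most \<open>k * cmod s\<close>, which bounds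
  \<open>a * N * cmod (H v)\<close> by twice that plus \<open>cmod c * N\<close>. As
  \<open>N\<close> behaves like \<open>2 * \<xi> / a\<close> near the axis, the two factors 2 cancel
  and the coefficient of \<open>1 / \<xi>\<close> is \<open>k\<close>, hence below 1.\<close>

lemma H_estimate:
  assumes "Re v < 0"
  shows "cmod (H v / s) \<le> k / (- Re v) + (2 * k / a + cmod c / (a * cmod s))"
proof -
  define \<xi> y N where "\<xi> = - Re v" and "y = 2 * \<xi> / a" and "N = 1 - exp (2 * Re v / a)"
  have "\<xi> > 0" using assms by (simp add: \<xi>_def)
  then have \<xi>: "\<xi> > 0" "y > 0" using a_pos by (auto simp: y_def)
  have N: "N = 1 - exp (- y)" by (simp add: N_def y_def \<xi>_def)
  have "exp (- y) \<le> 1 / (1 + y)" using exp_ge_add_one_self[of y] \<xi> by (simp add: exp_minus inverse_eq_divide frac_le)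
  then have Ny: "y / (1 + y) \<le> N" unfolding N using \<xi> by (simp add: field_simps)
  then have N0: "N > 0" using \<xi> by (smt (verit) divide_pos_pos)
  have iN: "1 / N \<le> 1 / y + 1"
  proof -
    have "1 / N \<le> 1 / (y / (1 + y))" using Ny N0 \<xi> by (intro divide_left_mono) auto
    then show ?thesis using \<xi> by (simp add: field_simps)
  qed
  have b: "cmod (s + c - (c + of_real a * H v) * of_real N) \<le> k * cmod s"
    by (rule H_bound) (use assms N0 in \<open>auto simp: N_def\<close>)
  define X where "X = s + c - (c + of_real a * H v) * of_real N"
  have "of_real (a * N) * H v = (s + c) - X - c * of_real N"
    by (simp add: X_def algebra_simps)
  then have "cmod (of_real (a * N) * H v) \<le> cmod (s + c) + cmod X + cmod (c * of_real N)"
    using norm_triangle_ineq4[of "(s + c) - X" "c * of_real N"] norm_triangle_ineq4[of "s + c" X] by simp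
  then have "a * N * cmod (H v) \<le> 2 * (k * cmod s) + cmod c * N"
    using b sc_bound N0 a_pos by (simp add: norm_mult X_def)
  then have "cmod (H v) \<le> (2 * (k * cmod s) + cmod c * N) / (a * N)"
    using a_pos N0 by (simp add: field_simps)
  also have "\<dots> = 2 * k * cmod s / a * (1 / N) + cmod c / a" using a_pos N0 by (simp add: field_simps)
  also have "\<dots> \<le> 2 * k * cmod s / a * (1 / y + 1) + cmod c / a"
    using iN k a_pos by (intro add_mono mult_left_mono) auto
  finally have "cmod (H v / s) \<le> (2 * k * cmod s / a * (1 / y + 1) + cmod c / a) / cmod s"
    unfolding norm_divide by (intro divide_right_mono) auto
  also have "\<dots> = k / \<xi> + (2 * k / a + cmod c / (a * cmod s))"
    using a_pos cmod_s_pos \<xi>(1) by (simp add: y_def field_simps)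
  finally show ?thesis by (simp add: \<xi>_def)
qed

text \<open>A holomorphic logarithm \<psi> of \<open>deriv h\<close> has derivative
  \<open>H / s\<close>, so the estimate of \<open>H\<close> integrates along horizontal lines
  starting at \<open>Re v = - 2\<close>, where compactness bounds the initial value.\<close>

lemma deriv_h_bound:
  obtains C where "0 \<le> C"
    "\<And>v. - 2 \<le> Re v \<Longrightarrow> Re v < 0 \<Longrightarrow> \<bar>Im v\<bar> \<le> Y \<Longrightarrow> cmod (deriv h v) \<le> C * (- Re v) powr - k"
proof -
  have hold: "deriv h holomorphic_on left_halfplane" by (rule holomorphic_deriv[OF hol_h open_left_halfplane])
  have nz: "deriv h v \<noteq> 0" if "v \<in> left_halfplane" for v
    using that \<gamma>_nz[of v] s_nz by (simp add: left_halfplane_def deriv_h h_def)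
  obtain \<psi> where \<psi>: "\<psi> holomorphic_on left_halfplane" "\<And>v. v \<in> left_halfplane \<Longrightarrow> deriv h v = exp (\<psi> v)"
    using contractible_imp_holomorphic_log[OF hold convex_imp_contractible[OF convex_left_halfplane] nz] by metis
  have d\<psi>: "(\<psi> has_field_derivative H v / s) (at v)" if v: "Re v < 0" for v
  proof -
    have vl: "v \<in> left_halfplane" using v by (simp add: left_halfplane_def)
    have 1: "(\<psi> has_field_derivative deriv \<psi> v) (at v)" by (rule holomorphic_derivI[OF \<psi>(1) open_left_halfplane vl])
    have "((\<lambda>v. exp (\<psi> v)) has_field_derivative exp (\<psi> v) * deriv \<psi> v) (at v)" by (rule DERIV_chain2[OF DERIV_exp 1])
    then have A: "(deriv h has_field_derivative exp (\<psi> v) * deriv \<psi> v) (at v)"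
      by (rule has_field_derivative_transform_within_open[OF _ open_left_halfplane vl]) (use \<psi> in auto)
    have dh: "(h has_field_derivative h v * \<gamma> v / s) (at v)"
      using holomorphic_derivI[OF hol_h open_left_halfplane vl] deriv_h[OF v] by simp
    have "((\<lambda>v. h v * \<gamma> v / s) has_field_derivative (h v * \<gamma> v / s * \<gamma> v + deriv \<gamma> v * h v) / s) (at v)"
      by (rule DERIV_cdivide[OF DERIV_mult'[OF dh has_deriv_\<gamma>[OF v], THEN DERIV_cong]]) (simp add: algebra_simps)
    then have B: "(deriv h has_field_derivative (h v * \<gamma> v / s * \<gamma> v + deriv \<gamma> v * h v) / s) (at v)"
      by (rule has_field_derivative_transform_within_open[OF _ open_left_halfplane vl])
         (auto simp: deriv_h left_halfplane_def)
    have "exp (\<psi> v) * deriv \<psi> v = (h v * \<gamma> v / s * \<gamma> v + deriv \<gamma> v * h v) / s" by (rule DERIV_unique[OF A B])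
    also have "\<dots> = deriv h v * (H v / s)"
      unfolding deriv_h[OF v] H_def using \<gamma>_nz[OF v] s_nz by (simp add: field_simps)
    finally have "exp (\<psi> v) * deriv \<psi> v = exp (\<psi> v) * (H v / s)" unfolding \<psi>(2)[OF vl] .
    then have "deriv \<psi> v = H v / s" unfolding mult_left_cancel[OF exp_not_eq_zero] .
    then show ?thesis using 1 by simp
  qed
  define C0 where "C0 = 2 * k / a + cmod c / (a * cmod s)"
  have C0: "C0 \<ge> 0" using k a_pos by (simp add: C0_def)
  \<comment> \<open>The added terms are a primitive of the bound in \<open>H_estimate\<close>, so
    the sum has a nonnegative derivative in \<xi>.\<close>
  have mono: "Re (\<psi> (of_real (- \<xi>) + \<i> * of_real y)) + k * ln \<xi> + C0 * \<xi> \<le> Re (\<psi> (of_real (- 2) + \<i> * of_real y)) + k * ln 2 + C0 * 2"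
    if \<xi>: "0 < \<xi>" "\<xi> \<le> 2" for \<xi> y
  proof (rule DERIV_nonneg_imp_nondecreasing[OF \<xi>(2), where f = "\<lambda>t. Re (\<psi> (of_real (- t) + \<i> * of_real y)) + k * ln t + C0 * t"])
    fix t assume t: "\<xi> \<le> t" "t \<le> 2"
    define v where "v = of_real (- t) + \<i> * of_real y"
    have v: "Re v < 0" "- Re v = t" using t \<xi> by (auto simp: v_def)
    have "(\<psi> \<circ> (\<lambda>t. of_real (- t) + \<i> * of_real y) has_vector_derivative (- 1) * (H v / s)) (at t)"
      by (rule field_vector_diff_chain_at[where f = "\<lambda>t. of_real (- t) + \<i> * of_real y"])
         (use d\<psi>[OF v(1)] in \<open>auto intro!: derivative_eq_intros simp: v_def\<close>)
    then have dRe: "((\<lambda>t. Re (\<psi> (of_real (- t) + \<i> * of_real y))) has_real_derivative Re ((- 1) * (H v / s))) (at t)"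
      by (intro has_field_derivative_Re) (simp add: o_def)
    have dln: "((\<lambda>t. k * ln t + C0 * t) has_real_derivative k / t + C0) (at t)"
      using t \<xi> by (auto intro!: derivative_eq_intros simp: divide_simps)
    have "((\<lambda>t. Re (\<psi> (of_real (- t) + \<i> * of_real y)) + (k * ln t + C0 * t)) has_real_derivative Re ((- 1) * (H v / s)) + (k / t + C0)) (at t)"
      by (rule DERIV_add[OF dRe dln])
    moreover have "0 \<le> Re ((- 1) * (H v / s)) + (k / t + C0)"
      using abs_Re_le_cmod[of "H v / s"] H_estimate[OF v(1)] unfolding v(2) C0_def by simp
    ultimately show "\<exists>D. ((\<lambda>t. Re (\<psi> (of_real (- t) + \<i> * of_real y)) + k * ln t + C0 * t) has_real_derivative D) (at t) \<and> 0 \<le> D"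
      by (auto simp: add.assoc)
  qed
  have bnd: "cmod (deriv h v) \<le> cmod (deriv h (of_real (- 2) + \<i> * of_real (Im v))) * exp (k * ln 2 + C0 * 2) * (- Re v) powr - k"
    if v: "- 2 \<le> Re v" "Re v < 0" for v
  proof -
    define \<xi> where "\<xi> = - Re v"
    have \<xi>: "0 < \<xi>" "\<xi> \<le> 2" "v = of_real (- \<xi>) + \<i> * of_real (Im v)" using v by (auto simp: \<xi>_def complex_eq_iff)
    let ?w = "of_real (- 2) + \<i> * of_real (Im v)"
    have "Re (\<psi> v) \<le> Re (\<psi> ?w) + (k * ln 2 + C0 * 2) + - k * ln \<xi>"
      using mono[OF \<xi>(1,2), of "Im v"] mult_nonneg_nonneg[OF C0 less_imp_le[OF \<xi>(1)]]
      unfolding \<xi>(3)[symmetric] by linarith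
    then have "exp (Re (\<psi> v)) \<le> exp (Re (\<psi> ?w)) * exp (k * ln 2 + C0 * 2) * exp (- k * ln \<xi>)"
      by (simp flip: exp_add)
    moreover have "exp (- k * ln \<xi>) = \<xi> powr - k" using \<xi> by (simp add: powr_def)
    moreover have "cmod (deriv h v) = exp (Re (\<psi> v))" "cmod (deriv h ?w) = exp (Re (\<psi> ?w))"
      using \<psi>(2)[of v] \<psi>(2)[of ?w] v by (simp_all add: left_halfplane_def)
    ultimately show ?thesis by (simp add: \<xi>_def)
  qed
  have "compact ((\<lambda>y. deriv h (of_real (- 2) + \<i> * of_real y)) ` {- Y..Y})"
    by (intro compact_continuous_image continuous_on_compose2[OF holomorphic_on_imp_continuous_on[OF hold]] continuous_intros)
       (auto simp: left_halfplane_def)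
  then obtain M where M: "\<And>y. y \<in> {- Y..Y} \<Longrightarrow> cmod (deriv h (of_real (- 2) + \<i> * of_real y)) \<le> M"
    using compact_imp_bounded by (force simp: bounded_iff)
  show ?thesis
  proof (rule that[of "max 0 M * exp (k * ln 2 + C0 * 2)"])
    fix v assume v: "- 2 \<le> Re v" "Re v < 0" "\<bar>Im v\<bar> \<le> Y"
    have "cmod (deriv h v) \<le> cmod (deriv h (of_real (- 2) + \<i> * of_real (Im v))) * exp (k * ln 2 + C0 * 2) * (- Re v) powr - k"
      by (rule bnd) (use v in auto)
    also have "\<dots> \<le> max 0 M * exp (k * ln 2 + C0 * 2) * (- Re v) powr - k"
    proof (intro mult_right_mono)
      have "Im v \<in> {- Y..Y}" using v by auto
      then show "cmod (deriv h (of_real (- 2) + \<i> * of_real (Im v))) \<le> max 0 M"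
        using M by (intro max.coboundedI2)
    qed auto
    finally show "cmod (deriv h v) \<le> max 0 M * exp (k * ln 2 + C0 * 2) * (- Re v) powr - k" .
  qed auto
qed

lemma left_ext_h_cont: "continuous_on {v. - 1 \<le> Re v \<and> Re v \<le> 0 \<and> \<bar>Im v\<bar> \<le> Y} (left_ext h)"
proof -
  obtain C where C: "0 \<le> C"
    "\<And>v. - 2 \<le> Re v \<Longrightarrow> Re v < 0 \<Longrightarrow> \<bar>Im v\<bar> \<le> Y \<Longrightarrow> cmod (deriv h v) \<le> C * (- Re v) powr - k"
    by (rule deriv_h_bound[of Y]) blast
  show ?thesis by (rule left_limit_estimate(2)[OF k hol_h C(2)])
qed

lemma A_bound:
  obtains C where "0 \<le> C" "\<And>x. 0 \<le> x \<Longrightarrow> x \<le> 2 \<Longrightarrow> A x \<le> C * x"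
proof (rule that[of "2 / a * exp (4 / a)"])
  fix x :: real assume x: "0 \<le> x" "x \<le> 2"
  have "1 - 2 * x / a \<le> exp (- (2 * x / a))" using exp_ge_add_one_self[of "- (2 * x / a)"] by simp
  then have "(1 - 2 * x / a) * exp (2 * x / a) \<le> exp (- (2 * x / a)) * exp (2 * x / a)"
    by (intro mult_right_mono) auto
  then have "A x \<le> 2 * x / a * exp (2 * x / a)" unfolding A_def by (simp add: algebra_simps flip: exp_add)
  also have "\<dots> \<le> 2 * x / a * exp (4 / a)"
    using x a_pos by (intro mult_left_mono) (auto simp: divide_right_mono)
  finally show "A x \<le> 2 / a * exp (4 / a) * x" by (simp add: mult_ac)
qed (use a_pos in auto)

text \<open>The power 1 / s of the extension. It is linear in \<open>h\<close> and
  \<open>deriv h\<close>, so its boundary behaviour can be read off before anything is known about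
  zeros of \<open>h\<close> on the axis.\<close>

definition root_ext :: "real \<Rightarrow> complex \<Rightarrow> complex" where "root_ext e u = exp (log_ext e u / s)"

lemma root_ext_nz: "root_ext e u \<noteq> 0" by (simp add: root_ext_def)

lemma root_ext_eq:
  assumes "0 \<le> e" "e > 0 \<or> Re u \<noteq> 0"
  shows "root_ext e u = h (reflect e u) - s * of_real a / c * of_real (A (pos_part u)) * deriv h (reflect e u)"
proof -
  have "root_ext e u = h (reflect e u) * G (reflect e u) (pos_part u)"
    unfolding root_ext_def log_ext_eq[OF assms] h_def using s_nz G_nz_reflect[OF assms]
    by (simp add: add_divide_distrib exp_add)
  then show ?thesis
    using s_nz by (simp add: deriv_h[OF reflect_region(1)[OF assms]] G_def algebra_simps)
qed

text \<open>\<open>A\<close> vanishes to first order and the singularity of \<open>deriv h\<close>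
  has order \<open>k\<close>, so the added term is of order \<open>1 - k\<close>. The constant does
  not depend on \<open>e\<close>, which later allows \<open>e\<close> to be chosen last.\<close>

lemma root_ext_near:
  obtains C where "0 \<le> C"
    "\<And>e u. 0 \<le> e \<Longrightarrow> e > 0 \<or> Re u \<noteq> 0 \<Longrightarrow> \<bar>Im u\<bar> \<le> Y \<Longrightarrow> \<bar>Re u\<bar> + e \<le> 2 \<Longrightarrow>
      cmod (root_ext e u - left_ext h (\<i> * of_real (Im u))) \<le> C * (\<bar>Re u\<bar> + e) powr (1 - k)"
proof -
  obtain C where C: "0 \<le> C"
    "\<And>v. - 2 \<le> Re v \<Longrightarrow> Re v < 0 \<Longrightarrow> \<bar>Im v\<bar> \<le> Y \<Longrightarrow> cmod (deriv h v) \<le> C * (- Re v) powr - k"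
    by (rule deriv_h_bound[of Y]) blast
  obtain CA where CA: "0 \<le> CA" "\<And>x. 0 \<le> x \<Longrightarrow> x \<le> 2 \<Longrightarrow> A x \<le> CA * x" by (rule A_bound) blast
  define K where "K = cmod (s * of_real a / c)"
  show ?thesis
  proof (rule that[of "C / (1 - k) + K * CA * C"])
    show "0 \<le> C / (1 - k) + K * CA * C" using C(1) CA(1) k by (simp add: K_def)
    fix e u assume eu: "0 \<le> e" "e > 0 \<or> Re u \<noteq> 0" "\<bar>Im u\<bar> \<le> Y" "\<bar>Re u\<bar> + e \<le> 2"
    define v \<xi> where "v = reflect e u" and "\<xi> = \<bar>Re u\<bar> + e"
    have \<xi>: "0 < \<xi>" "\<xi> \<le> 2" "Re v = - \<xi>" "Im v = Im u" using eu by (auto simp: \<xi>_def v_def)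
    have pos_part: "0 \<le> pos_part u" "pos_part u \<le> \<xi>" using eu by (auto simp: pos_part_def \<xi>_def)
    have v: "v = \<i> * of_real (Im u) - of_real \<xi>" using \<xi> by (simp add: complex_eq_iff)
    have 1: "cmod (left_ext h (\<i> * of_real (Im u)) - left_ext h v) \<le> C / (1 - k) * \<xi> powr (1 - k)"
      unfolding v by (rule left_limit_estimate(1)[OF k hol_h C(2)]) (use \<xi> eu in auto)
    have "cmod (s * of_real a / c * of_real (A (pos_part u)) * deriv h v) \<le> K * (CA * \<xi>) * (C * \<xi> powr - k)"
    proof -
      have "A (pos_part u) \<le> CA * \<xi>" using CA(2)[OF pos_part(1)] pos_part \<xi> CA(1) by (meson mult_left_mono order.trans)
      moreover have "0 \<le> A (pos_part u)" by (rule A_nonneg[OF pos_part(1)])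
      moreover have "cmod (deriv h v) \<le> C * \<xi> powr - k" using C(2)[of v] \<xi> eu by simp
      ultimately show ?thesis unfolding norm_mult K_def norm_of_real abs_of_nonneg[OF \<open>0 \<le> A (pos_part u)\<close>]
        by (intro mult_mono) (auto simp: C CA \<xi> less_imp_le)
    qed
    also have "\<dots> = K * CA * C * \<xi> powr (1 - k)" using \<xi> by (simp add: powr_diff powr_minus field_simps)
    finally have 2: "cmod (s * of_real a / c * of_real (A (pos_part u)) * deriv h v) \<le> K * CA * C * \<xi> powr (1 - k)" .
    have "root_ext e u - left_ext h (\<i> * of_real (Im u)) =
        (left_ext h v - left_ext h (\<i> * of_real (Im u))) - s * of_real a / c * of_real (A (pos_part u)) * deriv h v"
      using root_ext_eq[OF eu(1,2)] \<xi> by (simp add: v_def)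
    then have "cmod (root_ext e u - left_ext h (\<i> * of_real (Im u))) \<le>
       cmod (left_ext h (\<i> * of_real (Im u)) - left_ext h v) + cmod (s * of_real a / c * of_real (A (pos_part u)) * deriv h v)"
      by (metis norm_minus_commute norm_triangle_ineq4)
    also have "\<dots> \<le> (C / (1 - k) + K * CA * C) * \<xi> powr (1 - k)"
      using 1 2 by (simp add: ring_distribs)
    finally show "cmod (root_ext e u - left_ext h (\<i> * of_real (Im u))) \<le> (C / (1 - k) + K * CA * C) * (\<bar>Re u\<bar> + e) powr (1 - k)"
      by (simp add: \<xi>_def)
  qed
qed

text \<open>The period leaves the extension unchanged but multiplies its root by
  \<open>exp (turn n / s)\<close>, which for \<open>n \<noteq> 0\<close> is unimodular only if
  \<open>s\<close> is real.\<close>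

lemma cmod_root_ext_shift:
  assumes "0 \<le> e" "e > 0 \<or> Re u \<noteq> 0"
  shows "cmod (root_ext e (u + turn n)) = exp (2 * pi * of_int n * Im s / (cmod s)\<^sup>2) * cmod (root_ext e u)"
proof -
  have "Re (turn n / s) = 2 * pi * of_int n * Im s / (cmod s)\<^sup>2"
    by (simp add: Re_divide cmod_power2)
  then show ?thesis
    unfolding root_ext_def log_ext_shift'[OF assms] add_divide_distrib by (simp add: exp_add norm_mult)
qed

section \<open>Boundary values of h do not vanish\<close>

lemma continuous_on_root_ext: "continuous_on \<Omega> (\<lambda>p. root_ext (fst p) (snd p))"
  unfolding root_ext_def using continuous_on_log_ext s_nz
  by (intro continuous_intros) (auto simp: case_prod_unfold)

lemma exists_boundary_h_nz:
  assumes "y1 < y2"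
  obtains y where "y1 < y" "y < y2" "left_ext h (\<i> * of_real y) \<noteq> 0"
proof -
  have "\<exists>y. y1 < y \<and> y < y2 \<and> left_ext h (\<i> * of_real y) \<noteq> 0"
  proof (rule ccontr)
    assume "\<not> ?thesis"
    then have "left_ext h (Complex 0 y) = 0" if "y1 < y" "y < y2" for y
      using that by (simp add: Complex_eq)
    from const_if_left_ext_const[OF hol_h left_ext_h_cont assms this, of "-1"] show False by (simp add: h_def)
  qed
  then show ?thesis using that by blast
qed

text \<open>If the boundary value of \<open>h\<close> vanished at \<open>\<i> y0\<close>, then for small \<open>e\<close> the connected set
  on which \<open>exp (log_ext e u / s)\<close> is small would reach from the far left into the half-strip \<open>U\<close>
  around \<open>\<i> y0\<close>; but that function is bounded away from 0 on the frontier of \<open>U\<close>.\<close>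

lemma boundary_h_nz: "left_ext h (\<i> * of_real y0) \<noteq> 0"
proof
  assume h0: "left_ext h (\<i> * of_real y0) = 0"
  \<comment> \<open>The half-strip is to extend in the direction in which translation by the period
    does not decrease the modulus of \<open>root_ext\<close>.\<close>
  define \<sigma> :: real where "\<sigma> = (if Im s \<ge> 0 then 1 else - 1)"
  have \<sigma>: "\<sigma> * \<sigma> = 1" "\<bar>\<sigma>\<bar> = 1" "\<sigma> * Im s \<ge> 0" by (auto simp: \<sigma>_def)
  obtain y1 where y1: "\<sigma> * (y0 - y1) > 0" "left_ext h (\<i> * of_real y1) \<noteq> 0"
  proof (cases "Im s \<ge> 0")
    case True
    then show ?thesis using exists_boundary_h_nz[of "y0 - 1" y0] that by (auto simp: \<sigma>_def)
  next
    case False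
    then show ?thesis using exists_boundary_h_nz[of y0 "y0 + 1"] that by (auto simp: \<sigma>_def)
  qed
  define Y where "Y = max \<bar>y0\<bar> \<bar>y1\<bar>"
  obtain C where C: "0 \<le> C"
    "\<And>e u. 0 \<le> e \<Longrightarrow> e > 0 \<or> Re u \<noteq> 0 \<Longrightarrow> \<bar>Im u\<bar> \<le> Y \<Longrightarrow> \<bar>Re u\<bar> + e \<le> 2 \<Longrightarrow>
      cmod (root_ext e u - left_ext h (\<i> * of_real (Im u))) \<le> C * (\<bar>Re u\<bar> + e) powr (1 - k)"
    by (rule root_ext_near[of Y]) blast
  have small: "\<exists>\<delta>>0. \<delta> \<le> 1 \<and> C * (2 * \<delta>) powr (1 - k) < r" if "r > 0" for r
  proof -
    have "((\<lambda>\<delta>. C * (2 * \<delta>) powr (1 - k)) \<longlongrightarrow> C * (2 * 0) powr (1 - k)) (at_right 0)"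
      by (intro tendsto_mult tendsto_const tendsto_powr' tendsto_ident_at)
         (use k in \<open>auto intro!: eventually_mono[OF eventually_at_right_less]\<close>)
    then have "\<forall>\<^sub>F \<delta> in at_right 0. C * (2 * \<delta>) powr (1 - k) < r"
      using that k by (intro order_tendstoD) auto
    moreover have "\<forall>\<^sub>F \<delta> in at_right 0. \<delta> \<in> {0<..<1::real}"
      by (rule eventually_at_right_real) simp
    ultimately have "\<forall>\<^sub>F \<delta> in at_right 0. C * (2 * \<delta>) powr (1 - k) < r \<and> (0::real) < \<delta> \<and> \<delta> \<le> 1"
      by eventually_elim auto
    then show ?thesis using eventually_happens' trivial_limit_at_right_real by blast
  qed
  obtain \<eta> where \<eta>: "\<eta> > 0" "\<eta> \<le> 1" "C * (2 * \<eta>) powr (1 - k) < cmod (left_ext h (\<i> * of_real y1)) / 2"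
    using small[of "cmod (left_ext h (\<i> * of_real y1)) / 2"] y1 by auto
  \<comment> \<open>One period of the two long sides, and the base of the half-strip without its
    part near the axis. The set keeps away from the axis, so compactness gives one lower bound for
    all \<open>e\<close> in \<open>[0, 1]\<close>.\<close>
  define S1 where "S1 = {u. \<bar>Re u\<bar> = 1 \<and> \<bar>Im u - y1\<bar> \<le> 2 * pi} \<union> {u. \<eta> \<le> \<bar>Re u\<bar> \<and> \<bar>Re u\<bar> \<le> 1 \<and> Im u = y1}"
  have "compact S1"
  proof -
    have "S1 = cbox (Complex (-1) (y1 - 2 * pi)) (Complex 1 (y1 + 2 * pi)) \<inter>
        ({u. \<bar>Re u\<bar> = 1} \<union> ({u. \<eta> \<le> \<bar>Re u\<bar>} \<inter> {u. Im u = y1}))"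
      using pi_gt_zero by (auto simp: S1_def in_cbox_complex_iff abs_le_iff abs_if split: if_splits)
    moreover have "closed ({u. \<bar>Re u\<bar> = 1} \<union> ({u. \<eta> \<le> \<bar>Re u\<bar>} \<inter> {u. Im u = y1}))"
      by (intro closed_Un closed_Int closed_Collect_eq closed_Collect_le continuous_intros)
    ultimately show ?thesis using compact_Int_closed[OF compact_cbox] by metis
  qed
  then have S1c: "compact ({0..1::real} \<times> S1)" by (intro compact_Times) auto
  have "{0..1::real} \<times> S1 \<subseteq> \<Omega>" using \<eta> by (auto simp: S1_def \<Omega>_def)
  then have S1cont: "continuous_on ({0..1::real} \<times> S1) (\<lambda>p. cmod (root_ext (fst p) (snd p)))"
    by (intro continuous_on_norm continuous_on_subset[OF continuous_on_root_ext])
  have S1n: "{0..1::real} \<times> S1 \<noteq> {}"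
  proof -
    have "Complex 1 y1 \<in> S1" by (simp add: S1_def)
    then show ?thesis by force
  qed
  obtain p0 where p0: "p0 \<in> {0..1::real} \<times> S1"
    "\<And>p. p \<in> {0..1::real} \<times> S1 \<Longrightarrow> cmod (root_ext (fst p0) (snd p0)) \<le> cmod (root_ext (fst p) (snd p))"
    using continuous_attains_inf[OF S1c S1n S1cont] by blast
  define c0 where "c0 = min (cmod (root_ext (fst p0) (snd p0))) (cmod (left_ext h (\<i> * of_real y1)) / 2)"
  have c0: "c0 > 0" using y1 root_ext_nz by (simp add: c0_def)
  obtain \<delta> where \<delta>: "\<delta> > 0" "\<delta> \<le> 1" "C * (2 * \<delta>) powr (1 - k) < c0" using small[OF c0] by blast
  define e where "e = min \<eta> \<delta>"
  have e: "0 < e" "e \<le> \<eta>" "e \<le> \<delta>" "e \<le> 1" using \<eta> \<delta> by (auto simp: e_def)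
  define U where "U = {u. \<bar>Re u\<bar> < 1 \<and> \<sigma> * (Im u - y1) > 0}"
  have S1low: "c0 \<le> cmod (root_ext e u)" if "u \<in> S1" for u
    using p0(2)[of "(e, u)"] that e by (auto simp: c0_def)
  have low: "c0 \<le> cmod (root_ext e u)" if "u \<in> frontier U" for u
  proof -
    have "open U" unfolding U_def by (intro open_Collect_conj open_Collect_less continuous_intros)
    then have nU: "u \<notin> U" using that by (simp add: frontier_def interior_open)
    have "closed {u. \<bar>Re u\<bar> \<le> 1 \<and> 0 \<le> \<sigma> * (Im u - y1)}"
      by (intro closed_Collect_conj closed_Collect_le continuous_intros)
    then have "closure U \<subseteq> {u. \<bar>Re u\<bar> \<le> 1 \<and> 0 \<le> \<sigma> * (Im u - y1)}"
      by (intro closure_minimal) (auto simp: U_def)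
    then have u: "\<bar>Re u\<bar> \<le> 1" "0 \<le> \<sigma> * (Im u - y1)" using that by (auto simp: frontier_def)
    show ?thesis
    proof (cases "Im u = y1")
      case True
      show ?thesis
      \<comment> \<open>Near the axis the base is controlled by the nonzero boundary value at
        \<open>y1\<close>.\<close>
      proof (cases "\<bar>Re u\<bar> < \<eta>")
        case True
        have "cmod (root_ext e u - left_ext h (\<i> * of_real y1)) \<le> C * (\<bar>Re u\<bar> + e) powr (1 - k)"
          using C(2)[of e u] e True \<eta> \<open>Im u = y1\<close> by (simp add: Y_def)
        also have "\<dots> \<le> C * (2 * \<eta>) powr (1 - k)"
          using C(1) True e k by (intro mult_left_mono powr_mono2) auto
        also have "\<dots> < cmod (left_ext h (\<i> * of_real y1)) / 2" by (rule \<eta>)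
        finally have "cmod (root_ext e u - left_ext h (\<i> * of_real y1)) < cmod (left_ext h (\<i> * of_real y1)) / 2" .
        then have "cmod (left_ext h (\<i> * of_real y1)) / 2 \<le> cmod (root_ext e u)"
          using norm_triangle_ineq2[of "left_ext h (\<i> * of_real y1)" "root_ext e u"] by (simp add: norm_minus_commute)
        then show ?thesis by (simp add: c0_def)
      qed (use S1low[of u] u \<open>Im u = y1\<close> in \<open>auto simp: S1_def\<close>)
    next
      case False
      have "\<sigma> * (Im u - y1) \<noteq> 0" using False \<sigma> by auto
      then have re1: "\<bar>Re u\<bar> = 1" using nU u by (auto simp: U_def)
      \<comment> \<open>The number of whole periods between the base and \<open>u\<close>; removing
        them leads into \<open>S1\<close> and does not increase the modulus of
        \<open>root_ext\<close>.\<close>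
      define m where "m = \<lfloor>\<sigma> * (Im u - y1) / (2 * pi)\<rfloor>"
      have p: "2 * pi > 0" by simp
      have m0: "m \<ge> 0" using u unfolding m_def by simp
      have "of_int m \<le> \<sigma> * (Im u - y1) / (2 * pi)" "\<sigma> * (Im u - y1) / (2 * pi) \<le> of_int m + 1"
        unfolding m_def by linarith+
      then have m: "0 \<le> \<sigma> * (Im u - y1) - 2 * pi * of_int m" "\<sigma> * (Im u - y1) - 2 * pi * of_int m \<le> 2 * pi"
        unfolding pos_le_divide_eq[OF p] pos_divide_le_eq[OF p] by (auto simp: algebra_simps)
      define n :: int where "n = (if Im s \<ge> 0 then m else - m)"
      have n: "of_int n = \<sigma> * of_int m" by (simp add: n_def \<sigma>_def)
      define w where "w = u - turn n"
      have "\<bar>Im w - y1\<bar> = \<bar>\<sigma> * (Im w - y1)\<bar>" using \<sigma> by (simp add: abs_mult)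
      also have "\<sigma> * (Im w - y1) = \<sigma> * (Im u - y1) - 2 * pi * of_int m"
        using \<sigma>(1) by (simp add: w_def n algebra_simps)
      finally have "\<bar>Im w - y1\<bar> \<le> 2 * pi" using m by simp
      then have "w \<in> S1" using re1 by (simp add: S1_def w_def)
      have uw: "u = w + turn n" by (simp add: w_def)
      have "cmod (root_ext e u) = exp (2 * pi * of_int n * Im s / (cmod s)\<^sup>2) * cmod (root_ext e w)"
        unfolding uw by (rule cmod_root_ext_shift) (use e in auto)
      moreover have "1 \<le> exp (2 * pi * of_int n * Im s / (cmod s)\<^sup>2)"
      proof -
        have "0 \<le> of_int m * (\<sigma> * Im s)" using m0 by (intro mult_nonneg_nonneg[OF _ \<sigma>(3)]) simp
        then have "0 \<le> of_int n * Im s" by (simp only: n mult_ac)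
        then show ?thesis by (simp add: mult.assoc)
      qed
      ultimately have "1 * cmod (root_ext e w) \<le> cmod (root_ext e u)" using mult_right_mono[OF _ norm_ge_zero] by metis
      then show ?thesis using S1low[OF \<open>w \<in> S1\<close>] by simp
    qed
  qed
  define P where "P = {u. cmod (root_ext e u) < c0}"
  have "connected P"
  proof -
    have b: "bij (log_ext e)" by (rule log_ext_bij[OF e(1)])
    have hm: "homeomorphism UNIV UNIV (log_ext e) (inv_into UNIV (log_ext e))"
      by (rule homeomorphism_if_bij[OF log_ext_slice[OF e(1)] b])
    \<comment> \<open>Smallness of the root means that \<open>log_ext e\<close> lies in this
      half-plane, so \<open>P\<close> is connected as its preimage under a homeomorphism.\<close>
    define T where "T = {w. Re (w / s) < ln c0}"
    have "Re (w / s) = inner (cnj z) w" if "z = 1 / s" for w z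
    proof -
      have "Re (w * z) = inner (cnj z) w" by (simp add: inner_complex_def algebra_simps)
      then show ?thesis using that by simp
    qed
    then have "T = {w. inner (cnj (1 / s)) w < ln c0}" by (auto simp: T_def)
    then have "connected T" by (simp add: convex_connected convex_halfspace_lt)
    have PT: "cmod (root_ext e u) < c0 \<longleftrightarrow> log_ext e u \<in> T" for u
    proof -
      have "exp x < c0 \<longleftrightarrow> x < ln c0" for x using c0 by (metis exp_less_cancel_iff exp_ln)
      then show ?thesis by (simp add: root_ext_def T_def)
    qed
    have "P = inv_into UNIV (log_ext e) ` T"
    proof (intro Set.set_eqI iffI)
      fix u assume "u \<in> P"
      then have "log_ext e u \<in> T" by (simp add: P_def PT)
      moreover have "u = inv_into UNIV (log_ext e) (log_ext e u)" using b by (simp add: bij_def inv_into_f_f)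
      ultimately show "u \<in> inv_into UNIV (log_ext e) ` T" by blast
    next
      fix u assume "u \<in> inv_into UNIV (log_ext e) ` T"
      then obtain w where w: "w \<in> T" "u = inv_into UNIV (log_ext e) w" by blast
      have "log_ext e u = w" unfolding w(2) using b by (intro f_inv_into_f) (simp add: bij_def)
      then show "u \<in> P" using w(1) \<open>\<And>u. cmod (root_ext e u) < c0 \<longleftrightarrow> log_ext e u \<in> T\<close> by (simp add: P_def)
    qed
    then show ?thesis
      using \<open>connected T\<close> hm by (auto simp: homeomorphism_def intro!: connected_continuous_image intro: continuous_on_subset)
  qed
  moreover have "\<i> * of_real y0 \<in> P \<inter> U"
  proof
    have "cmod (root_ext e (\<i> * of_real y0) - left_ext h (\<i> * of_real (Im (\<i> * of_real y0)))) \<le> C * (\<bar>Re (\<i> * of_real y0)\<bar> + e) powr (1 - k)"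
      by (rule C(2)) (use e in \<open>auto simp: Y_def\<close>)
    then have "cmod (root_ext e (\<i> * of_real y0)) \<le> C * e powr (1 - k)" using h0 by simp
    also have "\<dots> \<le> C * (2 * \<delta>) powr (1 - k)" using e k C(1) by (intro mult_left_mono powr_mono2) auto
    also have "\<dots> < c0" by (rule \<delta>)
    finally show "\<i> * of_real y0 \<in> P" by (simp add: P_def)
    show "\<i> * of_real y0 \<in> U" using y1 by (simp add: U_def)
  qed
  moreover have "P - U \<noteq> {}"
  proof -
    obtain L where L: "L < 0" "\<And>v. Re v < L \<Longrightarrow> cmod (\<phi> v - v) < 1" using asym[of 1] by auto
    \<comment> \<open>Since \<open>Re (1 / s) = a / (cmod s)\<^sup>2\<close> is positive, the root
      tends to 0 on the far left, outside \<open>U\<close>.\<close>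
    define t where "t = max (1 - L) ((\<bar>ln c0\<bar> + 1 / cmod s + 1) * (cmod s)\<^sup>2 / a)"
    have t: "t \<ge> 1 - L" "(\<bar>ln c0\<bar> + 1 / cmod s + 1) * (cmod s)\<^sup>2 / a \<le> t" "t > 0" using L by (auto simp: t_def)
    have "cmod (root_ext e (- of_real t)) = exp (Re (\<phi> (- of_real t - of_real e) / s))"
      using t L e by (simp add: root_ext_def log_ext_left)
    also have "\<dots> < exp (ln c0)"
    proof -
      define v where "v = - complex_of_real t - of_real e"
      have v: "Re v < L" using t e by (simp add: v_def)
      have "Re (\<phi> v / s) = Re ((\<phi> v - v) / s) + Re (v / s)" by (simp add: diff_divide_distrib)
      moreover have "Re ((\<phi> v - v) / s) \<le> 1 / cmod s"
      proof -
        have "Re ((\<phi> v - v) / s) \<le> cmod ((\<phi> v - v) / s)" by (rule complex_Re_le_cmod)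
        also have "\<dots> \<le> 1 / cmod s" unfolding norm_divide using L(2)[OF v] by (intro divide_right_mono) auto
        finally show ?thesis .
      qed
      moreover have "Re (v / s) \<le> - (\<bar>ln c0\<bar> + 1 / cmod s + 1)"
      proof -
        have "Re (v / s) = - (t + e) * (a / (cmod s)\<^sup>2)" by (simp add: v_def Re_divide cmod_power2)
        also have "\<dots> \<le> - t * (a / (cmod s)\<^sup>2)" using e a_pos by (intro mult_right_mono) auto
        also have "\<dots> \<le> - (\<bar>ln c0\<bar> + 1 / cmod s + 1)"
        proof -
          have "x * m / a * (a / m) = x" if "m > 0" for x m using that a_pos by simp
          from this[of "(cmod s)\<^sup>2" "\<bar>ln c0\<bar> + 1 / cmod s + 1"]
          show ?thesis using mult_right_mono[OF t(2), of "a / (cmod s)\<^sup>2"] a_pos cmod_s_pos by simp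
        qed
        finally show ?thesis .
      qed
      ultimately show ?thesis unfolding v_def[symmetric] by simp
    qed
    finally have "- of_real t \<in> P" using c0 by (simp add: P_def)
    moreover have "- of_real t \<notin> U" using t L by (simp add: U_def)
    ultimately show ?thesis by blast
  qed
  ultimately have "P \<inter> frontier U \<noteq> {}" using connected_Int_frontier by blast
  then show False using low by (force simp: P_def)
qed

text \<open>\<open>\<gamma> = s * deriv h / h\<close>, and \<open>cmod h\<close> has a positive
  minimum on the closed rectangle because its boundary values do not vanish.\<close>

lemma \<gamma>_bound_strip:
  obtains C where "0 \<le> C"
    "\<And>v. - 2 \<le> Re v \<Longrightarrow> Re v < 0 \<Longrightarrow> \<bar>Im v\<bar> \<le> Y \<Longrightarrow> cmod (\<gamma> v) \<le> C * (- Re v) powr - k"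
proof -
  obtain C where C: "0 \<le> C"
    "\<And>v. - 2 \<le> Re v \<Longrightarrow> Re v < 0 \<Longrightarrow> \<bar>Im v\<bar> \<le> Y \<Longrightarrow> cmod (deriv h v) \<le> C * (- Re v) powr - k"
    by (rule deriv_h_bound[of Y]) blast
  define S where "S = cbox (Complex (-2) (- \<bar>Y\<bar>)) (Complex 0 \<bar>Y\<bar>)"
  have S: "v \<in> S \<longleftrightarrow> - 2 \<le> Re v \<and> Re v \<le> 0 \<and> \<bar>Im v\<bar> \<le> \<bar>Y\<bar>" for v
    by (auto simp: S_def in_cbox_complex_iff)
  have nz: "left_ext h v \<noteq> 0" if "v \<in> S" for v
  proof (cases "Re v < 0")
    case False
    then have "v = \<i> * of_real (Im v)" using that by (simp add: S complex_eq_iff)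
    then show ?thesis using boundary_h_nz by metis
  qed (simp add: h_def)
  have cont: "continuous_on S (\<lambda>v. cmod (left_ext h v))"
    by (intro continuous_on_norm continuous_on_subset[OF continuous_on_left_ext[OF hol_h left_ext_h_cont]]) (auto simp: S)
  have "compact S" unfolding S_def by (rule compact_cbox)
  moreover have "S \<noteq> {}" using S[of 0] by auto
  ultimately obtain v0 where v0: "v0 \<in> S" "\<And>v. v \<in> S \<Longrightarrow> cmod (left_ext h v0) \<le> cmod (left_ext h v)"
    using continuous_attains_inf[OF _ _ cont] by blast
  define m where "m = cmod (left_ext h v0)"
  have m: "m > 0" using nz[OF v0(1)] by (simp add: m_def)
  show ?thesis
  proof (rule that[of "cmod s * C / m"])
    fix v assume v: "- 2 \<le> Re v" "Re v < 0" "\<bar>Im v\<bar> \<le> Y"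
    have hm: "m \<le> cmod (h v)" using v0(2)[of v] v by (simp add: S m_def)
    have "cmod (h v) * cmod (\<gamma> v) = cmod s * cmod (deriv h v)"
      using s_nz by (simp add: deriv_h[OF v(2)] norm_mult norm_divide)
    then have "m * cmod (\<gamma> v) \<le> cmod s * cmod (deriv h v)"
      using hm by (metis mult_right_mono norm_ge_zero)
    also have "\<dots> \<le> cmod s * (C * (- Re v) powr - k)" using C(2)[OF v] by (intro mult_left_mono) auto
    finally show "cmod (\<gamma> v) \<le> cmod s * C / m * (- Re v) powr - k" using m by (simp add: field_simps)
  qed (use m C in auto)
qed

text \<open>On the far left \<open>\<gamma>\<close> is close to 1, near the axis the strip bound for
  one period applies, and the region between is compact modulo the period.\<close>

lemma \<gamma>_bound:
  obtains C where "0 \<le> C" "\<And>v. Re v < 0 \<Longrightarrow> cmod (\<gamma> v) \<le> C * (1 + (- Re v) powr - k)"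
proof -
  obtain C1 where C1: "0 \<le> C1"
    "\<And>v. - 2 \<le> Re v \<Longrightarrow> Re v < 0 \<Longrightarrow> \<bar>Im v\<bar> \<le> 2 * pi \<Longrightarrow> cmod (\<gamma> v) \<le> C1 * (- Re v) powr - k"
    by (rule \<gamma>_bound_strip[of "2 * pi"]) blast
  obtain L where L: "L < 0" "\<And>v. Re v < L \<Longrightarrow> cmod (\<gamma> v - 1) < 1" using asym[of 1] by (auto simp: \<gamma>_def)
  define S where "S = cbox (Complex L 0) (Complex (-1) (2 * pi))"
  have "compact (\<gamma> ` S)"
    by (intro compact_continuous_image holomorphic_on_imp_continuous_on holomorphic_on_subset[OF hol_\<gamma>])
       (auto simp: S_def in_cbox_complex_iff left_halfplane_def)
  then obtain C2 where C2: "\<And>v. v \<in> S \<Longrightarrow> cmod (\<gamma> v) \<le> C2"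
    using compact_imp_bounded by (force simp: bounded_iff)
  define C where "C = max C1 (max C2 2)"
  show ?thesis
  proof (rule that[of C])
    fix v assume v: "Re v < 0"
    have 1: "C * 1 \<le> C * (1 + (- Re v) powr - k)" by (intro mult_left_mono) (auto simp: C_def)
    obtain n :: int where n: "0 \<le> Im (v + turn n)" "Im (v + turn n) \<le> 2 * pi"
      using shift_to_strip by blast
    define w where "w = v + turn n"
    have w: "\<gamma> w = \<gamma> v" "Re w = Re v" "0 \<le> Im w" "Im w \<le> 2 * pi" using n \<gamma>_per_int[OF v] by (auto simp: w_def)
    consider "Re v < L" | "L \<le> Re v" "Re v \<le> - 1" | "- 1 < Re v" by linarith
    then show "cmod (\<gamma> v) \<le> C * (1 + (- Re v) powr - k)"
    proof cases
      case 1
      then have "cmod (\<gamma> v) \<le> 2" using L(2)[of v] norm_triangle_ineq2[of "\<gamma> v" 1] by simp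
      then show ?thesis using \<open>C * 1 \<le> _\<close> by (simp add: C_def)
    next
      case 2
      then have "cmod (\<gamma> w) \<le> C2" using w by (intro C2) (auto simp: S_def in_cbox_complex_iff)
      then show ?thesis using \<open>C * 1 \<le> _\<close> w by (simp add: C_def)
    next
      case 3
      then have "cmod (\<gamma> w) \<le> C1 * (- Re v) powr - k" using C1(2)[of w] w v by auto
      also have "\<dots> \<le> C * (1 + (- Re v) powr - k)" using C1(1) by (intro mult_mono) (auto simp: C_def)
      finally show ?thesis using w by simp
    qed
  qed (simp add: C_def)
qed

section \<open>The limit map: continuity, injectivity, derivative bound\<close>

lemma left_ext_\<phi>_cont: "continuous_on {v. - 1 \<le> Re v \<and> Re v \<le> 0 \<and> \<bar>Im v\<bar> \<le> Y} (left_ext \<phi>)"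
proof -
  obtain C where C: "0 \<le> C"
    "\<And>v. - 2 \<le> Re v \<Longrightarrow> Re v < 0 \<Longrightarrow> \<bar>Im v\<bar> \<le> Y \<Longrightarrow> cmod (\<gamma> v) \<le> C * (- Re v) powr - k"
    by (rule \<gamma>_bound_strip[of Y]) blast
  show ?thesis by (rule left_limit_estimate(2)[OF k hol C(2)[unfolded \<gamma>_def]])
qed

abbreviation "E01 \<equiv> {0..1::real} \<times> (UNIV :: complex set)"

text \<open>Only the axis at \<open>e = 0\<close> is new. There the first-order zero of
  \<open>A\<close> beats the singularity of \<open>\<gamma>\<close>, leaving a bound of order
  \<open>1 - k\<close> for the distance of \<open>G\<close> from 1.\<close>

lemma continuous_on_G_closed: "continuous_on E01 (\<lambda>p. G (reflect (fst p) (snd p)) (pos_part (snd p)))"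
  unfolding continuous_on_eq_continuous_within
proof
  fix p :: "real \<times> complex" assume p: "p \<in> E01"
  obtain e0 u0 where eu: "p = (e0, u0)" by (cases p)
  let ?g = "\<lambda>p. G (reflect (fst p) (snd p)) (pos_part (snd p))"
  show "continuous (at p within E01) ?g"
  proof (cases "e0 > 0 \<or> Re u0 \<noteq> 0")
    case True
    define N where "N = {p :: real \<times> complex. 0 < fst p} \<union> {p. 0 < \<bar>Re (snd p)\<bar>}"
    have "open N" unfolding N_def by (intro open_Un open_Collect_less continuous_intros)
    have "continuous (at p within \<Omega>) ?g"
      using continuous_on_G p True by (auto simp: continuous_on_eq_continuous_within \<Omega>_def eu)
    then have "continuous (at p within (\<Omega> \<inter> E01)) ?g" by (rule continuous_within_subset) auto
    moreover have "at p within E01 = at p within (\<Omega> \<inter> E01)"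
      by (rule at_within_nhd[OF _ \<open>open N\<close>]) (use True p in \<open>auto simp: N_def \<Omega>_def eu\<close>)
    ultimately show ?thesis by simp
  next
    case False
    then have e0: "e0 = 0" "Re u0 = 0" using p eu by auto
    define Y where "Y = \<bar>Im u0\<bar> + 1"
    obtain C where C: "0 \<le> C"
      "\<And>v. - 2 \<le> Re v \<Longrightarrow> Re v < 0 \<Longrightarrow> \<bar>Im v\<bar> \<le> Y \<Longrightarrow> cmod (\<gamma> v) \<le> C * (- Re v) powr - k"
      by (rule \<gamma>_bound_strip[of Y]) blast
    obtain CA where CA: "0 \<le> CA" "\<And>x. 0 \<le> x \<Longrightarrow> x \<le> 2 \<Longrightarrow> A x \<le> CA * x" by (rule A_bound) blast
    define K where "K = cmod (of_real a / c)"
    define B where "B q = K * CA * C * (\<bar>Re (snd q)\<bar> + \<bar>fst q\<bar>) powr (1 - k)" for q :: "real \<times> complex"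
    define N where "N = {q :: real \<times> complex. \<bar>Im (snd q)\<bar> < Y} \<inter> {q. \<bar>Re (snd q)\<bar> + fst q < 2}"
    have "open N" unfolding N_def by (intro open_Int open_Collect_less continuous_intros)
    moreover have "p \<in> N" using e0 eu by (simp add: N_def Y_def)
    ultimately have evN: "\<forall>\<^sub>F q in at p within E01. q \<in> N"
      by (simp add: eventually_at_topological) blast
    have "((\<lambda>q. ?g q - 1) \<longlongrightarrow> 0) (at p within E01)"
    proof (rule Lim_null_comparison[where g = B])
      have "\<forall>\<^sub>F q in at p within E01. q \<in> E01" by (auto simp: eventually_at_filter)
      with evN show "\<forall>\<^sub>F q in at p within E01. norm (?g q - 1) \<le> B q"
      proof eventually_elim
        case (elim q)
        obtain e u where q: "q = (e, u)" by (cases q)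
        have e: "0 \<le> e" "\<bar>Im u\<bar> \<le> Y" "\<bar>Re u\<bar> + e \<le> 2" using elim by (auto simp: q N_def)
        show ?case
        proof (cases "e > 0 \<or> Re u \<noteq> 0")
          case False
          then have "pos_part u = 0" by (auto simp: pos_part_def)
          then show ?thesis using C(1) CA(1) by (simp add: q B_def K_def)
        next
          case True
          define \<xi> where "\<xi> = \<bar>Re u\<bar> + e"
          have \<xi>: "0 < \<xi>" "\<xi> \<le> 2" using True e by (auto simp: \<xi>_def)
          have pos_part: "0 \<le> pos_part u" "pos_part u \<le> \<xi>" using e by (auto simp: pos_part_def \<xi>_def)
          have "A (pos_part u) \<le> CA * \<xi>" using CA(2)[OF pos_part(1)] pos_part \<xi> CA(1) by (meson mult_left_mono order.trans)
          moreover have A0: "0 \<le> A (pos_part u)" by (rule A_nonneg[OF pos_part(1)])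
          moreover have "cmod (\<gamma> (reflect e u)) \<le> C * \<xi> powr - k" using C(2)[of "reflect e u"] \<xi> e by (simp add: \<xi>_def add.commute)
          ultimately have "K * A (pos_part u) * cmod (\<gamma> (reflect e u)) \<le> K * (CA * \<xi>) * (C * \<xi> powr - k)"
            by (intro mult_mono) (auto simp: C CA \<xi> less_imp_le K_def)
          also have "\<dots> = K * CA * C * \<xi> powr (1 - k)" using \<xi> by (simp add: powr_diff powr_minus field_simps)
          finally have "K * A (pos_part u) * cmod (\<gamma> (reflect e u)) \<le> B q" using e by (simp add: q B_def \<xi>_def)
          moreover have "?g q - 1 = - (of_real a / c * of_real (A (pos_part u)) * \<gamma> (reflect e u))" by (simp add: q G_def)
          then have "norm (?g q - 1) = K * A (pos_part u) * cmod (\<gamma> (reflect e u))"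
            using A0 by (simp only: norm_minus_cancel norm_mult K_def norm_of_real abs_of_nonneg)
          ultimately show ?thesis by simp
        qed
      qed
      have "continuous_on UNIV B"
        unfolding B_def by (intro continuous_intros continuous_on_powr') (use k in auto)
      then have "(B \<longlongrightarrow> B p) (at p within E01)"
        using continuous_on_subset[of UNIV B E01] p unfolding continuous_on_def by blast
      moreover have "B p = 0" using e0 eu by (simp add: B_def)
      ultimately show "(B \<longlongrightarrow> 0) (at p within E01)" by simp
    qed
    then have "(?g \<longlongrightarrow> 1) (at p within E01)" by (simp add: LIM_zero_iff)
    moreover have "?g p = 1" using e0 eu by (simp add: pos_part_def)
    ultimately show ?thesis by (simp add: continuous_within)
  qed
qed

lemma G_slit_closed:
  assumes "0 \<le> e" shows "G (reflect e u) (pos_part u) \<notin> \<real>\<^sub>\<le>\<^sub>0"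
proof (cases "e > 0 \<or> Re u \<noteq> 0")
  case False
  then have "pos_part u = 0" by (auto simp: pos_part_def)
  then show ?thesis by simp
qed (use G_slit_reflect assms in blast)

lemma continuous_on_log_ext_closed: "continuous_on E01 (\<lambda>(e, u). log_ext e u)"
proof -
  have "continuous_on E01 (\<lambda>p. left_ext \<phi> (reflect (fst p) (snd p)))"
    by (rule continuous_on_compose2[OF continuous_on_left_ext[OF hol left_ext_\<phi>_cont] continuous_on_reflect]) auto
  then have "continuous_on E01 (\<lambda>p. log_ext (fst p) (snd p))"
    unfolding log_ext_def
    by (intro continuous_intros continuous_on_Ln continuous_on_G_closed) (use G_slit_closed in auto)
  then show ?thesis by (simp add: case_prod_unfold)
qed

lemma log_ext_0_cont: "continuous_on UNIV (log_ext 0)"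
  by (rule continuous_on_slice[OF continuous_on_log_ext_closed]) auto

lemma log_ext_0_inj: "inj (log_ext 0)"
proof (rule injI, rule ccontr)
  fix p q assume pq: "log_ext 0 p = log_ext 0 q" "p \<noteq> q"
  define F where "F = {u. log_ext 0 u = log_ext 0 q}"
  have F: "p \<in> F" "q \<in> F" using pq by (auto simp: F_def)
  have "bounded F"
    by (rule bounded_subset[OF log_ext_proper[OF order_refl log_ext_0_cont, of "cmod (log_ext 0 q)"]]) (auto simp: F_def)
  then have conF: "connected F"
    unfolding F_def by (intro connected_fibre_limit_homeo[OF continuous_on_log_ext_closed log_ext_bij]) auto
  \<comment> \<open>Off the axis local injectivity makes every point of the fibre isolated, which is
    impossible in a connected set with two points.\<close>
  have re0: "Re z = 0" if z: "z \<in> F" for z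
  proof (rule ccontr)
    assume "Re z \<noteq> 0"
    then obtain d where d: "d > 0" "inj_on (log_ext 0) (ball z d)" using log_ext_locally_injective[of 0 z] by auto
    have "F \<inter> ball z d \<subseteq> {z}"
    proof
      fix w assume w: "w \<in> F \<inter> ball z d"
      have "w = z" by (rule inj_onD[OF d(2)]) (use w z d(1) in \<open>auto simp: F_def\<close>)
      then show "w \<in> {z}" by simp
    qed
    obtain w where w: "w \<in> F" "w \<noteq> z" using F pq(2) by metis
    have "z \<in> ball z d \<inter> F" using d z by simp
    then have "F \<subseteq> ball z d \<union> - {z}" "ball z d \<inter> (- {z}) \<inter> F = {}" "ball z d \<inter> F \<noteq> {}" "- {z} \<inter> F \<noteq> {}"
      using \<open>F \<inter> ball z d \<subseteq> {z}\<close> w by blast+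
    then show False using connectedD[OF conF, of "ball z d" "- {z}"] by (simp add: open_Compl)
  qed
  define y1 y2 where "y1 = min (Im p) (Im q)" and "y2 = max (Im p) (Im q)"
  have "Im p \<noteq> Im q" using re0[OF F(1)] re0[OF F(2)] pq(2) by (auto simp: complex_eq_iff)
  then have y: "y1 < y2" by (auto simp: y1_def y2_def)
  have con: "connected (Im ` F)" by (intro connected_continuous_image conF continuous_intros)
  have "left_ext \<phi> (Complex 0 y) = log_ext 0 q" if "y1 < y" "y < y2" for y
  proof -
    have "y1 \<in> Im ` F" "y2 \<in> Im ` F" using F by (auto simp: y1_def y2_def min_def max_def)
    then have "y \<in> Im ` F" using con that by (meson connectedD_interval less_imp_le)
    then obtain z where "z \<in> F" "Im z = y" by blast
    then have "Complex 0 y \<in> F" using re0[OF \<open>z \<in> F\<close>] by (metis complex_surj)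
    then show ?thesis by (simp add: F_def log_ext_left)
  qed
  \<comment> \<open>A constant boundary value on an interval forces \<open>\<phi>\<close> to be
    constant, against the nonvanishing of its derivative.\<close>
  from const_if_left_ext_const[OF hol left_ext_\<phi>_cont y this]
  have const: "\<phi> v = log_ext 0 q" if "Re v < 0" for v using that by blast
  have "(\<phi> has_field_derivative 0) (at (-1))"
    by (rule has_field_derivative_transform_within_open[OF DERIV_const[of "log_ext 0 q"] open_left_halfplane])
       (auto simp: left_halfplane_def const)
  then have "\<gamma> (-1) = 0" unfolding \<gamma>_def by (rule DERIV_imp_deriv)
  then show False using \<gamma>_nz[of "-1"] by simp
qed

lemma log_ext_0_surj: "surj (log_ext 0)"
proof -
  have "bij (log_ext 0)"
  proof (rule bij_if_proper_local_homeo[OF log_ext_0_cont])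
    fix u show "\<exists>d>0. inj_on (log_ext 0) (ball u d)"
      using inj_on_subset[OF log_ext_0_inj] by (intro exI[of _ 1]) auto
    show "bounded {u. cmod (log_ext 0 u) \<le> B}" for B by (rule log_ext_proper[OF order_refl log_ext_0_cont])
    show "p = q" if "log_ext 0 p = 0" "log_ext 0 q = 0" for p q using that injD[OF log_ext_0_inj] by simp
  qed
  then show ?thesis by (simp add: bij_def)
qed

lemma log_ext_0_shift: "log_ext 0 (u + turn n) = log_ext 0 u + turn n"
  by (rule log_ext_shift[OF order_refl log_ext_0_cont])

text \<open>Apart from \<open>\<gamma>\<close>, the numerator of \<open>log_ext_D\<close> is
  expressed by \<open>W\<close> through \<open>W_eq\<close>, and
  \<open>cmod W \<le> 2 * cmod s\<close>; the denominator is bounded below on a compact period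
  rectangle. The bound \<open>X\<close> on \<open>Re u\<close> keeps that rectangle and the
  exponential in \<open>W_eq\<close> bounded.\<close>

lemma log_ext_D_bound:
  obtains C where "0 \<le> C" "\<And>u. Re u \<noteq> 0 \<Longrightarrow> Re u \<le> X \<Longrightarrow> cmod (log_ext_D 0 u) \<le> C * (1 + \<bar>Re u\<bar> powr - k)"
proof -
  obtain C1 where C1: "0 \<le> C1" "\<And>v. Re v < 0 \<Longrightarrow> cmod (\<gamma> v) \<le> C1 * (1 + (- Re v) powr - k)"
    by (rule \<gamma>_bound) blast
  define S where "S = cbox (Complex 0 0) (Complex \<bar>X\<bar> (2 * pi))"
  have cG: "continuous_on UNIV (\<lambda>u. G (reflect 0 u) (pos_part u))"
    using continuous_on_compose2[OF continuous_on_G_closed continuous_on_Pair[OF continuous_on_const continuous_on_id], of 0 UNIV]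
    by (simp add: image_subset_iff)
  have "compact S" unfolding S_def by (rule compact_cbox)
  moreover have "S \<noteq> {}"
  proof -
    have "0 \<in> S" by (simp add: S_def in_cbox_complex_iff)
    then show ?thesis by blast
  qed
  moreover have "continuous_on S (\<lambda>u. cmod (G (reflect 0 u) (pos_part u)))"
    by (intro continuous_on_norm continuous_on_subset[OF cG]) auto
  ultimately obtain u0 where u0: "\<And>u. u \<in> S \<Longrightarrow> cmod (G (reflect 0 u0) (pos_part u0)) \<le> cmod (G (reflect 0 u) (pos_part u))"
    using continuous_attains_inf[of S "\<lambda>u. cmod (G (reflect 0 u) (pos_part u))"] by blast
  define m where "m = cmod (G (reflect 0 u0) (pos_part u0))"
  have m: "m > 0" using G_slit_closed[of 0 u0] by (auto simp: m_def)
  define CQ where "CQ = 2 * cmod s * exp (2 * \<bar>X\<bar> / a) / cmod c"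
  have CQ: "CQ \<ge> 0" by (simp add: CQ_def)
  define C where "C = max C1 (C1 * CQ / m)"
  show ?thesis
  proof (rule that[of C])
    show "0 \<le> C" using C1 by (simp add: C_def)
    fix u assume u: "Re u \<noteq> 0" "Re u \<le> X"
    define v where "v = reflect 0 u"
    have v: "Re v < 0" "- Re v = \<bar>Re u\<bar>" using u by (auto simp: v_def)
    have C1': "cmod (\<gamma> v) \<le> C1 * (1 + \<bar>Re u\<bar> powr - k)" using C1(2)[OF v(1)] v(2) by simp
    show "cmod (log_ext_D 0 u) \<le> C * (1 + \<bar>Re u\<bar> powr - k)"
    proof (cases "Re u < 0")
      case True
      then have "log_ext_D 0 u = \<gamma> v" by (simp add: log_ext_D_left v_def reflect_left)
      also have "cmod \<dots> \<le> C1 * (1 + \<bar>Re u\<bar> powr - k)" by (rule C1')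
      also have "\<dots> \<le> C * (1 + \<bar>Re u\<bar> powr - k)" by (intro mult_right_mono) (auto simp: C_def)
      finally show ?thesis .
    next
      case False
      then have x: "0 < Re u" using u by simp
      define Q where "Q = 1 - of_real a / c * of_real (A (pos_part u)) * H v"
      have reg: "Re v < 0" "0 \<le> pos_part u" "pos_part u \<le> - Re v" using reflect_region[of 0 u] u by (auto simp: v_def)
      have "cmod (W v (pos_part u)) \<le> cmod (W v (pos_part u) + s) + cmod s"
        using norm_triangle_ineq4[of "W v (pos_part u) + s" s] by simp
      also have "\<dots> \<le> k * cmod s + cmod s" using W_bound[OF reg] by simp
      also have "\<dots> \<le> 2 * cmod s" using mult_right_mono[of k 1 "cmod s"] k by simp
      finally have W2: "cmod (W v (pos_part u)) \<le> 2 * cmod s" .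
      have "cmod (W v (pos_part u)) = cmod c * exp (- 2 * pos_part u / a) * cmod Q"
        unfolding W_eq Q_def by (simp add: norm_mult)
      then have "cmod Q = cmod (W v (pos_part u)) * exp (2 * pos_part u / a) / cmod c"
        using c_nz by (simp add: exp_minus field_simps)
      also have "\<dots> \<le> 2 * cmod s * exp (2 * \<bar>X\<bar> / a) / cmod c"
      proof -
        have "pos_part u \<le> \<bar>X\<bar>" using u x by (simp add: pos_part_def)
        then have "exp (2 * pos_part u / a) \<le> exp (2 * \<bar>X\<bar> / a)" using a_pos by (simp add: divide_right_mono)
        then show ?thesis using W2 by (intro divide_right_mono mult_mono) auto
      qed
      finally have Qb: "cmod Q \<le> CQ" by (simp add: CQ_def)
      have Gb: "m \<le> cmod (G v (pos_part u))"
      proof -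
        obtain n :: int where n: "0 \<le> Im (u + turn n)" "Im (u + turn n) \<le> 2 * pi"
          using shift_to_strip by blast
        define w where "w = u + turn n"
        have "w \<in> S" using n u x by (auto simp: S_def in_cbox_complex_iff w_def)
        moreover have "G (reflect 0 w) (pos_part w) = G v (pos_part u)"
          using v(1) by (simp add: w_def reflect_shift pos_part_shift G_def v_def \<gamma>_per_int)
        ultimately show ?thesis using u0[of w] by (simp add: m_def)
      qed
      have "cmod (log_ext_D 0 u) = cmod (\<gamma> v) * cmod Q / cmod (G v (pos_part u))"
        by (simp add: log_ext_D_def v_def Q_def norm_mult norm_divide)
      also have "\<dots> \<le> (C1 * (1 + \<bar>Re u\<bar> powr - k)) * CQ / m"
        using C1' Qb Gb m CQ C1(1) by (intro frac_le mult_mono) auto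
      also have "\<dots> = (C1 * CQ / m) * (1 + \<bar>Re u\<bar> powr - k)" by simp
      also have "\<dots> \<le> C * (1 + \<bar>Re u\<bar> powr - k)" by (intro mult_right_mono) (auto simp: C_def)
      finally show ?thesis .
    qed
  qed
qed

end

subsection \<open>The quasiconformal extension\<close>

lemma AE_lebesgue_ne: "AE x in lebesgue. x \<noteq> (c :: 'a :: euclidean_space)"
  by (rule AE_completion[OF AE_lborel_singleton])

lemma AE_lebesgue_not_sphere: "AE z in lebesgue. cmod z \<noteq> 1"
proof -
  have "sphere (0::complex) 1 \<in> null_sets lebesgue"
    using negligible_sphere negligible_iff_null_sets by blast
  from AE_not_in[OF this] show ?thesis by eventually_elim simp
qed

lemma has_partials_if_has_derivative:
  assumes "(F has_derivative F') (at z)"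
  shows "has_partial_x F z (F' 1)" "has_partial_y F z (F' \<i>)"
proof -
  have *: "((\<lambda>t. F (z + of_real t * d)) has_vector_derivative F' d) (at 0)" for d
  proof -
    have dl: "((\<lambda>t::real. z + of_real t * d) has_derivative (\<lambda>t. of_real t * d)) (at 0)"
      by (auto intro!: derivative_eq_intros)
    have "((\<lambda>t::real. F (z + of_real t * d)) has_derivative (\<lambda>t. F' (of_real t * d))) (at 0)"
      by (rule has_derivative_compose[OF dl]) (use assms in simp)
    moreover have "F' (of_real t * d) = t *\<^sub>R F' d" for t
      using linear_scale[OF has_derivative_linear[OF assms], of t d] by (simp add: scaleR_conv_of_real)
    ultimately show ?thesis by (simp add: has_vector_derivative_def)
  qed
  show "has_partial_x F z (F' 1)" "has_partial_y F z (F' \<i>)"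
    using *[of 1] *[of \<i>] by (simp_all add: has_partial_x_def has_partial_y_def mult.commute)
qed

text \<open>Converts a singularity in \<open>Re (Ln z) = ln (cmod z)\<close> into one in the
  distance of \<open>cmod z\<close> from 1.\<close>

lemma abs_ln_ge:
  fixes r K :: real
  assumes "0 < r" "r \<le> K" "1 \<le> K"
  shows "\<bar>r - 1\<bar> / K \<le> \<bar>ln r\<bar>"
proof (cases "r \<ge> 1")
  case True
  have "ln (1 / r) \<le> 1 / r - 1" using assms by (intro ln_le_minus_one) auto
  then have "(r - 1) / r \<le> ln r" using assms by (simp add: ln_div diff_divide_distrib)
  moreover have "(r - 1) / K \<le> (r - 1) / r" using True assms by (intro divide_left_mono) auto
  ultimately show ?thesis using True by simp
next
  case False
  have "ln r \<le> r - 1" using assms by (intro ln_le_minus_one) auto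
  moreover have "(1 - r) / K \<le> (1 - r) / 1" using False assms by (intro divide_left_mono) auto
  ultimately show ?thesis using False assms by (simp add: abs_if)
qed

lemma add_mult_le:
  fixes a x y :: real
  assumes "0 \<le> a" "0 \<le> x" "0 \<le> y"
  shows "1 + a * (x + y) \<le> (1 + a) * (1 + x + y)"
  using assms by (simp add: algebra_simps)

text \<open>By \<open>orth\<close>, \<open>p\<close> is the foot of the perpendicular from 0, so the
  line either misses the unit circle or crosses it transversally at \<open>x\<close> and
  \<open>- x\<close>. On a tangent line \<open>cmod z - 1\<close> vanishes to second order and a
  singularity of order \<open>2 * k\<close> need not be integrable; this is why
  \<open>cmod p = 1\<close> is excluded.\<close>

lemma abs_cont_on_line:
  fixes F :: "complex \<Rightarrow> complex" and p d :: complex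
  assumes k: "0 \<le> k" "k < 1" and cont: "continuous_on UNIV F"
    and der: "\<And>K. 1 \<le> K \<Longrightarrow> \<exists>C\<ge>0. \<forall>z. cmod z \<le> K \<longrightarrow> cmod z \<noteq> 1 \<longrightarrow>
        (\<exists>F'. (F has_derivative F') (at z) \<and> (\<forall>h. cmod (F' h) \<le> C * (1 + \<bar>cmod z - 1\<bar> powr - k) * cmod h))"
    and d: "cmod d = 1" and orth: "\<And>t. (cmod (p + of_real t * d))\<^sup>2 = (cmod p)\<^sup>2 + t\<^sup>2"
    and q1: "cmod p \<noteq> 1"
  shows "abs_cont_on (\<lambda>t. F (p + of_real t * d)) \<alpha> \<beta>"
proof -
  define K where "K = 1 + cmod p + \<bar>\<alpha>\<bar> + \<bar>\<beta>\<bar>"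
  have K: "1 \<le> K" by (simp add: K_def)
  obtain C where C: "C \<ge> 0" "\<And>z. cmod z \<le> K \<Longrightarrow> cmod z \<noteq> 1 \<Longrightarrow>
      \<exists>F'. (F has_derivative F') (at z) \<and> (\<forall>h. cmod (F' h) \<le> C * (1 + \<bar>cmod z - 1\<bar> powr - k) * cmod h)"
    using der[OF K] by blast
  have zK: "cmod (p + of_real t * d) \<le> K" if "\<alpha> < t" "t < \<beta>" for t
  proof -
    have "cmod (p + of_real t * d) \<le> cmod p + \<bar>t\<bar>" using norm_triangle_ineq[of p "of_real t * d"] d by (simp add: norm_mult)
    then show ?thesis using that by (simp add: K_def)
  qed
  have gder: "\<exists>g'. ((\<lambda>t. F (p + of_real t * d)) has_vector_derivative g') (at t) \<and>
      cmod g' \<le> C * (1 + \<bar>cmod (p + of_real t * d) - 1\<bar> powr - k)"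
    if t: "\<alpha> < t" "t < \<beta>" "cmod (p + of_real t * d) \<noteq> 1" for t
  proof -
    let ?z = "p + of_real t * d"
    obtain F' where F': "(F has_derivative F') (at ?z)" "\<And>h. cmod (F' h) \<le> C * (1 + \<bar>cmod ?z - 1\<bar> powr - k) * cmod h"
      using C(2)[OF zK[OF t(1,2)] t(3)] by blast
    have dl: "((\<lambda>t::real. p + of_real t * d) has_derivative (\<lambda>t. of_real t * d)) (at t)"
      by (auto intro!: derivative_eq_intros)
    have "((\<lambda>t::real. F (p + of_real t * d)) has_derivative (\<lambda>t. F' (of_real t * d))) (at t)"
      by (rule has_derivative_compose[OF dl F'(1)])
    moreover have "F' (of_real t * d) = t *\<^sub>R F' d" for t
      using linear_scale[OF has_derivative_linear[OF F'(1)], of t d] by (simp add: scaleR_conv_of_real)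
    ultimately show ?thesis using F'(2)[of d] d by (auto simp: has_vector_derivative_def)
  qed
  have cont': "continuous_on {\<alpha>..\<beta>} (\<lambda>t. F (p + of_real t * d))"
    by (intro continuous_on_compose2[OF cont] continuous_intros) auto
  show ?thesis
  proof (cases "cmod p > 1")
    case True
    define B where "B = C * (1 + (cmod p - 1) powr - k)"
    show ?thesis
    proof (rule abs_cont_on_if_deriv_le_powr[OF k _ cont', of B 0 0])
      show "0 \<le> B" using C(1) by (simp add: B_def)
      fix t assume t: "\<alpha> < t" "t < \<beta>"
      have "(cmod p)\<^sup>2 \<le> (cmod (p + of_real t * d))\<^sup>2" unfolding orth by simp
      then have zp: "cmod p \<le> cmod (p + of_real t * d)" by (rule power2_le_imp_le) simp
      obtain g' where g': "((\<lambda>t. F (p + of_real t * d)) has_vector_derivative g') (at t)"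
          "cmod g' \<le> C * (1 + \<bar>cmod (p + of_real t * d) - 1\<bar> powr - k)"
        using gder[OF t] zp True by auto
      have "\<bar>cmod (p + of_real t * d) - 1\<bar> powr - k \<le> (cmod p - 1) powr - k"
        using zp True k by (intro powr_mono2') auto
      then have "C * (1 + \<bar>cmod (p + of_real t * d) - 1\<bar> powr - k) \<le> B"
        unfolding B_def using C(1) by (intro mult_left_mono) auto
      also have "B * 1 \<le> B * (1 + \<bar>t - 0\<bar> powr - k + \<bar>t - 0\<bar> powr - k)"
        using \<open>0 \<le> B\<close> by (intro mult_left_mono) auto
      finally show "\<exists>g'. ((\<lambda>t. F (p + of_real t * d)) has_vector_derivative g') (at t) \<and>
          cmod g' \<le> B * (1 + \<bar>t - 0\<bar> powr - k + \<bar>t - 0\<bar> powr - k)"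
        using g' by (auto intro!: exI[of _ g'])
    qed
  next
    case False
    then have p1: "cmod p < 1" using q1 by simp
    define x where "x = sqrt (1 - (cmod p)\<^sup>2)"
    have p2: "(cmod p)\<^sup>2 < 1" using p1 by (simp add: power_less_one_iff abs_square_less_1)
    then have x: "x > 0" "x\<^sup>2 = 1 - (cmod p)\<^sup>2" by (auto simp: x_def)
    \<comment> \<open>Here \<open>r\<^sup>2 - 1 = (t - x) * (t + x)\<close> and
      \<open>r + 1 \<le> K + 1\<close>. The factor belonging to the farther crossing is at least
      \<open>x\<close>, so \<open>\<bar>r - 1\<bar>\<close> is at least \<open>m\<close> times the
      distance to the nearer one.\<close>
    define m where "m = x / (K + 1)"
    have m: "m > 0" using x K by (simp add: m_def)
    define B where "B = C * (1 + m powr - k)"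
    have B: "0 \<le> B" using C(1) by (simp add: B_def)
    show ?thesis
    proof (rule abs_cont_on_if_deriv_le_powr[OF k B cont', of x "- x"])
      fix t assume t: "\<alpha> < t" "t < \<beta>" "t \<noteq> x" "t \<noteq> - x"
      define r where "r = cmod (p + of_real t * d)"
      have r: "0 \<le> r" "r \<le> K" "r\<^sup>2 - 1 = (t - x) * (t + x)"
        using zK[OF t(1,2)] orth[of t] x(2) by (auto simp: r_def power2_eq_square algebra_simps)
      have r1: "r \<noteq> 1" using r(3) t by auto
      define y where "y = (if t \<ge> 0 then x else - x)"
      have y: "\<bar>t - y\<bar> > 0" "\<bar>t - y\<bar> * x \<le> \<bar>r\<^sup>2 - 1\<bar>"
        using t x(1) unfolding r(3) abs_mult by (auto simp: y_def mult.commute intro!: mult_right_mono)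
      have "\<bar>r\<^sup>2 - 1\<bar> = \<bar>r - 1\<bar> * (r + 1)" using r(1) by (simp add: power2_eq_square square_diff_one_factored abs_mult)
      also have "\<dots> \<le> \<bar>r - 1\<bar> * (K + 1)" using r by (intro mult_left_mono) auto
      finally have "m * \<bar>t - y\<bar> \<le> \<bar>r - 1\<bar>" using y(2) K by (simp add: m_def field_simps)
      then have "\<bar>r - 1\<bar> powr - k \<le> (m * \<bar>t - y\<bar>) powr - k"
        using y(1) m k by (intro powr_mono2') auto
      also have "\<dots> = m powr - k * \<bar>t - y\<bar> powr - k" using m by (simp add: powr_mult)
      also have "\<dots> \<le> m powr - k * (\<bar>t - x\<bar> powr - k + \<bar>t - (- x)\<bar> powr - k)"
        by (intro mult_left_mono) (auto simp: y_def)
      finally have "1 + \<bar>r - 1\<bar> powr - k \<le> (1 + m powr - k) * (1 + \<bar>t - x\<bar> powr - k + \<bar>t - (- x)\<bar> powr - k)"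
        using add_mult_le[of "m powr - k" "\<bar>t - x\<bar> powr - k" "\<bar>t - (- x)\<bar> powr - k"] by simp
      then have le: "C * (1 + \<bar>r - 1\<bar> powr - k) \<le> B * (1 + \<bar>t - x\<bar> powr - k + \<bar>t - (- x)\<bar> powr - k)"
        unfolding B_def mult.assoc using C(1) by (intro mult_left_mono) auto
      obtain g' where g': "((\<lambda>t. F (p + of_real t * d)) has_vector_derivative g') (at t)"
          "cmod g' \<le> C * (1 + \<bar>r - 1\<bar> powr - k)"
        using gder[OF t(1,2)] r1 by (auto simp: r_def)
      then show "\<exists>g'. ((\<lambda>t. F (p + of_real t * d)) has_vector_derivative g') (at t) \<and>
          cmod g' \<le> B * (1 + \<bar>t - x\<bar> powr - k + \<bar>t - (- x)\<bar> powr - k)"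
        using le by (auto intro!: exI[of _ g'])
    qed
  qed
qed

section \<open>The extension in the plane\<close>

locale loewner_extension = loewner_data +
  fixes f :: "complex \<Rightarrow> complex"
  assumes f_hol: "f holomorphic_on unit_disc" and f_0: "f 0 = 0"
    and f_exp: "Re v < 0 \<Longrightarrow> f (exp v) = exp (\<phi> v)"
begin

definition F :: "complex \<Rightarrow> complex" where
  "F z = (if z = 0 then 0 else exp (log_ext 0 (Ln z)))"

lemma F_exp: "F (exp u) = exp (log_ext 0 u)"
proof -
  have "exp (Ln (exp u)) = exp u" by simp
  then obtain n :: int where "Ln (exp u) = u + of_int (2 * n) * of_real pi * \<i>" unfolding exp_eq by auto
  then have "Ln (exp u) = u + turn n" by (simp add: mult_ac)
  then have "F (exp u) = exp (log_ext 0 u + turn n)"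
    by (simp add: F_def log_ext_0_shift)
  also have "\<dots> = exp (log_ext 0 u)" unfolding exp_eq by (intro exI[of _ n]) (simp add: mult_ac)
  finally show ?thesis .
qed

lemma F_disc: "z \<in> unit_disc \<Longrightarrow> F z = f z"
proof (cases "z = 0")
  case False
  assume z: "z \<in> unit_disc"
  have "Re (Ln z) < 0" using z False by (simp add: Re_Ln)
  then have "F z = exp (\<phi> (Ln z))" using False by (simp add: F_def log_ext_left)
  also have "\<dots> = f z" using f_exp[OF \<open>Re (Ln z) < 0\<close>] False by simp
  finally show ?thesis .
qed (simp add: F_def f_0)

text \<open>A branch of the logarithm that is holomorphic near \<open>z0\<close> even if
  \<open>z0\<close> lies on the cut of \<open>Ln\<close>; since \<open>log_ext 0\<close> commutes
  with the period, it may replace \<open>Ln\<close> in \<open>F\<close>.\<close>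

definition logb :: "complex \<Rightarrow> complex \<Rightarrow> complex" where
  "logb z0 z = Ln (z / z0) + Ln z0"

lemma F_logb: "z0 \<noteq> 0 \<Longrightarrow> z \<noteq> 0 \<Longrightarrow> F z = exp (log_ext 0 (logb z0 z))"
  using F_exp[of "logb z0 z"] by (simp add: logb_def exp_add)

lemma logb_deriv: "z0 \<noteq> 0 \<Longrightarrow> (logb z0 has_field_derivative 1 / z0) (at z0)"
  unfolding logb_def by (auto intro!: derivative_eq_intros)

lemma logb_self [simp]: "z0 \<noteq> 0 \<Longrightarrow> logb z0 z0 = Ln z0"
  by (simp add: logb_def)

lemma F_cont: "continuous_on UNIV F"
proof (rule continuous_at_imp_continuous_on, safe)
  fix z0
  show "isCont F z0"
  proof (cases "z0 = 0")
    case True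
    have "continuous_on unit_disc F"
      by (rule continuous_on_eq[OF holomorphic_on_imp_continuous_on[OF f_hol]]) (simp add: F_disc)
    then show ?thesis using True by (simp add: continuous_on_eq_continuous_at)
  next
    case False
    have 1: "isCont (logb z0) z0" using logb_deriv[OF False] by (rule DERIV_isCont)
    have 2: "isCont (log_ext 0) (logb z0 z0)" using log_ext_0_cont by (simp add: continuous_on_eq_continuous_at)
    have "isCont (\<lambda>z. exp (log_ext 0 (logb z0 z))) z0"
      by (rule isCont_o2[OF isCont_o2[OF 1 2] isCont_exp])
    moreover have "\<forall>\<^sub>F z in nhds z0. z \<in> - {0}"
      using False by (intro eventually_nhds_in_open) auto
    then have "\<forall>\<^sub>F z in nhds z0. exp (log_ext 0 (logb z0 z)) = F z"
      by eventually_elim (simp add: F_logb[OF False])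
    ultimately show ?thesis by (simp cong: isCont_cong)
  qed
qed

lemma F_inj: "inj F"
proof (rule injI)
  fix z w assume eq: "F z = F w"
  show "z = w"
  proof (cases "z = 0 \<or> w = 0")
    case True
    then show ?thesis using eq by (auto simp: F_def split: if_splits)
  next
    case False
    then have "exp (log_ext 0 (Ln z)) = exp (log_ext 0 (Ln w))" using eq by (simp add: F_def)
    then obtain n :: int where "log_ext 0 (Ln z) = log_ext 0 (Ln w) + of_int (2 * n) * of_real pi * \<i>" unfolding exp_eq by auto
    also have "\<dots> = log_ext 0 (Ln w + turn n)" unfolding log_ext_0_shift by (simp add: mult_ac)
    finally have "Ln z = Ln w + turn n" using log_ext_0_inj by (simp add: inj_eq)
    then have "exp (Ln z) = exp (Ln w)" unfolding exp_eq by (intro exI[of _ n]) (simp add: mult_ac)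
    then show ?thesis using False by simp
  qed
qed

lemma F_surj: "surj F"
proof -
  have "\<exists>z. F z = w" for w
  proof (cases "w = 0")
    case True
    then show ?thesis by (intro exI[of _ 0]) (simp add: F_def)
  next
    case False
    obtain u where "Ln w = log_ext 0 u" using log_ext_0_surj by (metis surjD)
    then have "F (exp u) = w" using False F_exp[of u] by (metis exp_Ln)
    then show ?thesis by blast
  qed
  then show ?thesis by (metis surjI)
qed

lemma F_homeo: "\<exists>G. homeomorphism UNIV UNIV F G"
  using homeomorphism_if_bij[OF F_cont] F_inj F_surj by (auto simp: bij_def)

lemma F_has_derivative:
  assumes "z \<noteq> 0" "cmod z \<noteq> 1"
  shows "(F has_derivative (\<lambda>h. F z * ((of_real (Re (h / z)) * log_ext_P 0 (Ln z) + \<i> * of_real (Im (h / z))) * log_ext_D 0 (Ln z)))) (at z)"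
proof -
  have dl: "(logb z has_derivative (\<lambda>h. h / z)) (at z)"
    using logb_deriv[OF assms(1)] unfolding has_field_derivative_def by (rule has_derivative_eq_rhs) auto
  have "Re (Ln z) \<noteq> 0" using assms by (simp add: Re_Ln)
  from log_ext_has_derivative[OF order_refl this]
  have "((\<lambda>w. log_ext 0 (logb z w)) has_derivative
     (\<lambda>h. (of_real (Re (h / z)) * log_ext_P 0 (Ln z) + \<i> * of_real (Im (h / z))) * log_ext_D 0 (Ln z))) (at z)"
    using assms(1) by (intro has_derivative_compose[OF dl]) simp
  then have "((\<lambda>w. exp (log_ext 0 (logb z w))) has_derivative
     (\<lambda>h. exp (log_ext 0 (logb z z)) * ((of_real (Re (h / z)) * log_ext_P 0 (Ln z) + \<i> * of_real (Im (h / z))) * log_ext_D 0 (Ln z)))) (at z)"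
    by (rule has_derivative_compose) (use DERIV_exp in \<open>simp add: has_field_derivative_def\<close>)
  then have "((\<lambda>w. exp (log_ext 0 (logb z w))) has_derivative
     (\<lambda>h. F z * ((of_real (Re (h / z)) * log_ext_P 0 (Ln z) + \<i> * of_real (Im (h / z))) * log_ext_D 0 (Ln z)))) (at z)"
    using F_logb[OF assms(1) assms(1)] by simp
  then show ?thesis
    by (rule has_derivative_transform_within_open[of _ _ _ _ "- {0}"]) (use assms in \<open>auto simp: F_logb[OF assms(1)]\<close>)
qed

lemma F_has_derivative_disc:
  assumes "cmod z < 1"
  shows "(F has_derivative (\<lambda>h. deriv f z * h)) (at z)"
proof -
  have "(f has_derivative (\<lambda>h. deriv f z * h)) (at z)"
    using holomorphic_derivI[OF f_hol open_ball, of z] assms by (simp add: has_field_derivative_def)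
  then show ?thesis
    by (rule has_derivative_transform_within_open[of _ _ _ _ unit_disc]) (use F_disc assms in auto)
qed

lemma F_beltrami:
  assumes "cmod z \<noteq> 1"
  shows "\<exists>Fx Fy. has_partial_x F z Fx \<and> has_partial_y F z Fy \<and>
    cmod ((Fx + \<i> * Fy) / 2) \<le> k * cmod ((Fx - \<i> * Fy) / 2)"
proof (cases "cmod z < 1")
  case True
  then show ?thesis
    using has_partials_if_has_derivative[OF F_has_derivative_disc[OF True]] k(1)
    by (intro exI[of _ "deriv f z * 1"] exI[of _ "deriv f z * \<i>"]) (auto simp: algebra_simps)
next
  case False
  then have "z \<noteq> 0" "cmod z > 1" using assms by auto
  then have z: "z \<noteq> 0" "Re (Ln z) \<noteq> 0" by (auto simp: Re_Ln)
  define P D where "P = log_ext_P 0 (Ln z)" and "D = log_ext_D 0 (Ln z)"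
  define T where "T h = F z * ((of_real (Re (h / z)) * P + \<i> * of_real (Im (h / z))) * D)" for h
  \<comment> \<open>Here \<open>\<alpha> + \<i> * \<beta> = 1 / z\<close>: the change to logarithmic
    coordinates contributes conjugate factors of equal modulus to the two Wirtinger derivatives, and
    \<open>P - 1\<close> and \<open>P + 1\<close> are left to be compared.\<close>
  define \<alpha> \<beta> where "\<alpha> = complex_of_real (Re (1 / z))" and "\<beta> = complex_of_real (Im (1 / z))"
  have "Re (\<i> / z) = - Im (1 / z)" "Im (\<i> / z) = Re (1 / z)"
    by (simp_all add: Re_divide Im_divide)
  then have T: "T 1 = F z * ((\<alpha> * P + \<i> * \<beta>) * D)" "T \<i> = F z * ((- \<beta> * P + \<i> * \<alpha>) * D)"
    by (simp_all add: T_def \<alpha>_def \<beta>_def)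
  have "T 1 + \<i> * T \<i> = F z * D * (P - 1) * (\<alpha> - \<i> * \<beta>)" "T 1 - \<i> * T \<i> = F z * D * (P + 1) * (\<alpha> + \<i> * \<beta>)"
    unfolding T by (simp_all add: algebra_simps)
  moreover have "cmod (\<alpha> - \<i> * \<beta>) = cmod (\<alpha> + \<i> * \<beta>)"
    by (simp add: \<alpha>_def \<beta>_def cmod_def)
  ultimately have "cmod (T 1 + \<i> * T \<i>) = cmod (F z * D) * cmod (\<alpha> + \<i> * \<beta>) * cmod (P - 1)"
    "cmod (T 1 - \<i> * T \<i>) = cmod (F z * D) * cmod (\<alpha> + \<i> * \<beta>) * cmod (P + 1)"
    by (simp_all add: norm_mult)
  moreover have "cmod (P - 1) \<le> k * cmod (P + 1)" unfolding P_def by (rule log_ext_P_bounds) (use z in auto)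
  ultimately have "cmod (T 1 + \<i> * T \<i>) \<le> k * cmod (T 1 - \<i> * T \<i>)"
    using mult_left_mono[of "cmod (P - 1)" "k * cmod (P + 1)" "cmod (F z * D) * cmod (\<alpha> + \<i> * \<beta>)"]
    by (simp add: mult_ac)
  then have "cmod ((T 1 + \<i> * T \<i>) / 2) \<le> k * cmod ((T 1 - \<i> * T \<i>) / 2)" by (simp add: norm_divide)
  moreover have "(F has_derivative T) (at z)"
    using F_has_derivative[OF z(1) assms] unfolding T_def P_def D_def .
  ultimately show ?thesis using has_partials_if_has_derivative by blast
qed

lemma F_derivative_bound:
  assumes K: "1 \<le> K"
  shows "\<exists>C\<ge>0. \<forall>z. cmod z \<le> K \<longrightarrow> cmod z \<noteq> 1 \<longrightarrow>
     (\<exists>F'. (F has_derivative F') (at z) \<and> (\<forall>h. cmod (F' h) \<le> C * (1 + \<bar>cmod z - 1\<bar> powr - k) * cmod h))"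
proof -
  have "compact (F ` cball 0 K)" by (intro compact_continuous_image continuous_on_subset[OF F_cont]) auto
  then obtain M where M: "\<And>z. cmod z \<le> K \<Longrightarrow> cmod (F z) \<le> M"
    using compact_imp_bounded by (force simp: bounded_iff)
  have M0: "0 \<le> M" using M[of 0] K norm_ge_zero order.trans[of 0 "cmod (F 0)" M] by auto
  have "deriv f holomorphic_on unit_disc" by (rule holomorphic_deriv[OF f_hol open_ball])
  then have "compact (deriv f ` cball 0 (1/2))"
    by (intro compact_continuous_image holomorphic_on_imp_continuous_on) (auto elim: holomorphic_on_subset)
  then obtain M2 where M2: "\<And>z. cmod z \<le> 1/2 \<Longrightarrow> cmod (deriv f z) \<le> M2"
    using compact_imp_bounded by (force simp: bounded_iff)
  have M20: "0 \<le> M2" using M2[of 0] norm_ge_zero order.trans[of 0 "cmod (deriv f 0)" M2] by auto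
  obtain CD where CD: "0 \<le> CD" "\<And>u. Re u \<noteq> 0 \<Longrightarrow> Re u \<le> ln K \<Longrightarrow> cmod (log_ext_D 0 u) \<le> CD * (1 + \<bar>Re u\<bar> powr - k)"
    by (rule log_ext_D_bound[of "ln K"]) blast
  define CK where "CK = 1 + (1 / K) powr - k"
  define C where "C = M2 + M * (2 * (P_upper + 1)) * (CD * CK)"
  have P_upper_nonneg: "0 \<le> P_upper" using P_lower_upper by simp
  have CM: "0 \<le> M * (2 * (P_upper + 1)) * (CD * CK)" using M0 P_upper_nonneg CD(1) by (simp add: CK_def)
  have C0: "0 \<le> C" using CM M20 by (simp add: C_def)
  show ?thesis
  proof (intro exI[of _ C] conjI C0 allI impI)
    fix z assume z: "cmod z \<le> K" "cmod z \<noteq> 1"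
    define B where "B = 1 + \<bar>cmod z - 1\<bar> powr - k"
    have B: "1 \<le> B" by (simp add: B_def)
    show "\<exists>F'. (F has_derivative F') (at z) \<and> (\<forall>h. cmod (F' h) \<le> C * (1 + \<bar>cmod z - 1\<bar> powr - k) * cmod h)"
    \<comment> \<open>Near 0 the logarithmic coordinate is singular and the bound comes from
      \<open>deriv f\<close>; elsewhere \<open>1 / cmod z\<close> is at most 2.\<close>
    proof (cases "cmod z \<le> 1/2")
      case True
      have "cmod (deriv f z * h) \<le> C * B * cmod h" for h
      proof -
        have "cmod (deriv f z) \<le> C * 1" using M2[OF True] CM by (simp add: C_def)
        also have "\<dots> \<le> C * B" using C0 B by (intro mult_left_mono)
        finally show ?thesis unfolding norm_mult by (intro mult_right_mono) auto
      qed
      then show ?thesis using F_has_derivative_disc[of z] True unfolding B_def by auto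
    next
      case False
      then have z0: "z \<noteq> 0" "1/2 < cmod z" by auto
      define r where "r = cmod z"
      have r: "0 < r" "r \<le> K" "r \<noteq> 1" using z z0 by (auto simp: r_def)
      have re: "Re (Ln z) = ln r" using z0 by (simp add: Re_Ln r_def)
      have lr: "ln r \<noteq> 0" "ln r \<le> ln K" using r by auto
      have D: "cmod (log_ext_D 0 (Ln z)) \<le> CD * (CK * B)"
      proof -
        have "\<bar>ln r\<bar> powr - k \<le> (\<bar>r - 1\<bar> / K) powr - k"
          using abs_ln_ge[OF r(1,2) K] r K k by (intro powr_mono2') auto
        also have "\<dots> = (1 / K) powr - k * \<bar>r - 1\<bar> powr - k" using K by (simp flip: powr_mult)
        finally have "1 + \<bar>ln r\<bar> powr - k \<le> CK * B"
          using add_mult_le[of "(1 / K) powr - k" "\<bar>r - 1\<bar> powr - k" 0] by (simp add: CK_def B_def r_def)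
        then have "CD * (1 + \<bar>ln r\<bar> powr - k) \<le> CD * (CK * B)" using CD(1) by (intro mult_left_mono)
        then show ?thesis using CD(2)[of "Ln z"] re lr by simp
      qed
      define T where "T h = F z * ((of_real (Re (h / z)) * log_ext_P 0 (Ln z) + \<i> * of_real (Im (h / z))) * log_ext_D 0 (Ln z))" for h
      have "cmod (T h) \<le> C * B * cmod h" for h
      proof -
        have hz: "cmod (h / z) \<le> 2 * cmod h"
        proof -
          have "cmod h / cmod z \<le> cmod h / (1/2)" using z0 by (intro divide_left_mono) auto
          then show ?thesis by (simp add: norm_divide)
        qed
        have PC: "cmod (log_ext_P 0 (Ln z)) \<le> P_upper" by (rule log_ext_P_bounds) (use re lr in auto)
        have "cmod (of_real (Re (h / z)) * log_ext_P 0 (Ln z) + \<i> * of_real (Im (h / z))) \<le> \<bar>Re (h / z)\<bar> * cmod (log_ext_P 0 (Ln z)) + \<bar>Im (h / z)\<bar>"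
          by (rule order.trans[OF norm_triangle_ineq]) (simp add: norm_mult)
        also have "\<dots> \<le> (2 * cmod h) * P_upper + 2 * cmod h"
          using abs_Re_le_cmod[of "h / z"] abs_Im_le_cmod[of "h / z"] hz PC
          by (intro add_mono mult_mono) (auto intro: order.trans)
        also have "\<dots> = 2 * (P_upper + 1) * cmod h" by (simp add: algebra_simps)
        finally have lin: "cmod (of_real (Re (h / z)) * log_ext_P 0 (Ln z) + \<i> * of_real (Im (h / z))) \<le> 2 * (P_upper + 1) * cmod h" .
        have "cmod (T h) \<le> M * ((2 * (P_upper + 1) * cmod h) * (CD * (CK * B)))"
          unfolding T_def norm_mult using M[OF z(1)] lin D M0 P_upper_nonneg by (intro mult_mono) auto
        also have "\<dots> = (M * (2 * (P_upper + 1)) * (CD * CK)) * (B * cmod h)" by (simp add: mult_ac)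
        also have "\<dots> \<le> C * (B * cmod h)" using M20 B by (intro mult_right_mono) (auto simp: C_def)
        finally show ?thesis by (simp add: mult_ac)
      qed
      then show ?thesis using F_has_derivative[OF z0(1) z(2)] unfolding T_def B_def by blast
    qed
  qed
qed

lemma F_ACL: "ACL F"
proof -
  have h: "abs_cont_on (\<lambda>x. F (Complex x y)) \<alpha> \<beta>" if "\<bar>y\<bar> \<noteq> 1" for y \<alpha> \<beta>
  proof -
    have "abs_cont_on (\<lambda>t. F (\<i> * of_real y + of_real t * 1)) \<alpha> \<beta>"
      by (rule abs_cont_on_line[OF k F_cont F_derivative_bound]) (use that in \<open>auto simp: cmod_power2 norm_mult\<close>)
    moreover have "\<i> * of_real y + of_real t * 1 = Complex t y" for t by (simp add: complex_eq_iff)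
    ultimately show ?thesis by simp
  qed
  have v: "abs_cont_on (\<lambda>y. F (Complex x y)) \<alpha> \<beta>" if "\<bar>x\<bar> \<noteq> 1" for x \<alpha> \<beta>
  proof -
    have "abs_cont_on (\<lambda>t. F (of_real x + of_real t * \<i>)) \<alpha> \<beta>"
      by (rule abs_cont_on_line[OF k F_cont F_derivative_bound]) (use that in \<open>auto simp: cmod_power2 norm_mult\<close>)
    moreover have "of_real x + of_real t * \<i> = Complex x t" for t by (simp add: complex_eq_iff)
    ultimately show ?thesis by simp
  qed
  \<comment> \<open>The two exceptional lines in each direction are the tangents of the
    circle.\<close>
  have ae: "AE y in lebesgue. \<bar>y::real\<bar> \<noteq> 1"
    using AE_lebesgue_ne[of 1] AE_lebesgue_ne[of "-1"] by eventually_elim auto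
  show ?thesis
    unfolding ACL_def
    by (intro conjI; use ae in eventually_elim) (auto intro: h v)
qed

lemma qc_extension: "has_qc_extension k f"
proof -
  have "qc_homeo k F"
    unfolding qc_homeo_def
    using F_homeo F_ACL AE_lebesgue_not_sphere F_beltrami by (auto elim!: eventually_mono)
  then show ?thesis unfolding has_qc_extension_def using F_disc by blast
qed

end

section \<open>From the hypothesis on f to the logarithmic data\<close>

lemma classA_log_factor:
  assumes "classA f" and nz: "\<forall>z\<in>unit_disc. z \<noteq> 0 \<longrightarrow> f z \<noteq> 0"
  obtains lam where "lam holomorphic_on unit_disc" "lam 0 = 0" "\<And>z. z \<in> unit_disc \<Longrightarrow> f z = z * exp (lam z)"
proof -
  have hol: "f holomorphic_on unit_disc" and f0: "f 0 = 0" "deriv f 0 = 1" using assms(1) by (auto simp: classA_def)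
  define g where "g = (\<lambda>z. if z = 0 then deriv f 0 else (f z - f 0) / (z - 0))"
  have "g holomorphic_on unit_disc" unfolding g_def by (rule pole_lemma[OF hol]) (simp add: interior_open)
  moreover have "g z \<noteq> 0" if "z \<in> unit_disc" for z using nz that f0 by (auto simp: g_def)
  ultimately obtain l where l: "l holomorphic_on unit_disc" "\<And>z. z \<in> unit_disc \<Longrightarrow> g z = exp (l z)"
    using contractible_imp_holomorphic_log[OF _ convex_imp_contractible[OF convex_ball]] by metis
  have l0: "exp (l 0) = 1" using l(2)[of 0] f0 by (simp add: g_def)
  show ?thesis
  proof (rule that[of "\<lambda>z. l z - l 0"])
    show "(\<lambda>z. l z - l 0) holomorphic_on unit_disc" by (intro holomorphic_intros l)
    fix z :: complex assume z: "z \<in> unit_disc"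
    show "f z = z * exp (l z - l 0)"
      using l(2)[OF z, symmetric] f0 l0 by (auto simp: g_def exp_diff)
  qed simp
qed

theorem theorem1:
  fixes a b k :: real and f :: "complex \<Rightarrow> complex" and c :: complex
  defines "s \<equiv> Complex a b"
  defines "M \<equiv> (if a \<le> 1 then a * k * cmod s + (a - 1) * cmod (s + c) else k * cmod s)"
  defines "l \<equiv> (2 * k * a + (1 - k\<^sup>2) * \<bar>b\<bar>) / ((1 + k\<^sup>2) * a + (1 - k\<^sup>2) * cmod s)"
  assumes "a > 0" and "0 \<le> k" and "k < 1"
    and "classA f"
    and "\<forall>z\<in>unit_disc. deriv f z \<noteq> 0"
    and "\<forall>z\<in>unit_disc. z \<noteq> 0 \<longrightarrow> f z \<noteq> 0"
    and "\<forall>z\<in>unit_disc.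
           cmod (c * (cmod z)\<^sup>2 + s - a * (1 - (cmod z)\<^sup>2) *
             (s * (1 + z * deriv (deriv f) z / deriv f z) +
              (1 - s) * (if z = 0 then 1 else z * deriv f z / f z))) \<le> M"
  shows "l < 1 \<and> has_qc_extension l f"
proof
  note a = assms(4) and k = assms(5,6) and fA = assms(7) and f' = assms(8) and fnz = assms(9) and hyp = assms(10)
  have sb: "\<bar>b\<bar> \<le> cmod s" "cmod s \<le> a + \<bar>b\<bar>" "cmod s > 0" "Re s = a"
    using abs_Im_le_cmod[of s] cmod_le[of s] a by (auto simp: s_def complex_eq_iff)
  have k2: "0 < 1 - k\<^sup>2" using k by (simp add: power_less_one_iff abs_square_less_1)
  define den where "den = (1 + k\<^sup>2) * a + (1 - k\<^sup>2) * cmod s"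
  have den: "den > 0"
  proof -
    have "0 < 1 + k\<^sup>2" by (simp add: add_pos_nonneg)
    then show ?thesis unfolding den_def using mult_pos_pos[of "1 + k\<^sup>2" a] mult_pos_pos[OF k2 sb(3)] a by linarith
  qed
  have "2 * k * a < (1 + k\<^sup>2) * a"
  proof -
    have "0 < (1 - k)\<^sup>2 * a" using a k by simp
    then show ?thesis by (simp add: power2_eq_square algebra_simps)
  qed
  moreover have "(1 - k\<^sup>2) * \<bar>b\<bar> \<le> (1 - k\<^sup>2) * cmod s" using k2 sb(1) by (intro mult_left_mono) auto
  ultimately show "l < 1" using den unfolding l_def den_def[symmetric] by (simp add: den_def)
  \<comment> \<open>With the denominator cleared, this is
    \<open>k * cmod s \<le> k * a + \<bar>b\<bar>\<close> multiplied by
    \<open>1 - k\<^sup>2\<close>.\<close>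
  have kl: "k \<le> l"
  proof -
    have "k * cmod s \<le> k * a + \<bar>b\<bar>"
      using mult_left_mono[OF sb(2) k(1)] mult_right_mono[of k 1 "\<bar>b\<bar>"] k by (simp add: distrib_left)
    then have "(1 - k\<^sup>2) * (k * cmod s) \<le> (1 - k\<^sup>2) * (k * a + \<bar>b\<bar>)" using k2 by (intro mult_left_mono) auto
    then have "k * den \<le> 2 * k * a + (1 - k\<^sup>2) * \<bar>b\<bar>"
      by (simp add: den_def algebra_simps power2_eq_square)
    then show ?thesis using den unfolding l_def den_def[symmetric] by (simp add: pos_le_divide_eq)
  qed
  obtain lam where lam: "lam holomorphic_on unit_disc" "lam 0 = 0" "\<And>z. z \<in> unit_disc \<Longrightarrow> f z = z * exp (lam z)"
    using classA_log_factor[OF fA fnz] by metis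
  \<comment> \<open>This is z f'/f, with the value 1 at the origin built in.\<close>
  define g where "g z = 1 + z * deriv lam z" for z
  have dlam: "(lam has_field_derivative deriv lam z) (at z)" if "z \<in> unit_disc" for z
    using holomorphic_derivI[OF lam(1) open_ball that] by simp
  have g_hol: "g holomorphic_on unit_disc"
    unfolding g_def by (intro holomorphic_intros holomorphic_deriv[OF lam(1) open_ball])
  have dg: "(g has_field_derivative deriv g z) (at z)" if "z \<in> unit_disc" for z
    using holomorphic_derivI[OF g_hol open_ball that] by simp
  have df: "(f has_field_derivative exp (lam z) * g z) (at z)" if z: "z \<in> unit_disc" for z
  proof -
    have "((\<lambda>z. exp (lam z)) has_field_derivative exp (lam z) * deriv lam z) (at z)"
      by (rule DERIV_chain2[OF DERIV_exp dlam[OF z]])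
    from DERIV_mult'[OF DERIV_ident this]
    have "((\<lambda>z. z * exp (lam z)) has_field_derivative exp (lam z) * g z) (at z)"
      by (rule DERIV_cong) (simp add: g_def algebra_simps)
    then show ?thesis
      by (rule has_field_derivative_transform_within_open[OF _ open_ball z]) (simp add: lam(3))
  qed
  have f1: "deriv f z = exp (lam z) * g z" if "z \<in> unit_disc" for z using df[OF that] by (rule DERIV_imp_deriv)
  have gnz: "g z \<noteq> 0" if "z \<in> unit_disc" for z using f1[OF that] f' that by auto
  have f2: "deriv (deriv f) z = exp (lam z) * (deriv lam z * g z + deriv g z)" if z: "z \<in> unit_disc" for z
  proof (rule DERIV_imp_deriv)
    have "((\<lambda>z. exp (lam z)) has_field_derivative exp (lam z) * deriv lam z) (at z)"
      by (rule DERIV_chain2[OF DERIV_exp dlam[OF z]])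
    from DERIV_mult'[OF this dg[OF z]]
    have "((\<lambda>z. exp (lam z) * g z) has_field_derivative exp (lam z) * (deriv lam z * g z + deriv g z)) (at z)"
      by (rule DERIV_cong) (simp add: algebra_simps)
    then show "(deriv f has_field_derivative exp (lam z) * (deriv lam z * g z + deriv g z)) (at z)"
      by (rule has_field_derivative_transform_within_open[OF _ open_ball z]) (simp add: f1)
  qed
  define H where "H z = g z + s * (z * deriv g z / g z)" for z
  have bracket: "s * (1 + z * deriv (deriv f) z / deriv f z) + (1 - s) * (if z = 0 then 1 else z * deriv f z / f z) = H z"
    if z: "z \<in> unit_disc" for z
  proof -
    have 1: "1 + z * deriv (deriv f) z / deriv f z = g z + z * deriv g z / g z"
    proof -
      have "z * deriv (deriv f) z / deriv f z = z * deriv lam z + z * deriv g z / g z"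
        unfolding f1[OF z] f2[OF z] using gnz[OF z] by (simp add: field_simps)
      then show ?thesis by (simp add: g_def[of z])
    qed
    have 2: "(if z = 0 then 1 else z * deriv f z / f z) = g z"
      using lam(3)[OF z] by (simp add: f1[OF z] g_def)
    show ?thesis unfolding 1 2 H_def by (simp add: algebra_simps)
  qed
  \<comment> \<open>The expression of the hypothesis with \<open>1 - (cmod z)\<^sup>2\<close>
    replaced by a free weight \<open>N\<close>: affine in \<open>N\<close>, holomorphic in
    \<open>z\<close>, and equal to \<open>s + c\<close> at \<open>N = 0\<close>.\<close>
  define X where "X z N = s + c - (c + of_real a * H z) * of_real N" for z N
  have X1: "cmod (X z (1 - (cmod z)\<^sup>2)) \<le> M" if z: "z \<in> unit_disc" for z
  proof -
    have "c * (cmod z)\<^sup>2 + s - a * (1 - (cmod z)\<^sup>2) * H z = X z (1 - (cmod z)\<^sup>2)"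
      by (simp add: X_def algebra_simps)
    then show ?thesis using hyp[rule_format, OF z] unfolding bracket[OF z] by simp
  qed
  have H_hol: "H holomorphic_on unit_disc"
    unfolding H_def by (intro holomorphic_intros g_hol holomorphic_deriv[OF g_hol open_ball]) (use gnz in auto)
  \<comment> \<open>\<open>H\<close> may be unbounded near the circle, so the limit is not taken
    there. For fixed \<open>N = 1 - r\<^sup>2\<close> the maximum principle carries the bound from
    the circle of radius \<open>r\<close> to the origin, where \<open>r\<close> can tend to 1 while
    \<open>H\<close> stays fixed.\<close>
  have scM: "cmod (s + c) \<le> M"
  proof -
    have le: "cmod (X 0 (1 - r\<^sup>2)) \<le> M" if r: "0 < r" "r < 1" for r
    proof (rule maximum_modulus_frontier[where S = "cball 0 r" and f = "\<lambda>z. X z (1 - r\<^sup>2)"])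
      have "(\<lambda>z. X z (1 - r\<^sup>2)) holomorphic_on unit_disc" unfolding X_def by (intro holomorphic_intros H_hol)
      then have "(\<lambda>z. X z (1 - r\<^sup>2)) holomorphic_on cball 0 r" by (rule holomorphic_on_subset) (use r in auto)
      then show "(\<lambda>z. X z (1 - r\<^sup>2)) holomorphic_on interior (cball 0 r)"
        "continuous_on (closure (cball 0 r)) (\<lambda>z. X z (1 - r\<^sup>2))"
        by (auto intro: holomorphic_on_imp_continuous_on elim: holomorphic_on_subset)
      fix z :: complex assume "z \<in> frontier (cball 0 r)"
      then have "cmod z = r" using r by (simp add: frontier_cball)
      then show "cmod (X z (1 - r\<^sup>2)) \<le> M" using X1[of z] r by simp
    qed (use r in auto)
    have "((\<lambda>r. cmod (X 0 (1 - r\<^sup>2))) \<longlongrightarrow> cmod (X 0 (1 - 1\<^sup>2))) (at_left 1)"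
      unfolding X_def by (intro tendsto_intros)
    moreover have "\<forall>\<^sub>F r in at_left 1. cmod (X 0 (1 - r\<^sup>2)) \<le> M"
    proof -
      have "\<forall>\<^sub>F r in at_left (1::real). r \<in> {0<..<1}" by (rule eventually_at_left_real) simp
      then show ?thesis by eventually_elim (use le in auto)
    qed
    ultimately have "cmod (X 0 (1 - 1\<^sup>2)) \<le> M" by (intro tendsto_upperbound) auto
    then show ?thesis by (simp add: X_def)
  qed
  have Mk: "M \<le> k * cmod s"
  proof (cases "a \<le> 1")
    case True
    have "a * (k * cmod s) \<le> 1 * (k * cmod s)" using True k by (intro mult_right_mono) auto
    moreover have "(a - 1) * cmod (s + c) \<le> 0" using True by (intro mult_nonpos_nonneg) auto
    ultimately show ?thesis using True by (simp add: M_def mult.assoc)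
  qed (simp add: M_def)
  have key: "cmod (X (exp v) N) \<le> k * cmod s" if v: "Re v < 0" and N: "0 \<le> N" "N \<le> 1 - exp (2 * Re v / a)" for v N
  proof -
    define x where "x = exp (2 * Re v)"
    have z: "exp v \<in> unit_disc" using v by simp
    have "(cmod (exp v))\<^sup>2 = x" by (simp add: x_def exp_double)
    then have XM: "cmod (X (exp v) (1 - x)) \<le> M" using X1[OF z] by simp
    have x1: "x < 1" using v by (simp add: x_def)
    \<comment> \<open>As \<open>X\<close> is affine in \<open>N\<close>, it is the combination with
      weights \<theta> and \<open>1 - \<theta>\<close> of a value bounded by \<open>M\<close> and of
      \<open>s + c\<close>: convex for \<open>\<theta> \<le> 1\<close>, an extrapolation
      otherwise.\<close>
    define \<theta> where "\<theta> = N / (1 - x)"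
    have \<theta>0: "0 \<le> \<theta>" and N\<theta>: "N = \<theta> * (1 - x)" using N x1 by (auto simp: \<theta>_def)
    have Xcomb: "X (exp v) N = of_real \<theta> * X (exp v) (1 - x) + of_real (1 - \<theta>) * (s + c)"
      by (simp add: X_def N\<theta> algebra_simps)
    have Xle: "cmod (X (exp v) N) \<le> \<theta> * M + \<bar>1 - \<theta>\<bar> * cmod (s + c)"
    proof -
      have "cmod (X (exp v) N) \<le> \<theta> * cmod (X (exp v) (1 - x)) + \<bar>1 - \<theta>\<bar> * cmod (s + c)"
        unfolding Xcomb using norm_triangle_ineq[of "of_real \<theta> * X (exp v) (1 - x)" "of_real (1 - \<theta>) * (s + c)"] \<theta>0
        unfolding norm_mult norm_of_real by simp
      also have "\<dots> \<le> \<theta> * M + \<bar>1 - \<theta>\<bar> * cmod (s + c)" using XM \<theta>0 by (intro add_right_mono mult_left_mono)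
      finally show ?thesis .
    qed
    show ?thesis
    proof (cases "\<theta> \<le> 1")
      case True
      have "\<theta> * M + \<bar>1 - \<theta>\<bar> * cmod (s + c) \<le> \<theta> * (k * cmod s) + (1 - \<theta>) * (k * cmod s)"
        using True \<theta>0 Mk scM order.trans[OF norm_ge_zero scM] by (intro add_mono mult_mono) auto
      then show ?thesis using Xle by (simp add: algebra_simps)
    next
      case False
      have a1: "a \<le> 1"
      proof (rule ccontr)
        assume "\<not> a \<le> 1"
        then have "2 * Re v \<le> 2 * Re v / a" using v a by (simp add: field_simps)
        then have "1 - exp (2 * Re v / a) \<le> 1 - x" by (simp add: x_def)
        then show False using N False x1 by (simp add: \<theta>_def)
      qed
      \<comment> \<open>Convexity of the exponential between 0 and \<open>2 * Re v / a\<close>, with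
        weight \<open>a\<close> at the latter.\<close>
      have "\<theta> * a \<le> 1"
      proof -
        have "exp ((1 - a) * 0 + a * (2 * Re v / a)) \<le> (1 - a) * exp 0 + a * exp (2 * Re v / a)"
          using convex_onD[OF exp_convex, of a 0 "2 * Re v / a"] a a1 by simp
        then have "x \<le> (1 - a) + a * exp (2 * Re v / a)" using a by (simp add: x_def)
        then have "a * (1 - exp (2 * Re v / a)) \<le> 1 - x" by (simp add: algebra_simps)
        moreover have "a * N \<le> a * (1 - exp (2 * Re v / a))" using N a by (intro mult_left_mono) auto
        ultimately have "a * N \<le> 1 - x" by simp
        then show ?thesis using x1 by (simp add: \<theta>_def mult.commute)
      qed
      then have ta: "\<theta> * a * (k * cmod s) \<le> k * cmod s" "0 \<le> (1 - \<theta> * a) * cmod (s + c)"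
        using k mult_right_mono[of "\<theta> * a" 1 "k * cmod s"] by auto
      \<comment> \<open>The coefficient of \<open>cmod (s + c)\<close> is
        \<open>\<theta> * (a - 1) + (\<theta> - 1) = \<theta> * a - 1\<close>, which is not
        positive: this is the purpose of the summand with \<open>a - 1\<close> in
        \<open>M\<close>.\<close>
      have "\<theta> * M + \<bar>1 - \<theta>\<bar> * cmod (s + c) = \<theta> * a * (k * cmod s) - (1 - \<theta> * a) * cmod (s + c)"
        using False a1 by (simp add: M_def algebra_simps)
      then show ?thesis using Xle ta by linarith
    qed
  qed
  \<comment> \<open>A branch of \<open>log (f (exp v))\<close>. It differs from \<open>v\<close> by
    a function of \<open>exp v\<close> that vanishes at 0, whence the periodicity and the
    asymptotics.\<close>
  define \<phi> where "\<phi> v = v + lam (exp v)" for v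
  have ed: "exp v \<in> unit_disc" if "Re v < 0" for v using that by simp
  have d\<phi>: "(\<phi> has_field_derivative g (exp v)) (at v)" if v: "Re v < 0" for v
  proof -
    have "((\<lambda>v. lam (exp v)) has_field_derivative deriv lam (exp v) * exp v) (at v)"
      by (rule DERIV_chain2[OF dlam[OF ed[OF v]] DERIV_exp])
    from DERIV_add[OF DERIV_ident this] show ?thesis
      unfolding \<phi>_def by (rule DERIV_cong) (simp add: g_def)
  qed
  have \<phi>1: "deriv \<phi> v = g (exp v)" if "Re v < 0" for v using d\<phi>[OF that] by (rule DERIV_imp_deriv)
  have \<phi>2: "deriv (deriv \<phi>) v = deriv g (exp v) * exp v" if v: "Re v < 0" for v
  proof (rule DERIV_imp_deriv)
    have "((\<lambda>v. g (exp v)) has_field_derivative deriv g (exp v) * exp v) (at v)"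
      by (rule DERIV_chain2[OF dg[OF ed[OF v]] DERIV_exp])
    then show "(deriv \<phi> has_field_derivative deriv g (exp v) * exp v) (at v)"
      by (rule has_field_derivative_transform_within_open[OF _ open_left_halfplane])
         (use v \<phi>1 in \<open>auto simp: left_halfplane_def\<close>)
  qed
  interpret loewner_extension s c k \<phi> f
  proof
    show "Re s > 0" "0 \<le> k" "k < 1" using a k sb by auto
    show "\<phi> holomorphic_on left_halfplane"
      using d\<phi> open_left_halfplane
      by (auto simp: holomorphic_on_open left_halfplane_def)
    show "f holomorphic_on unit_disc" "f 0 = 0" using fA by (auto simp: classA_def)
    fix v :: complex assume v: "Re v < 0"
    show "\<phi> (v + 2 * of_real pi * \<i>) = \<phi> v + 2 * of_real pi * \<i>"
    proof -
      have "exp (v + 2 * of_real pi * \<i>) = exp v" unfolding exp_eq by (intro exI[of _ 1]) simp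
      then show ?thesis by (simp add: \<phi>_def)
    qed
    show "deriv \<phi> v \<noteq> 0" using \<phi>1[OF v] gnz[OF ed[OF v]] by simp
    show "f (exp v) = exp (\<phi> v)" using lam(3)[OF ed[OF v]] by (simp add: \<phi>_def exp_add)
    fix N assume N: "0 \<le> N" "N \<le> 1 - exp (2 * Re v / Re s)"
    show "cmod (s + c - (c + of_real (Re s) * (deriv \<phi> v + s * deriv (deriv \<phi>) v / deriv \<phi> v)) * of_real N) \<le> k * cmod s"
      using key[OF v N(1)] N(2) unfolding \<phi>1[OF v] \<phi>2[OF v] sb(4) X_def H_def by (simp add: mult_ac)
  next
    fix e :: real assume e: "e > 0"
    have "isCont lam 0" "isCont g 0"
      using dlam[of 0] dg[of 0] by (auto intro: DERIV_isCont)
    then obtain d1 d2 where d: "d1 > 0" "\<And>z. cmod z < d1 \<Longrightarrow> cmod (lam z) < e"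
        "d2 > 0" "\<And>z. cmod z < d2 \<Longrightarrow> cmod (g z - 1) < e"
      using e lam(2) unfolding continuous_at_eps_delta dist_norm by (metis diff_zero g_def add.right_neutral mult_zero_left)
    define L where "L = min (-1) (ln (min d1 d2))"
    have "cmod (\<phi> v - v) < e \<and> cmod (deriv \<phi> v - 1) < e" if v: "Re v < L" for v
    proof -
      have "Re v < ln (min d1 d2)" using v by (simp add: L_def)
      then have "exp (Re v) < min d1 d2" using d by (metis exp_less_cancel_iff exp_ln min_less_iff_conj)
      then have "cmod (exp v) < d1" "cmod (exp v) < d2" by auto
      moreover have "Re v < 0" using v by (simp add: L_def)
      ultimately show ?thesis using d by (simp add: \<phi>_def[of v] \<phi>1)
    qed
    then show "\<exists>L<0. \<forall>v. Re v < L \<longrightarrow> cmod (\<phi> v - v) < e \<and> cmod (deriv \<phi> v - 1) < e"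
      by (intro exI[of _ L]) (auto simp: L_def)
  qed
  obtain F where F: "qc_homeo k F" "\<forall>z\<in>unit_disc. F z = f z"
    using qc_extension by (auto simp: has_qc_extension_def)
  have "qc_homeo l F"
    using F(1) mult_right_mono[OF kl norm_ge_zero] unfolding qc_homeo_def
    by (fast intro: order.trans elim: eventually_mono)
  then show "has_qc_extension l f" using F(2) by (auto simp: has_qc_extension_def)
qed

end
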